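(* Let $d\ge 3$. The singular locus of the $d$th inverse Gaussian moment variety $\mathcal{M}^{\mathrm{IG}}_d\subseteq\mathbb{P}^d$ is the union of the line $m_0=m_1=\cdots=m_{d-2}=0$ and the point $m_1=m_2=\cdots=m_d=0$ in $\mathbb{P}^d$.
   Context: The moments of the inverse Gaussian distribution with parameters $\mu,\lambda$ are given by $m_0=1$, $m_1=\mu$, and $m_i=\frac{2i-3}{\lambda}\mu^2 m_{i-1}+\mu^2 m_{i-2}$ for $i\geq 2$. The inverse Gaussian moment variety $\mathcal{M}^{\mathrm{IG}}_d\subseteq\mathbb{P}^d$ is the Zariski closure of the set of points $[m_0(\mu,\lambda):m_1(\mu,\lambda):\cdots:m_d(\mu,\lambda)]$ with $\mu\in\mathbb{C}$, $\lambda\in\mathbb{C}\setminus\{0\}$ (complex projective space with homogeneous coordinates $m_0,\dots,m_d$). *)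

theory Defs
  imports "HOL-Analysis.Analysis" "HOL-Library.Poly_Mapping" "HOL-Library.Extended_Nat"
    "HOL-Library.Function_Algebras"
begin

section \<open>Complex polynomials in the variables $x_0, x_1, \dots$\<close>

text \<open>An exponent vector is a finitely supported map from variable indices to exponents;
  a polynomial is a finitely supported map from exponent vectors to coefficients, with the
  convolution product of \<^theory>\<open>HOL-Library.Poly_Mapping\<close>.\<close>

type_synonym cpoly = "(nat \<Rightarrow>\<^sub>0 nat) \<Rightarrow>\<^sub>0 complex"

definition monom_eval :: "(nat \<Rightarrow>\<^sub>0 nat) \<Rightarrow> (nat \<Rightarrow> complex) \<Rightarrow> complex" where
  "monom_eval m x = (\<Prod>i\<in>Poly_Mapping.keys m. x i ^ Poly_Mapping.lookup m i)"

definition poly_eval :: "cpoly \<Rightarrow> (nat \<Rightarrow> complex) \<Rightarrow> complex" where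
  "poly_eval f x = (\<Sum>m\<in>Poly_Mapping.keys f. Poly_Mapping.lookup f m * monom_eval m x)"

text \<open>Subtraction of exponents truncates at 0, but then the coefficient is 0 as well.\<close>

definition partial_deriv :: "nat \<Rightarrow> cpoly \<Rightarrow> cpoly" where
  "partial_deriv j f = (\<Sum>m\<in>Poly_Mapping.keys f.
     Poly_Mapping.single (m - Poly_Mapping.single j 1)
       (of_nat (Poly_Mapping.lookup m j) * Poly_Mapping.lookup f m))"

definition polys_upto :: "nat \<Rightarrow> cpoly set" where
  "polys_upto d = {f. \<forall>m\<in>Poly_Mapping.keys f. Poly_Mapping.keys m \<subseteq> {..d}}"

definition homogeneous :: "cpoly \<Rightarrow> bool" where
  "homogeneous f \<longleftrightarrow> (\<exists>k. \<forall>m\<in>Poly_Mapping.keys f.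
     (\<Sum>i\<in>Poly_Mapping.keys m. Poly_Mapping.lookup m i) = k)"

section \<open>Projective space and its Zariski topology\<close>

text \<open>Vectors of $\mathbb{C}^{d+1}$ are functions on the naturals that vanish beyond \<open>d\<close>;
  a point of $\mathbb{P}^d$ is a class of nonzero vectors modulo nonzero scalars.\<close>

definition cvecs :: "nat \<Rightarrow> (nat \<Rightarrow> complex) set" where
  "cvecs d = {x. \<forall>i>d. x i = 0}"

definition cscale :: "complex \<Rightarrow> (nat \<Rightarrow> complex) \<Rightarrow> nat \<Rightarrow> complex" where
  "cscale c x = (\<lambda>i. c * x i)"

interpretation cfun: vector_space cscale
  by unfold_locales (auto simp: cscale_def algebra_simps fun_eq_iff)

definition proj_rel :: "nat \<Rightarrow> ((nat \<Rightarrow> complex) \<times> (nat \<Rightarrow> complex)) set" where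
  "proj_rel d = {(x, y). x \<in> cvecs d - {0} \<and> y \<in> cvecs d - {0} \<and> (\<exists>c. c \<noteq> 0 \<and> y = cscale c x)}"

definition proj_space :: "nat \<Rightarrow> (nat \<Rightarrow> complex) set set" where
  "proj_space d = (cvecs d - {0}) // proj_rel d"

text \<open>The point $[h_0 : \dots : h_d]$; this is the empty set, not a point, if all these
  coordinates vanish.\<close>

definition proj_point :: "nat \<Rightarrow> (nat \<Rightarrow> complex) \<Rightarrow> (nat \<Rightarrow> complex) set" where
  "proj_point d h = proj_rel d `` {\<lambda>i. if i \<le> d then h i else 0}"

definition zero_locus :: "nat \<Rightarrow> cpoly set \<Rightarrow> (nat \<Rightarrow> complex) set set" where
  "zero_locus d S = {P \<in> proj_space d. \<forall>f\<in>S. \<forall>x\<in>P. poly_eval f x = 0}"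

definition zariski :: "nat \<Rightarrow> (nat \<Rightarrow> complex) set topology" where
  "zariski d = topology (\<lambda>U. \<exists>S \<subseteq> {f \<in> polys_upto d. homogeneous f}.
     U = proj_space d - zero_locus d S)"

lemma equiv_proj_rel: "equiv (cvecs d - {0}) (proj_rel d)"
proof (rule equivI)
  show "proj_rel d \<subseteq> (cvecs d - {0}) \<times> (cvecs d - {0})"
    by (auto simp: proj_rel_def)
  show "refl_on (cvecs d - {0}) (proj_rel d)"
    by (auto simp: refl_on_def proj_rel_def cscale_def intro!: exI[of _ 1])
  show "sym (proj_rel d)"
  proof (rule symI)
    fix x y assume "(x, y) \<in> proj_rel d"
    then obtain c where "x \<in> cvecs d - {0}" "y \<in> cvecs d - {0}" "c \<noteq> 0" "y = cscale c x"
      by (auto simp: proj_rel_def)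
    then show "(y, x) \<in> proj_rel d"
      by (auto simp: proj_rel_def cscale_def intro!: exI[of _ "inverse c"])
  qed
  show "trans (proj_rel d)"
  proof (rule transI)
    fix x y z assume "(x, y) \<in> proj_rel d" "(y, z) \<in> proj_rel d"
    then obtain b c where "x \<in> cvecs d - {0}" "z \<in> cvecs d - {0}"
      "b \<noteq> 0" "c \<noteq> 0" "y = cscale b x" "z = cscale c y"
      by (auto simp: proj_rel_def)
    then show "(x, z) \<in> proj_rel d"
      by (auto simp: proj_rel_def cscale_def mult.assoc intro!: exI[of _ "c * b"])
  qed
qed

lemma monom_eval_superset:
  assumes "finite A" "Poly_Mapping.keys m \<subseteq> A"
  shows "monom_eval m x = (\<Prod>i\<in>A. x i ^ Poly_Mapping.lookup m i)"
  unfolding monom_eval_def using assms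
  by (intro prod.mono_neutral_left) (auto simp: in_keys_iff)

lemma monom_eval_add: "monom_eval (m + n) x = monom_eval m x * monom_eval n x"
proof -
  let ?A = "Poly_Mapping.keys m \<union> Poly_Mapping.keys n"
  have "monom_eval (m + n) x = (\<Prod>i\<in>?A. x i ^ Poly_Mapping.lookup (m + n) i)"
    by (rule monom_eval_superset) (auto simp: keys_add)
  also have "\<dots> = (\<Prod>i\<in>?A. x i ^ Poly_Mapping.lookup m i) * (\<Prod>i\<in>?A. x i ^ Poly_Mapping.lookup n i)"
    by (simp add: lookup_add power_add prod.distrib)
  also have "\<dots> = monom_eval m x * monom_eval n x"
    by (simp add: monom_eval_superset[of ?A])
  finally show ?thesis .
qed

lemma poly_eval_superset:
  assumes "finite A" "Poly_Mapping.keys f \<subseteq> A"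
  shows "poly_eval f x = (\<Sum>m\<in>A. Poly_Mapping.lookup f m * monom_eval m x)"
  unfolding poly_eval_def using assms
  by (intro sum.mono_neutral_left) (auto simp: in_keys_iff)

lemma poly_eval_zero [simp]: "poly_eval 0 x = 0"
  by (simp add: poly_eval_def)

lemma poly_eval_add: "poly_eval (f + g) x = poly_eval f x + poly_eval g x"
proof -
  let ?A = "Poly_Mapping.keys f \<union> Poly_Mapping.keys g"
  have "poly_eval (f + g) x = (\<Sum>m\<in>?A. Poly_Mapping.lookup (f + g) m * monom_eval m x)"
    using Poly_Mapping.keys_add[of f g] by (intro poly_eval_superset) auto
  then show ?thesis
    by (simp add: lookup_add algebra_simps sum.distrib poly_eval_superset[of ?A])
qed

lemma poly_eval_sum: "poly_eval (\<Sum>a\<in>A. F a) x = (\<Sum>a\<in>A. poly_eval (F a) x)"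
  by (induction A rule: infinite_finite_induct) (auto simp: poly_eval_add)

lemma poly_eval_single [simp]: "poly_eval (Poly_Mapping.single m c) x = c * monom_eval m x"
  by (simp add: poly_eval_def)

lemma poly_expand: "f = (\<Sum>m\<in>Poly_Mapping.keys f. Poly_Mapping.single m (Poly_Mapping.lookup f m))"
  by (rule poly_mapping_eqI)
     (auto simp: lookup_sum lookup_single when_def in_keys_iff sum.delta)

lemma poly_eval_mult: "poly_eval (f * g) x = poly_eval f x * poly_eval g x"
proof -
  have fg: "f * g = (\<Sum>m\<in>Poly_Mapping.keys f. \<Sum>n\<in>Poly_Mapping.keys g.
      Poly_Mapping.single (m + n) (Poly_Mapping.lookup f m * Poly_Mapping.lookup g n))"
    by (subst poly_expand[of f], subst poly_expand[of g]) (simp add: sum_product mult_single)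
  show ?thesis
    unfolding fg poly_eval_sum poly_eval_single monom_eval_add
    by (simp add: poly_eval_def sum_product algebra_simps)
qed

lemma polys_upto_mult:
  assumes "f \<in> polys_upto d" "g \<in> polys_upto d"
  shows "f * g \<in> polys_upto d"
  unfolding polys_upto_def
proof (clarify)
  fix m i assume "m \<in> Poly_Mapping.keys (f * g)" "i \<in> Poly_Mapping.keys m"
  then obtain a b where "a \<in> Poly_Mapping.keys f" "b \<in> Poly_Mapping.keys g" "m = a + b"
    using keys_mult[of f g] by blast
  with \<open>i \<in> Poly_Mapping.keys m\<close> assms show "i \<le> d"
    using keys_add[of a b] unfolding polys_upto_def by blast
qed

lemma total_degree_add:
  fixes a b :: "nat \<Rightarrow>\<^sub>0 nat"
  shows "(\<Sum>i\<in>Poly_Mapping.keys (a + b). Poly_Mapping.lookup (a + b) i) =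
    (\<Sum>i\<in>Poly_Mapping.keys a. Poly_Mapping.lookup a i) + (\<Sum>i\<in>Poly_Mapping.keys b. Poly_Mapping.lookup b i)"
proof -
  let ?A = "Poly_Mapping.keys a \<union> Poly_Mapping.keys b"
  have *: "(\<Sum>i\<in>Poly_Mapping.keys c. Poly_Mapping.lookup c i) = (\<Sum>i\<in>?A. Poly_Mapping.lookup c i)"
    if "Poly_Mapping.keys c \<subseteq> ?A" for c :: "nat \<Rightarrow>\<^sub>0 nat"
    using that by (intro sum.mono_neutral_left) (auto simp: in_keys_iff)
  show ?thesis
    unfolding *[OF Poly_Mapping.keys_add] *[OF Un_upper1] *[OF Un_upper2]
    by (simp add: lookup_add sum.distrib)
qed

lemma homogeneous_mult:
  assumes "homogeneous f" "homogeneous g"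
  shows "homogeneous (f * g)"
proof -
  obtain k l where
    k: "\<And>m. m \<in> Poly_Mapping.keys f \<Longrightarrow> (\<Sum>i\<in>Poly_Mapping.keys m. Poly_Mapping.lookup m i) = k" and
    l: "\<And>m. m \<in> Poly_Mapping.keys g \<Longrightarrow> (\<Sum>i\<in>Poly_Mapping.keys m. Poly_Mapping.lookup m i) = l"
    using assms unfolding homogeneous_def by blast
  have "(\<Sum>i\<in>Poly_Mapping.keys m. Poly_Mapping.lookup m i) = k + l"
    if m: "m \<in> Poly_Mapping.keys (f * g)" for m
  proof -
    obtain a b where "a \<in> Poly_Mapping.keys f" "b \<in> Poly_Mapping.keys g" "m = a + b"
      using subsetD[OF keys_mult m] by blast
    then show ?thesis using k l by (simp add: total_degree_add)
  qed
  then show ?thesis unfolding homogeneous_def by blast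
qed

lemma monom_eval_scale:
  "monom_eval m (cscale c x) = c ^ (\<Sum>i\<in>Poly_Mapping.keys m. Poly_Mapping.lookup m i) * monom_eval m x"
  by (simp add: monom_eval_def cscale_def power_mult_distrib prod.distrib power_sum)

lemma homogeneous_zero_scale:
  assumes "homogeneous f" "poly_eval f x = 0"
  shows "poly_eval f (cscale c x) = 0"
proof -
  obtain k where
    k: "\<And>m. m \<in> Poly_Mapping.keys f \<Longrightarrow> (\<Sum>i\<in>Poly_Mapping.keys m. Poly_Mapping.lookup m i) = k"
    using assms unfolding homogeneous_def by blast
  have "poly_eval f (cscale c x) = c ^ k * poly_eval f x"
    by (simp add: poly_eval_def monom_eval_scale k sum_distrib_left algebra_simps cong: sum.cong)
  with assms show ?thesis by simp
qed

lemma proj_space_scale: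
  assumes "P \<in> proj_space d" "x \<in> P" "y \<in> P"
  obtains c where "y = cscale c x"
proof -
  have "(x, y) \<in> proj_rel d"
    using assms quotient_eq_iff[OF equiv_proj_rel, of P d P x y] by (simp add: proj_space_def)
  then show ?thesis using that by (auto simp: proj_rel_def)
qed

lemma zero_locus_Un:
  assumes "S \<subseteq> {f \<in> polys_upto d. homogeneous f}" "T \<subseteq> {f \<in> polys_upto d. homogeneous f}"
  shows "zero_locus d S \<union> zero_locus d T = zero_locus d {f * g | f g. f \<in> S \<and> g \<in> T}"
proof (intro equalityI subsetI)
  fix P assume "P \<in> zero_locus d S \<union> zero_locus d T"
  then show "P \<in> zero_locus d {f * g | f g. f \<in> S \<and> g \<in> T}"
    by (auto simp: zero_locus_def poly_eval_mult)
next
  fix P assume P: "P \<in> zero_locus d {f * g | f g. f \<in> S \<and> g \<in> T}"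
  show "P \<in> zero_locus d S \<union> zero_locus d T"
  proof (rule ccontr)
    assume "P \<notin> zero_locus d S \<union> zero_locus d T"
    with P obtain f g x y where fg: "f \<in> S" "x \<in> P" "poly_eval f x \<noteq> 0"
      "g \<in> T" "y \<in> P" "poly_eval g y \<noteq> 0" and PP: "P \<in> proj_space d"
      by (auto simp: zero_locus_def)
    obtain c where "y = cscale c x"
      using proj_space_scale[OF PP fg(2,5)] by blast
    then have "poly_eval g x \<noteq> 0"
      using homogeneous_zero_scale[of g x c] fg assms by auto
    moreover have "poly_eval (f * g) x = 0"
      using P fg unfolding zero_locus_def by blast
    ultimately show False using fg by (simp add: poly_eval_mult)
  qed
qed

lemma istopology_zariski:
  "istopology (\<lambda>U. \<exists>S \<subseteq> {f \<in> polys_upto d. homogeneous f}. U = proj_space d - zero_locus d S)"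
  (is "istopology ?open")
  unfolding istopology_def
proof (intro conjI allI impI)
  fix U V assume "?open U" "?open V"
  then obtain S T where S: "S \<subseteq> {f \<in> polys_upto d. homogeneous f}" "U = proj_space d - zero_locus d S"
    and T: "T \<subseteq> {f \<in> polys_upto d. homogeneous f}" "V = proj_space d - zero_locus d T" by blast
  have "U \<inter> V = proj_space d - zero_locus d {f * g | f g. f \<in> S \<and> g \<in> T}"
    unfolding zero_locus_Un[OF S(1) T(1), symmetric] S T by blast
  moreover have "{f * g | f g. f \<in> S \<and> g \<in> T} \<subseteq> {f \<in> polys_upto d. homogeneous f}"
    using S T by (auto intro: polys_upto_mult homogeneous_mult)
  ultimately show "?open (U \<inter> V)" by blast
next
  fix \<K> assume *: "\<forall>K\<in>\<K>. ?open K"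
  define S where "S = {f \<in> polys_upto d. homogeneous f \<and>
    (\<exists>K T. K \<in> \<K> \<and> f \<in> T \<and> T \<subseteq> {f \<in> polys_upto d. homogeneous f} \<and> K = proj_space d - zero_locus d T)}"
  have "\<Union>\<K> = proj_space d - zero_locus d S"
  proof (intro equalityI subsetI)
    fix P assume "P \<in> \<Union>\<K>"
    then obtain K T where KT: "K \<in> \<K>" "P \<in> K" "T \<subseteq> {f \<in> polys_upto d. homogeneous f}"
      "K = proj_space d - zero_locus d T"
      using * by blast
    then have "T \<subseteq> S" unfolding S_def by blast
    then show "P \<in> proj_space d - zero_locus d S"
      using KT(2) unfolding KT(4) zero_locus_def by blast
  next
    fix P assume P: "P \<in> proj_space d - zero_locus d S"
    then obtain f x where "f \<in> S" "x \<in> P" "poly_eval f x \<noteq> 0"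
      unfolding zero_locus_def by blast
    moreover from \<open>f \<in> S\<close> obtain K T where "K \<in> \<K>" "f \<in> T" "K = proj_space d - zero_locus d T"
      unfolding S_def by blast
    ultimately have "P \<in> K"
      using P unfolding zero_locus_def by blast
    with \<open>K \<in> \<K>\<close> show "P \<in> \<Union>\<K>" by blast
  qed
  moreover have "S \<subseteq> {f \<in> polys_upto d. homogeneous f}"
    unfolding S_def by blast
  ultimately show "?open (\<Union>\<K>)" by blast
qed

lemma openin_zariski:
  "openin (zariski d) U \<longleftrightarrow>
    (\<exists>S \<subseteq> {f \<in> polys_upto d. homogeneous f}. U = proj_space d - zero_locus d S)"
  unfolding zariski_def by (simp add: topology_inverse'[OF istopology_zariski])

lemma topspace_zariski: "topspace (zariski d) = proj_space d"
proof -
  have "poly_eval 1 x = 1" for x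
    using poly_eval_single[of 0 1 x] by (simp add: monom_eval_def)
  then have "zero_locus d {1} = {}"
    using in_quotient_imp_non_empty[OF equiv_proj_rel]
    by (fastforce simp: zero_locus_def proj_space_def)
  moreover have "{1} \<subseteq> {f \<in> polys_upto d. homogeneous f}"
    by (auto simp: polys_upto_def homogeneous_def)
  ultimately have "openin (zariski d) (proj_space d)"
    unfolding openin_zariski by (intro exI[of _ "{1}"]) auto
  then show ?thesis
    by (metis Diff_subset openin_subset openin_topspace openin_zariski subset_antisym)
qed

lemma closedin_zariski:
  "closedin (zariski d) C \<longleftrightarrow> (\<exists>S \<subseteq> {f \<in> polys_upto d. homogeneous f}. C = zero_locus d S)"
proof -
  have "C \<subseteq> proj_space d \<and> proj_space d - C = proj_space d - zero_locus d S \<longleftrightarrow> C = zero_locus d S" for S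
    unfolding zero_locus_def by blast
  then show ?thesis
    unfolding closedin_def topspace_zariski openin_zariski by blast
qed

section \<open>Dimension, tangent spaces, and singular points\<close>

definition irreducible_in :: "'a topology \<Rightarrow> 'a set \<Rightarrow> bool" where
  "irreducible_in T A \<longleftrightarrow> A \<noteq> {} \<and> A \<subseteq> topspace T \<and>
     (\<forall>C D. closedin T C \<longrightarrow> closedin T D \<longrightarrow> A \<subseteq> C \<union> D \<longrightarrow> A \<subseteq> C \<or> A \<subseteq> D)"

text \<open>The local Krull dimension. For a closed subset of $\mathbb{P}^d$ with the induced Zariski
  topology it is the Krull dimension of the local ring at \<open>p\<close>.\<close>

definition local_dim :: "'a topology \<Rightarrow> 'a \<Rightarrow> enat" where
  "local_dim T p = Sup {enat n | n. \<exists>Z :: nat \<Rightarrow> 'a set.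
     p \<in> Z 0 \<and> (\<forall>i\<le>n. closedin T (Z i) \<and> irreducible_in T (Z i)) \<and> (\<forall>i<n. Z i \<subset> Z (Suc i))}"

text \<open>The polynomials need not be homogeneous: requiring them to vanish at all representatives
  of all points of \<open>X\<close> gives the ideal of the affine cone, which is the homogeneous ideal of
  \<open>X\<close>.\<close>

definition vanishing_ideal :: "nat \<Rightarrow> (nat \<Rightarrow> complex) set set \<Rightarrow> cpoly set" where
  "vanishing_ideal d X = {f \<in> polys_upto d. \<forall>P\<in>X. \<forall>x\<in>P. poly_eval f x = 0}"

text \<open>The linear subspace of $\mathbb{C}^{d+1}$ whose projectivization is the embedded projective
  tangent space of \<open>X\<close> at \<open>P\<close>; its vector space dimension is one more than the dimension of the
  Zariski tangent space.\<close>

definition tangent_subspace ::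
  "nat \<Rightarrow> (nat \<Rightarrow> complex) set set \<Rightarrow> (nat \<Rightarrow> complex) set \<Rightarrow> (nat \<Rightarrow> complex) set" where
  "tangent_subspace d X P = {v \<in> cvecs d. \<forall>f\<in>vanishing_ideal d X. \<forall>x\<in>P.
     (\<Sum>j\<le>d. poly_eval (partial_deriv j f) x * v j) = 0}"

text \<open>\<open>P\<close> is singular iff the dimension of the tangent space exceeds that of \<open>X\<close> at \<open>P\<close>.\<close>

definition singular_locus :: "nat \<Rightarrow> (nat \<Rightarrow> complex) set set \<Rightarrow> (nat \<Rightarrow> complex) set set" where
  "singular_locus d X = {P \<in> X.
     local_dim (subtopology (zariski d) X) P + 1 < enat (cfun.dim (tangent_subspace d X P))}"

section \<open>The inverse Gaussian moment variety\<close>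

fun ig_moment :: "complex \<Rightarrow> complex \<Rightarrow> nat \<Rightarrow> complex" where
  "ig_moment \<mu> l 0 = 1"
| "ig_moment \<mu> l (Suc 0) = \<mu>"
| "ig_moment \<mu> l (Suc (Suc n)) =
     (2 * of_nat (Suc (Suc n)) - 3) / l * \<mu>\<^sup>2 * ig_moment \<mu> l (Suc n) + \<mu>\<^sup>2 * ig_moment \<mu> l n"

definition ig_moment_variety :: "nat \<Rightarrow> (nat \<Rightarrow> complex) set set" where
  "ig_moment_variety d =
     zariski d closure_of {proj_point d (ig_moment \<mu> l) | \<mu> l. l \<noteq> 0}"

end

theory Submission
  imports Defs "HOL-Computational_Algebra.Fundamental_Theorem_Algebra"
begin

text \<open>With \<open>a = \<mu>\<^sup>2/\<lambda>\<close> the moments are polynomials in \<open>(\<mu>, a)\<close>, homogeneous when \<open>m\<^sub>i\<close> has degree \<open>i\<close>,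
  so the variety \<open>X\<close> is an irreducible surface. A chain of four irreducible closed subsets would give four
  algebraically independent forms of equal degree; pulled back to the \<open>(\<mu>, a)\<close> plane, their
  monomials outnumber the available bidegrees, so the local dimension is at most 2.

  Eliminating \<open>\<mu>\<close> and \<open>a\<close> from the recurrence shows that \<open>X\<close> consists of the image of \<open>\<mu> \<noteq> 0\<close>, the
  line joining the first and last coordinate points, and the line \<open>m\<^sub>0 = \<dots> = m\<^bsub>d-2\<^esub> = 0\<close>. The same
  equations bound the tangent space on the first two parts, away from the ends of the joining line.

  At the first coordinate point the tangent directions at \<open>\<mu> = 0\<close>, for varying \<open>a\<close>, trace a rational
  normal curve and hence span. Along the line \<open>m\<^sub>0 = \<dots> = m\<^bsub>d-2\<^esub> = 0\<close> there is one branch of \<open>X\<close> for each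
  root of \<open>m\<^sub>d(1, t)\<close>, a Bessel polynomial. The branches are tangent to each other, but those of two
  roots \<open>t\<^sub>1\<^sup>2 \<noteq> t\<^sub>2\<^sup>2\<close> have different second order terms, which forces the coordinate direction \<open>d - 3\<close>
  into the tangent space. Such roots exist because the roots are simple.\<close>

text \<open>Only inequalities with 2 and 3 decide singularity. Since the local dimension is at most
  2 everywhere, four unit vectors in the tangent subspace, those with indices \<open>d - 3\<close>
  to \<open>d\<close>, make a point singular. At the remaining points a chain consisting of the
  point, a curve and X gives local dimension at least 2, and three coordinates determine a tangent
  vector. The ideal of X is never computed. Upper bounds for tangent spaces use a few explicit forms
  in it; lower bounds test an arbitrary member along curves on the cone over X. The line at infinity
  is the delicate case: as \<open>m\<^sub>0 = 1\<close> on the parametrization, it is reached only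
  as the parameters tend to infinity. The assumption \<open>d \<ge> 3\<close> supplies the fourth
  direction \<open>d - 3\<close>, and a polynomial \<open>m\<^sub>d(1, t)\<close> of degree
  \<open>d - 1 \<ge> 2\<close>, hence at least two roots.\<close>

section \<open>Representatives of projective points\<close>

definition trunc :: "nat \<Rightarrow> (nat \<Rightarrow> complex) \<Rightarrow> nat \<Rightarrow> complex" where
  "trunc d h = (\<lambda>i. if i \<le> d then h i else 0)"

lemma trunc_cvecs [simp]: "trunc d h \<in> cvecs d"
  by (simp add: trunc_def cvecs_def)

lemma trunc_eq [simp]: "x \<in> cvecs d \<Longrightarrow> trunc d x = x"
  by (auto simp: trunc_def cvecs_def fun_eq_iff)

lemma trunc_nonzero: "trunc d h \<noteq> 0 \<longleftrightarrow> (\<exists>i\<le>d. h i \<noteq> 0)"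
  by (auto simp: trunc_def fun_eq_iff)

lemma proj_point_trunc: "proj_point d h = proj_rel d `` {trunc d h}"
  by (simp add: proj_point_def trunc_def)

lemma proj_point_in_space: "\<exists>i\<le>d. h i \<noteq> 0 \<Longrightarrow> proj_point d h \<in> proj_space d"
  unfolding proj_point_trunc proj_space_def
  by (intro quotientI) (use trunc_nonzero[of d h] in auto)

lemma proj_point_mem_iff:
  assumes "\<exists>i\<le>d. h i \<noteq> 0"
  shows "x \<in> proj_point d h \<longleftrightarrow> (\<exists>c. c \<noteq> 0 \<and> x = cscale c (trunc d h))"
proof -
  obtain i where i: "i \<le> d" "h i \<noteq> 0" using assms by auto
  have "cscale c (trunc d h) \<in> cvecs d - {0}" if "c \<noteq> 0" for c
  proof -
    have "cscale c (trunc d h) i \<noteq> 0" using that i by (simp add: cscale_def trunc_def)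
    then have "cscale c (trunc d h) \<noteq> 0" by (metis zero_fun_apply)
    then show ?thesis by (simp add: cvecs_def cscale_def trunc_def)
  qed
  moreover have "trunc d h \<in> cvecs d - {0}" using trunc_nonzero[of d h] assms by simp
  ultimately show ?thesis
    by (auto simp: proj_point_trunc proj_rel_def)
qed

lemma trunc_mem_proj_point: "\<exists>i\<le>d. h i \<noteq> 0 \<Longrightarrow> trunc d h \<in> proj_point d h"
  using proj_point_mem_iff[of d h "trunc d h"] by (auto intro!: exI[of _ 1] simp: cscale_def)

lemma proj_space_memD:
  assumes "P \<in> proj_space d" "x \<in> P"
  shows "x \<in> cvecs d" "x \<noteq> 0" "\<exists>i\<le>d. x i \<noteq> 0" "P = proj_point d x"
proof -
  obtain y where y: "y \<in> cvecs d - {0}" "P = proj_rel d `` {y}"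
    using assms(1) unfolding proj_space_def by (auto elim: quotientE)
  then have xy: "(y, x) \<in> proj_rel d" using assms(2) by simp
  then show x: "x \<in> cvecs d" "x \<noteq> 0" by (auto simp: proj_rel_def)
  then show "\<exists>i\<le>d. x i \<noteq> 0" using trunc_nonzero[of d x] by simp
  show "P = proj_point d x"
    unfolding proj_point_trunc y(2) using x equiv_class_eq[OF equiv_proj_rel xy] by simp
qed

lemma proj_space_nonempty: "P \<in> proj_space d \<Longrightarrow> P \<noteq> {}"
  using in_quotient_imp_non_empty[OF equiv_proj_rel] by (simp add: proj_space_def)

section \<open>Forms of a fixed degree\<close>

text \<open>Forms are kept as functions on all sequences, so that sums, products and restrictions to
  curves are pointwise and \<open>igm \<mu> a\<close> can be inserted without truncation. The zero
  function belongs to every degree.\<close>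

definition forms :: "nat \<Rightarrow> nat \<Rightarrow> ((nat \<Rightarrow> complex) \<Rightarrow> complex) set" where
  "forms d k = {poly_eval f | f. f \<in> polys_upto d \<and>
     (\<forall>m\<in>Poly_Mapping.keys f. (\<Sum>i\<in>Poly_Mapping.keys m. Poly_Mapping.lookup m i) = k)}"

lemma homogeneous_forms:
  "f \<in> polys_upto d \<Longrightarrow> homogeneous f \<Longrightarrow> \<exists>k. poly_eval f \<in> forms d k"
  unfolding homogeneous_def forms_def by blast

lemma formsE:
  assumes "g \<in> forms d k"
  obtains f where "g = poly_eval f" "f \<in> polys_upto d" "homogeneous f"
    "\<And>m. m \<in> Poly_Mapping.keys f \<Longrightarrow> (\<Sum>i\<in>Poly_Mapping.keys m. Poly_Mapping.lookup m i) = k"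
  using assms unfolding forms_def homogeneous_def by blast

lemma polys_upto_add: "f \<in> polys_upto d \<Longrightarrow> g \<in> polys_upto d \<Longrightarrow> f + g \<in> polys_upto d"
  using Poly_Mapping.keys_add[of f g] unfolding polys_upto_def by blast

lemma forms_add:
  assumes "f \<in> forms d k" "g \<in> forms d k"
  shows "(\<lambda>x. f x + g x) \<in> forms d k"
proof -
  obtain F where F: "f = poly_eval F" "F \<in> polys_upto d"
    "\<And>m. m \<in> Poly_Mapping.keys F \<Longrightarrow> (\<Sum>i\<in>Poly_Mapping.keys m. Poly_Mapping.lookup m i) = k"
    using assms(1) by (metis formsE)
  obtain G where G: "g = poly_eval G" "G \<in> polys_upto d"
    "\<And>m. m \<in> Poly_Mapping.keys G \<Longrightarrow> (\<Sum>i\<in>Poly_Mapping.keys m. Poly_Mapping.lookup m i) = k"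
    using assms(2) by (metis formsE)
  have "(\<lambda>x. f x + g x) = poly_eval (F + G)"
    by (simp add: F G fun_eq_iff poly_eval_add)
  moreover have "F + G \<in> polys_upto d"
    using F G by (simp add: polys_upto_add)
  moreover have "\<forall>m\<in>Poly_Mapping.keys (F + G). (\<Sum>i\<in>Poly_Mapping.keys m. Poly_Mapping.lookup m i) = k"
    using F(3) G(3) Poly_Mapping.keys_add[of F G] by blast
  ultimately show ?thesis unfolding forms_def by blast
qed

lemma forms_mult:
  assumes "f \<in> forms d k" "g \<in> forms d l"
  shows "(\<lambda>x. f x * g x) \<in> forms d (k + l)"
proof -
  obtain F where F: "f = poly_eval F" "F \<in> polys_upto d"
    "\<And>m. m \<in> Poly_Mapping.keys F \<Longrightarrow> (\<Sum>i\<in>Poly_Mapping.keys m. Poly_Mapping.lookup m i) = k"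
    using assms(1) by (metis formsE)
  obtain G where G: "g = poly_eval G" "G \<in> polys_upto d"
    "\<And>m. m \<in> Poly_Mapping.keys G \<Longrightarrow> (\<Sum>i\<in>Poly_Mapping.keys m. Poly_Mapping.lookup m i) = l"
    using assms(2) by (metis formsE)
  have "(\<lambda>x. f x * g x) = poly_eval (F * G)"
    by (simp add: F G fun_eq_iff poly_eval_mult)
  moreover have "F * G \<in> polys_upto d"
    using F G by (simp add: polys_upto_mult)
  moreover have "(\<Sum>i\<in>Poly_Mapping.keys m. Poly_Mapping.lookup m i) = k + l"
    if m: "m \<in> Poly_Mapping.keys (F * G)" for m
  proof -
    obtain a b where "a \<in> Poly_Mapping.keys F" "b \<in> Poly_Mapping.keys G" "m = a + b"
      using subsetD[OF keys_mult m] by blast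
    then show ?thesis using F G by (simp add: total_degree_add)
  qed
  ultimately show ?thesis unfolding forms_def by blast
qed

lemma forms_const: "(\<lambda>x. c) \<in> forms d 0"
proof -
  have "(\<lambda>x. c) = poly_eval (Poly_Mapping.single 0 c)"
    by (auto simp: fun_eq_iff monom_eval_def)
  moreover have "Poly_Mapping.single 0 c \<in> polys_upto d"
    by (simp add: polys_upto_def)
  ultimately show ?thesis unfolding forms_def by (force split: if_splits)
qed

lemma forms_zero: "(\<lambda>x. 0) \<in> forms d k"
  unfolding forms_def by (intro CollectI exI[of _ 0]) (auto simp: polys_upto_def)

lemma forms_coord:
  assumes "i \<le> d"
  shows "(\<lambda>x. x i) \<in> forms d 1"
proof -
  have "(\<lambda>x. x i) = poly_eval (Poly_Mapping.single (Poly_Mapping.single i 1) 1)"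
    by (auto simp: fun_eq_iff monom_eval_def)
  moreover have "Poly_Mapping.single (Poly_Mapping.single i 1) 1 \<in> polys_upto d"
    using assms by (simp add: polys_upto_def)
  ultimately show ?thesis unfolding forms_def by (force split: if_splits)
qed

lemma forms_cmult: "f \<in> forms d k \<Longrightarrow> (\<lambda>x. c * f x) \<in> forms d k"
  using forms_mult[OF forms_const] by fastforce

lemma forms_diff: "f \<in> forms d k \<Longrightarrow> g \<in> forms d k \<Longrightarrow> (\<lambda>x. f x - g x) \<in> forms d k"
  using forms_add[OF _ forms_cmult[of g d k "-1"], of f] by simp

lemma forms_power: "f \<in> forms d k \<Longrightarrow> (\<lambda>x. f x ^ n) \<in> forms d (n * k)"
proof (induction n)
  case 0
  then show ?case using forms_const[of 1] by simp
next
  case (Suc n)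
  then show ?case using forms_mult[of f d k "\<lambda>x. f x ^ n" "n * k"] by simp
qed

lemma forms_sum: "(\<And>i. i \<in> I \<Longrightarrow> f i \<in> forms d k) \<Longrightarrow> (\<lambda>x. \<Sum>i\<in>I. f i x) \<in> forms d k"
  by (induction I rule: infinite_finite_induct) (auto intro: forms_zero forms_add)

lemma forms_scale:
  assumes "g \<in> forms d k"
  shows "g (cscale c x) = c ^ k * g x"
proof -
  obtain f where f: "g = poly_eval f"
    "\<And>m. m \<in> Poly_Mapping.keys f \<Longrightarrow> (\<Sum>i\<in>Poly_Mapping.keys m. Poly_Mapping.lookup m i) = k"
    using assms by (metis formsE)
  show ?thesis
    by (simp add: f(1) poly_eval_def monom_eval_scale f(2) sum_distrib_left algebra_simps cong: sum.cong)
qed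

lemma poly_eval_cong:
  assumes "f \<in> polys_upto d" "\<And>i. i \<le> d \<Longrightarrow> x i = y i"
  shows "poly_eval f x = poly_eval f y"
proof -
  have "monom_eval m x = monom_eval m y" if m: "m \<in> Poly_Mapping.keys f" for m
  proof -
    have "x i = y i" if "i \<in> Poly_Mapping.keys m" for i
    proof -
      have "i \<le> d" using assms(1) m that unfolding polys_upto_def by blast
      then show ?thesis by (rule assms(2))
    qed
    then show ?thesis unfolding monom_eval_def by (intro prod.cong refl) simp
  qed
  then show ?thesis unfolding poly_eval_def by (intro sum.cong refl) simp
qed

lemma poly_eval_trunc: "f \<in> polys_upto d \<Longrightarrow> poly_eval f (trunc d x) = poly_eval f x"
  by (rule poly_eval_cong[of f d]) (simp_all add: trunc_def)

lemma forms_trunc: "g \<in> forms d k \<Longrightarrow> g (trunc d x) = g x"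
  unfolding forms_def using poly_eval_trunc by blast

lemma forms_vanish_proj_point:
  assumes "g \<in> forms d k" "g h = 0" "\<exists>i\<le>d. h i \<noteq> 0" "x \<in> proj_point d h"
  shows "g x = 0"
  using assms proj_point_mem_iff[of d h x] forms_scale[of g d k] by (auto simp: forms_trunc)

lemma closedin_zariski_hypersurface:
  assumes "g \<in> forms d k"
  shows "closedin (zariski d) {P \<in> proj_space d. \<forall>x\<in>P. g x = 0}"
proof -
  obtain f where "g = poly_eval f" "f \<in> polys_upto d" "homogeneous f"
    using assms by (metis formsE)
  then show ?thesis unfolding closedin_zariski zero_locus_def
    by (intro exI[of _ "{f}"]) auto
qed

text \<open>One defining form of \<open>C\<close> fails at some representative of \<open>P\<close>.
  Representatives are proportional and the form is homogeneous, so it fails at all of them.\<close>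

lemma closedin_zariski_separate:
  assumes "closedin (zariski d) C" "P \<in> proj_space d" "P \<notin> C"
  obtains g k where "g \<in> forms d k" "\<And>Q x. Q \<in> C \<Longrightarrow> x \<in> Q \<Longrightarrow> g x = 0" "\<And>x. x \<in> P \<Longrightarrow> g x \<noteq> 0"
proof -
  obtain S where S: "S \<subseteq> {f \<in> polys_upto d. homogeneous f}" "C = zero_locus d S"
    using assms(1) closedin_zariski by blast
  then obtain f x where f: "f \<in> S" "x \<in> P" "poly_eval f x \<noteq> 0"
    using assms(2,3) unfolding zero_locus_def by blast
  then obtain k where k: "poly_eval f \<in> forms d k" using S homogeneous_forms by blast
  have "poly_eval f y \<noteq> 0" if y: "y \<in> P" for y
  proof -
    obtain c where "x = cscale c y" using proj_space_scale[OF assms(2) y f(2)] by blast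
    then show ?thesis using f forms_scale[OF k] by auto
  qed
  moreover have "poly_eval f y = 0" if "Q \<in> C" "y \<in> Q" for Q y
    using that f(1) unfolding S(2) zero_locus_def by blast
  ultimately show ?thesis by (intro that[OF k])
qed

section \<open>Closures of sets of vectors\<close>

text \<open>Entries of the vectors beyond \<open>d\<close> are ignored, since forms depend on the first \<open>d + 1\<close> only.\<close>

definition proj_closure :: "nat \<Rightarrow> (nat \<Rightarrow> complex) set \<Rightarrow> (nat \<Rightarrow> complex) set set" where
  "proj_closure d A = {P \<in> proj_space d.
     \<forall>k. \<forall>g\<in>forms d k. (\<forall>h\<in>A. g h = 0) \<longrightarrow> (\<forall>x\<in>P. g x = 0)}"

lemma proj_closure_vanish:
  "g \<in> forms d k \<Longrightarrow> (\<And>h. h \<in> A \<Longrightarrow> g h = 0) \<Longrightarrow> P \<in> proj_closure d A \<Longrightarrow> x \<in> P \<Longrightarrow> g x = 0"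
  unfolding proj_closure_def by blast

lemma proj_closure_space: "proj_closure d A \<subseteq> proj_space d"
  by (auto simp: proj_closure_def)

lemma proj_closure_mem:
  "h \<in> A \<Longrightarrow> \<exists>i\<le>d. h i \<noteq> 0 \<Longrightarrow> proj_point d h \<in> proj_closure d A"
  unfolding proj_closure_def using forms_vanish_proj_point proj_point_in_space by blast

lemma closedin_proj_closure: "closedin (zariski d) (proj_closure d A)"
proof -
  define S where "S = {f. f \<in> polys_upto d \<and> homogeneous f \<and> (\<forall>h\<in>A. poly_eval f h = 0)}"
  have "proj_closure d A = zero_locus d S"
  proof (intro equalityI subsetI)
    fix P assume P: "P \<in> proj_closure d A"
    have "poly_eval f x = 0" if f: "f \<in> S" and x: "x \<in> P" for f x
    proof -
      obtain k where "poly_eval f \<in> forms d k"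
        using homogeneous_forms[of f d] f unfolding S_def by blast
      then show ?thesis
        using P f x unfolding S_def proj_closure_def by blast
    qed
    then show "P \<in> zero_locus d S"
      using P unfolding zero_locus_def proj_closure_def by blast
  next
    fix P assume P: "P \<in> zero_locus d S"
    have "g x = 0" if g: "g \<in> forms d k" "\<forall>h\<in>A. g h = 0" and x: "x \<in> P" for g k x
    proof -
      obtain f where "g = poly_eval f" "f \<in> polys_upto d" "homogeneous f"
        using formsE[OF g(1)] by blast
      then have "f \<in> S" using g(2) by (simp add: S_def)
      then show ?thesis
        using P x \<open>g = poly_eval f\<close> unfolding zero_locus_def by blast
    qed
    then show "P \<in> proj_closure d A"
      using P unfolding zero_locus_def proj_closure_def by blast
  qed
  moreover have "S \<subseteq> {f \<in> polys_upto d. homogeneous f}" unfolding S_def by blast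
  ultimately show ?thesis unfolding closedin_zariski by blast
qed

lemma closure_of_proj_points:
  assumes "\<And>h. h \<in> A \<Longrightarrow> \<exists>i\<le>d. h i \<noteq> 0"
  shows "zariski d closure_of (proj_point d ` A) = proj_closure d A"
proof (rule closure_of_unique)
  show "proj_point d ` A \<subseteq> proj_closure d A" using assms proj_closure_mem by blast
  show "closedin (zariski d) (proj_closure d A)" by (rule closedin_proj_closure)
  fix T assume T: "proj_point d ` A \<subseteq> T" "closedin (zariski d) T"
  show "proj_closure d A \<subseteq> T"
  proof
    fix P assume P: "P \<in> proj_closure d A"
    show "P \<in> T"
    proof (rule ccontr)
      assume "P \<notin> T"
      then obtain g k where g: "g \<in> forms d k" "\<And>Q x. Q \<in> T \<Longrightarrow> x \<in> Q \<Longrightarrow> g x = 0" "\<And>x. x \<in> P \<Longrightarrow> g x \<noteq> 0"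
        using closedin_zariski_separate[OF T(2)] P proj_closure_space by (metis subsetD)
      have "g h = 0" if "h \<in> A" for h
      proof -
        have "trunc d h \<in> proj_point d h" by (rule trunc_mem_proj_point[OF assms[OF that]])
        then have "g (trunc d h) = 0" using g(2) T(1) that by blast
        then show ?thesis using forms_trunc[OF g(1)] by simp
      qed
      moreover obtain x where "x \<in> P" using P proj_closure_space proj_space_nonempty by blast
      ultimately show False using g P unfolding proj_closure_def by blast
    qed
  qed
qed

text \<open>The hypothesis \<open>prod\<close> says that the homogeneous ideal of \<open>A\<close>
  is prime, in contrapositive form.\<close>

lemma irreducible_proj_closure:
  assumes X: "closedin (zariski d) X" "proj_closure d A \<subseteq> X"
    and A: "A \<noteq> {}" "\<And>h. h \<in> A \<Longrightarrow> \<exists>i\<le>d. h i \<noteq> 0"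
    and prod: "\<And>f g k l u v. f \<in> forms d k \<Longrightarrow> g \<in> forms d l \<Longrightarrow> u \<in> A \<Longrightarrow> v \<in> A \<Longrightarrow> f u \<noteq> 0 \<Longrightarrow> g v \<noteq> 0 \<Longrightarrow>
       \<exists>w\<in>A. f w \<noteq> 0 \<and> g w \<noteq> 0"
  shows "irreducible_in (subtopology (zariski d) X) (proj_closure d A)"
  unfolding irreducible_in_def
proof (intro conjI allI impI)
  show "proj_closure d A \<noteq> {}" using A proj_closure_mem by blast
  show "proj_closure d A \<subseteq> topspace (subtopology (zariski d) X)"
    using X proj_closure_space by (simp add: topspace_subtopology topspace_zariski)
  fix C D assume "closedin (subtopology (zariski d) X) C" "closedin (subtopology (zariski d) X) D"
  then have CD: "closedin (zariski d) C" "closedin (zariski d) D"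
    using X(1) closedin_closed_subtopology by blast+
  assume sub: "proj_closure d A \<subseteq> C \<union> D"
  have *: "\<exists>f k u. f \<in> forms d k \<and> u \<in> A \<and> f u \<noteq> 0 \<and> (\<forall>Q\<in>E. \<forall>x\<in>Q. f x = 0)"
    if E: "closedin (zariski d) E" "\<not> proj_closure d A \<subseteq> E" for E
  proof -
    obtain P where P: "P \<in> proj_closure d A" "P \<notin> E" using E by blast
    obtain f k where f: "f \<in> forms d k" "\<And>Q x. Q \<in> E \<Longrightarrow> x \<in> Q \<Longrightarrow> f x = 0" "\<And>x. x \<in> P \<Longrightarrow> f x \<noteq> 0"
      using closedin_zariski_separate[OF E(1)] P proj_closure_space by (metis subsetD)
    have "\<exists>u\<in>A. f u \<noteq> 0"
    proof (rule ccontr)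
      assume "\<not> ?thesis"
      then have "\<forall>x\<in>P. f x = 0" using proj_closure_vanish[OF f(1) _ P(1)] by blast
      then show False using f(3) P proj_closure_space proj_space_nonempty by blast
    qed
    then show ?thesis using f by blast
  qed
  show "proj_closure d A \<subseteq> C \<or> proj_closure d A \<subseteq> D"
  proof (rule ccontr)
    assume "\<not> ?thesis"
    then have n: "\<not> proj_closure d A \<subseteq> C" "\<not> proj_closure d A \<subseteq> D" by auto
    obtain f k u where
      f: "f \<in> forms d k" "u \<in> A" "f u \<noteq> 0" "\<forall>Q\<in>C. \<forall>x\<in>Q. f x = 0"
      using *[OF CD(1) n(1)] by auto
    obtain g l v where
      g: "g \<in> forms d l" "v \<in> A" "g v \<noteq> 0" "\<forall>Q\<in>D. \<forall>x\<in>Q. g x = 0"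
      using *[OF CD(2) n(2)] by auto
    obtain w where w: "w \<in> A" "f w \<noteq> 0" "g w \<noteq> 0"
      using prod[OF f(1) g(1) f(2) g(2) f(3) g(3)] by blast
    have "trunc d w \<in> proj_point d w" by (rule trunc_mem_proj_point[OF A(2)[OF w(1)]])
    moreover have "proj_point d w \<in> C \<union> D"
      using sub proj_closure_mem[OF w(1) A(2)[OF w(1)]] by blast
    ultimately show False using f g w forms_trunc[OF f(1)] forms_trunc[OF g(1)] by force
  qed
qed

section \<open>Irreducibility by polynomial curves\<close>

lemma poly_eval_along_curve:
  assumes "f \<in> polys_upto d" "\<And>i. i \<le> d \<Longrightarrow> \<exists>q. \<forall>s. \<gamma> s i = poly q s"
  shows "\<exists>q. \<forall>s. poly_eval f (\<gamma> s) = poly q s"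
proof -
  obtain Q where Q: "\<And>i s. i \<le> d \<Longrightarrow> \<gamma> s i = poly (Q i) s" using assms(2) by metis
  have *: "monom_eval m (\<gamma> s) = poly (\<Prod>i\<in>Poly_Mapping.keys m. Q i ^ Poly_Mapping.lookup m i) s"
    if m: "m \<in> Poly_Mapping.keys f" for m s
  proof -
    have "\<gamma> s i = poly (Q i) s" if "i \<in> Poly_Mapping.keys m" for i
      using assms(1) m that Q unfolding polys_upto_def by blast
    then show ?thesis unfolding monom_eval_def poly_prod by (intro prod.cong refl) simp
  qed
  have "poly_eval f (\<gamma> s) = poly (\<Sum>m\<in>Poly_Mapping.keys f. smult (Poly_Mapping.lookup f m)
      (\<Prod>i\<in>Poly_Mapping.keys m. Q i ^ Poly_Mapping.lookup m i)) s" for s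
    unfolding poly_eval_def poly_sum by (intro sum.cong refl) (simp add: *)
  then show ?thesis by blast
qed

lemma forms_along_curve:
  "g \<in> forms d k \<Longrightarrow> (\<And>i. i \<le> d \<Longrightarrow> \<exists>q. \<forall>s. \<gamma> s i = poly q s) \<Longrightarrow> \<exists>q. \<forall>s. g (\<gamma> s) = poly q s"
  unfolding forms_def using poly_eval_along_curve by fastforce

text \<open>Two forms, one nonzero at each end of a polynomial curve inside \<open>A\<close>,
  restrict to nonzero univariate polynomials. Their product has a non-root, and there both forms are
  nonzero.\<close>

lemma irreducible_proj_closure_curves:
  assumes X: "closedin (zariski d) X" "proj_closure d A \<subseteq> X"
    and A: "A \<noteq> {}" "\<And>h. h \<in> A \<Longrightarrow> \<exists>i\<le>d. h i \<noteq> 0"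
    and curve: "\<And>u v. u \<in> A \<Longrightarrow> v \<in> A \<Longrightarrow>
       \<exists>\<gamma>. \<gamma> 0 = u \<and> \<gamma> 1 = v \<and> (\<forall>s. \<gamma> s \<in> A) \<and> (\<forall>i\<le>d. \<exists>q. \<forall>s. \<gamma> s i = poly q s)"
  shows "irreducible_in (subtopology (zariski d) X) (proj_closure d A)"
proof (rule irreducible_proj_closure[OF X A])
  fix f g k l u v
  assume fg: "f \<in> forms d k" "g \<in> forms d l" "u \<in> A" "v \<in> A" "f u \<noteq> 0" "g v \<noteq> 0"
  obtain \<gamma> where \<gamma>: "\<gamma> 0 = u" "\<gamma> 1 = v" "\<And>s. \<gamma> s \<in> A" "\<And>i. i \<le> d \<Longrightarrow> \<exists>q. \<forall>s. \<gamma> s i = poly q s"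
    using curve[OF fg(3,4)] by auto
  obtain p where p: "\<And>s. f (\<gamma> s) = poly p s" using forms_along_curve[OF fg(1), of \<gamma>] \<gamma>(4) by auto
  obtain q where q: "\<And>s. g (\<gamma> s) = poly q s" using forms_along_curve[OF fg(2), of \<gamma>] \<gamma>(4) by auto
  have "p \<noteq> 0" "q \<noteq> 0" using p[of 0] q[of 1] fg \<gamma>(1,2) by auto
  then have "finite {s. poly (p * q) s = 0}" by (intro poly_roots_finite) simp
  then obtain s where "poly (p * q) s \<noteq> 0"
    using ex_new_if_finite[of "{s. poly (p * q) s = 0}"] infinite_UNIV_char_0 by auto
  then show "\<exists>w\<in>A. f w \<noteq> 0 \<and> g w \<noteq> 0"
    using \<gamma>(3)[of s] p q by (intro bexI[of _ "\<gamma> s"]) auto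
qed simp_all

section \<open>The parametrization\<close>

fun igm :: "complex \<Rightarrow> complex \<Rightarrow> nat \<Rightarrow> complex" where
  "igm \<mu> a 0 = 1"
| "igm \<mu> a (Suc 0) = \<mu>"
| "igm \<mu> a (Suc (Suc n)) = (2 * of_nat n + 1) * a * igm \<mu> a (Suc n) + \<mu>\<^sup>2 * igm \<mu> a n"

lemma ig_moment_igm: "ig_moment \<mu> l n = igm \<mu> (\<mu>\<^sup>2 / l) n"
  by (induction \<mu> l n rule: ig_moment.induct) (simp_all add: field_simps)

lemma igm_mu_zero: "n > 0 \<Longrightarrow> igm 0 a n = 0"
  by (induction "0::complex" a n rule: igm.induct) simp_all

lemma igm_poly: "\<exists>q. \<forall>s. igm (poly p s) (poly r s) n = poly q s"
proof (induction n rule: induct_nat_012)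
  case 0
  show ?case by (intro exI[of _ 1]) simp
next
  case 1
  show ?case by (intro exI[of _ p]) simp
next
  case (ge2 n)
  then obtain q1 q2 where "\<And>s. igm (poly p s) (poly r s) n = poly q1 s"
    "\<And>s. igm (poly p s) (poly r s) (Suc n) = poly q2 s" by blast
  then show ?case
    by (intro exI[of _ "smult (2 * of_nat n + 1) (r * q2) + p\<^sup>2 * q1"]) (simp add: mult.assoc)
qed

definition igms :: "(nat \<Rightarrow> complex) set" where
  "igms = {igm \<mu> a | \<mu> a. True}"

lemma igms_nonzero: "h \<in> igms \<Longrightarrow> \<exists>i\<le>d. h i \<noteq> 0"
  by (auto simp: igms_def intro!: exI[of _ 0])

lemma igms_nonempty: "igms \<noteq> {}"
  by (auto simp: igms_def)

text \<open>This carries vanishing along a polynomial curve over to a limit point at which the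
  parametrization itself breaks down.\<close>

lemma poly_zero_except_point:
  fixes q :: "complex poly"
  assumes "\<And>s. s \<noteq> c \<Longrightarrow> poly q s = 0"
  shows "q = 0"
proof (rule ccontr)
  assume "q \<noteq> 0"
  then have "finite (insert c {s. poly q s = 0})" by (simp add: poly_roots_finite)
  moreover have "insert c {s. poly q s = 0} = UNIV" using assms by blast
  ultimately show False using infinite_UNIV_char_0 by metis
qed

text \<open>The parameters \<mu> and \<open>a = \<mu>\<^sup>2/\<lambda>\<close> add only the points
  with \<open>a = 0\<close> and \<mu> \<noteq> 0, where \<lambda> would be infinite; a form that
  vanishes for all other \<open>a\<close> is a polynomial in \<open>a\<close> and vanishes there
  too. For \<mu> = 0 the moments do not depend on \<open>a\<close>.\<close>

lemma ig_moment_variety_eq: "ig_moment_variety d = proj_closure d igms"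
proof -
  define A where "A = {ig_moment \<mu> l | \<mu> l. l \<noteq> 0}"
  have "ig_moment_variety d = zariski d closure_of (proj_point d ` A)"
    unfolding ig_moment_variety_def A_def by (rule arg_cong[where f = "\<lambda>S. zariski d closure_of S"]) blast
  also have "\<dots> = proj_closure d A"
    by (rule closure_of_proj_points) (auto simp: A_def intro!: exI[of _ 0])
  also have "\<dots> = proj_closure d igms"
  proof -
    have "g h = 0" if g: "g \<in> forms d k" "\<forall>h\<in>A. g h = 0" and h: "h \<in> igms" for g k h
    proof -
      obtain \<mu> a where h: "h = igm \<mu> a" using h by (auto simp: igms_def)
      have gA: "g (igm \<mu> (\<mu>\<^sup>2 / l)) = 0" if "l \<noteq> 0" for \<mu> l
      proof -
        have "ig_moment \<mu> l = igm \<mu> (\<mu>\<^sup>2 / l)" using ig_moment_igm by (intro ext)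
        then have "igm \<mu> (\<mu>\<^sup>2 / l) \<in> A" using that unfolding A_def by (metis (mono_tags, lifting) mem_Collect_eq)
        then show ?thesis using g(2) by blast
      qed
      show ?thesis
      proof (cases "\<mu> = 0")
        case True
        have "igm 0 a n = igm 0 0 n" for n by (cases n) (simp_all add: igm_mu_zero)
        then have "h = igm 0 0" using h True by auto
        then show ?thesis using gA[of 1 0] by simp
      next
        case False
        obtain q where q: "\<And>s. g (igm \<mu> s) = poly q s"
          using forms_along_curve[OF g(1), of "igm \<mu>"] igm_poly[of "[:\<mu>:]" "[:0,1:]"] by auto
        have "poly q s = 0" if "s \<noteq> 0" for s
          using gA[of "\<mu>\<^sup>2 / s" \<mu>] False that q by simp
        then have "q = 0" by (rule poly_zero_except_point)
        then show ?thesis using q h by simp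
      qed
    qed
    moreover have "A \<subseteq> igms" unfolding A_def igms_def using ig_moment_igm by fastforce
    ultimately show ?thesis unfolding proj_closure_def by blast
  qed
  finally show ?thesis .
qed

section \<open>Upper bound for the dimension\<close>

text \<open>Bounding the degree in each variable separately gives a box of exponents, hence a linear
  system with exactly \<open>(L + 1)\<^sup>2\<close> equations when coefficients are
  compared.\<close>

definition bipoly :: "nat \<Rightarrow> (complex \<Rightarrow> complex \<Rightarrow> complex) set" where
  "bipoly L = {h. \<exists>w. \<forall>\<mu> a. h \<mu> a = (\<Sum>(p, q)\<in>{..L} \<times> {..L}. w (p, q) * (\<mu> ^ p * a ^ q))}"

lemma bipoly_monom: "p \<le> L \<Longrightarrow> q \<le> L \<Longrightarrow> (\<lambda>\<mu> a. \<mu> ^ p * a ^ q) \<in> bipoly L"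
proof -
  assume pq: "p \<le> L" "q \<le> L"
  have "\<mu> ^ p * a ^ q = (\<Sum>(p', q')\<in>{..L} \<times> {..L}. (if (p', q') = (p, q) then 1 else 0) * (\<mu> ^ p' * a ^ q'))"
    for \<mu> a :: complex
  proof -
    have "(\<Sum>(p', q')\<in>{..L} \<times> {..L}. (if (p', q') = (p, q) then 1 else 0) * (\<mu> ^ p' * a ^ q')) =
      (\<Sum>z\<in>{..L} \<times> {..L}. if z = (p, q) then \<mu> ^ p * a ^ q else 0)"
      by (intro sum.cong) (auto split: if_splits)
    then show ?thesis using pq by (simp add: sum.delta)
  qed
  then show ?thesis unfolding bipoly_def by (intro CollectI exI[of _ "\<lambda>z. if z = (p, q) then 1 else 0"]) blast
qed

lemma bipoly_add: "f \<in> bipoly L \<Longrightarrow> g \<in> bipoly L \<Longrightarrow> (\<lambda>\<mu> a. f \<mu> a + g \<mu> a) \<in> bipoly L"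
proof -
  assume "f \<in> bipoly L" "g \<in> bipoly L"
  then obtain v w where
    "\<And>\<mu> a. f \<mu> a = (\<Sum>(p, q)\<in>{..L} \<times> {..L}. v (p, q) * (\<mu> ^ p * a ^ q))"
    "\<And>\<mu> a. g \<mu> a = (\<Sum>(p, q)\<in>{..L} \<times> {..L}. w (p, q) * (\<mu> ^ p * a ^ q))"
    unfolding bipoly_def by blast
  then show ?thesis unfolding bipoly_def
    by (intro CollectI exI[of _ "\<lambda>z. v z + w z"])
       (simp add: case_prod_unfold sum.distrib algebra_simps)
qed

lemma bipoly_cmult: "f \<in> bipoly L \<Longrightarrow> (\<lambda>\<mu> a. c * f \<mu> a) \<in> bipoly L"
proof -
  assume "f \<in> bipoly L"
  then obtain v where
    "\<And>\<mu> a. f \<mu> a = (\<Sum>(p, q)\<in>{..L} \<times> {..L}. v (p, q) * (\<mu> ^ p * a ^ q))"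
    unfolding bipoly_def by blast
  then show ?thesis unfolding bipoly_def
    by (intro CollectI exI[of _ "\<lambda>z. c * v z"])
       (simp add: case_prod_unfold sum_distrib_left algebra_simps)
qed

lemma bipoly_sum: "(\<And>i. i \<in> I \<Longrightarrow> f i \<in> bipoly L) \<Longrightarrow> (\<lambda>\<mu> a. \<Sum>i\<in>I. f i \<mu> a) \<in> bipoly L"
proof (induction I rule: infinite_finite_induct)
  case (insert x F)
  then show ?case using bipoly_add[of "f x" L] by auto
qed (use bipoly_cmult[OF bipoly_monom[of 0 L 0], of 0] in simp_all)

lemma bipoly_mult:
  assumes "f \<in> bipoly L" "g \<in> bipoly M"
  shows "(\<lambda>\<mu> a. f \<mu> a * g \<mu> a) \<in> bipoly (L + M)"
proof -
  obtain v where
    v: "\<And>\<mu> a. f \<mu> a = (\<Sum>z\<in>{..L} \<times> {..L}. v z * (\<mu> ^ fst z * a ^ snd z))"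
    using assms(1) unfolding bipoly_def case_prod_unfold by auto
  obtain w where
    w: "\<And>\<mu> a. g \<mu> a = (\<Sum>z\<in>{..M} \<times> {..M}. w z * (\<mu> ^ fst z * a ^ snd z))"
    using assms(2) unfolding bipoly_def case_prod_unfold by auto
  have "(\<lambda>\<mu> a. f \<mu> a * g \<mu> a) = (\<lambda>\<mu> a. \<Sum>z\<in>{..L} \<times> {..L}. \<Sum>y\<in>{..M} \<times> {..M}.
      (v z * w y) * (\<mu> ^ (fst z + fst y) * a ^ (snd z + snd y)))"
    by (simp add: fun_eq_iff v w sum_product power_add mult_ac)
  also have "\<dots> \<in> bipoly (L + M)"
    by (intro bipoly_sum bipoly_cmult bipoly_monom) auto
  finally show ?thesis .
qed

lemma bipoly_const: "(\<lambda>\<mu> a. c) \<in> bipoly L"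
  using bipoly_cmult[OF bipoly_monom[of 0 L 0], of c] by simp

lemma bipoly_mono: "f \<in> bipoly L \<Longrightarrow> L \<le> M \<Longrightarrow> f \<in> bipoly M"
  using bipoly_mult[OF _ bipoly_const[of 1 "M - L"], of f L] by simp

lemma bipoly_power: "f \<in> bipoly L \<Longrightarrow> (\<lambda>\<mu> a. f \<mu> a ^ n) \<in> bipoly (n * L)"
proof (induction n)
  case 0
  show ?case using bipoly_const[of 1] by simp
next
  case (Suc n)
  then show ?case using bipoly_mult[of f L "\<lambda>\<mu> a. f \<mu> a ^ n" "n * L"] by simp
qed

lemma bipoly_prod:
  "finite I \<Longrightarrow> (\<And>i. i \<in> I \<Longrightarrow> f i \<in> bipoly (L i)) \<Longrightarrow> (\<lambda>\<mu> a. \<Prod>i\<in>I. f i \<mu> a) \<in> bipoly (\<Sum>i\<in>I. L i)"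
proof (induction I rule: finite_induct)
  case empty
  show ?case using bipoly_const[of 1] by simp
next
  case (insert x F)
  then show ?case using bipoly_mult[of "f x" "L x" "\<lambda>\<mu> a. \<Prod>i\<in>F. f i \<mu> a" "\<Sum>i\<in>F. L i"] by simp
qed

lemma igm_bipoly: "(\<lambda>\<mu> a. igm \<mu> a n) \<in> bipoly n"
proof (induction n rule: induct_nat_012)
  case 0
  show ?case using bipoly_const[of 1] by simp
next
  case 1
  show ?case using bipoly_monom[of 1 1 0] by simp
next
  case (ge2 n)
  have "(\<lambda>\<mu> a. a * igm \<mu> a (Suc n)) \<in> bipoly (Suc (Suc n))"
    using bipoly_mult[OF bipoly_monom[of 0 1 1] ge2(2)] by simp
  moreover have "(\<lambda>\<mu> a. \<mu>\<^sup>2 * igm \<mu> a n) \<in> bipoly (Suc (Suc n))"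
    using bipoly_mult[OF bipoly_monom[of 2 2 0] ge2(1)] by simp
  ultimately show ?case
    using bipoly_add[OF bipoly_cmult[of "\<lambda>\<mu> a. a * igm \<mu> a (Suc n)" _ "2 * of_nat n + 1"]]
    by (simp add: mult.assoc)
qed

lemma forms_igm_bipoly:
  assumes "g \<in> forms d k"
  shows "(\<lambda>\<mu> a. g (igm \<mu> a)) \<in> bipoly (k * d)"
proof -
  obtain f where f: "g = poly_eval f" "f \<in> polys_upto d"
    "\<And>m. m \<in> Poly_Mapping.keys f \<Longrightarrow> (\<Sum>i\<in>Poly_Mapping.keys m. Poly_Mapping.lookup m i) = k"
    using formsE[OF assms] by blast
  have "(\<lambda>\<mu> a. monom_eval m (igm \<mu> a)) \<in> bipoly (k * d)" if m: "m \<in> Poly_Mapping.keys f" for m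
  proof -
    have "(\<lambda>\<mu> a. igm \<mu> a i) \<in> bipoly d" if "i \<in> Poly_Mapping.keys m" for i
    proof -
      have "i \<le> d" using f(2) m that unfolding polys_upto_def by blast
      then show ?thesis using bipoly_mono igm_bipoly by blast
    qed
    then have "(\<lambda>\<mu> a. monom_eval m (igm \<mu> a)) \<in>
        bipoly (\<Sum>i\<in>Poly_Mapping.keys m. Poly_Mapping.lookup m i * d)"
      unfolding monom_eval_def by (intro bipoly_prod bipoly_power) simp_all
    then show ?thesis using f(3)[OF m] by (simp add: sum_distrib_right[symmetric])
  qed
  then show ?thesis
    unfolding f(1) poly_eval_def by (intro bipoly_sum bipoly_cmult)
qed

text \<open>Gaussian elimination: the equation \<open>j\<close> is solved for a pivot
  \<open>i0\<close> and substituted into the others, which leaves one equation and one unknown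
  fewer.\<close>

lemma underdetermined_system:
  fixes v :: "'i \<Rightarrow> 'j \<Rightarrow> 'a::field"
  assumes "finite J" "finite I" "card J < card I"
  shows "\<exists>c. (\<exists>i\<in>I. c i \<noteq> 0) \<and> (\<forall>j\<in>J. (\<Sum>i\<in>I. c i * v i j) = 0)"
  using assms
proof (induction J arbitrary: I v rule: finite_induct)
  case empty
  then have "I \<noteq> {}" by auto
  then show ?case by (intro exI[of _ "\<lambda>_. 1"]) auto
next
  case (insert j J)
  show ?case
  proof (cases "\<forall>i\<in>I. v i j = 0")
    case True
    have "card J < card I" using insert by simp
    then obtain c where "\<exists>i\<in>I. c i \<noteq> 0" "\<forall>j\<in>J. (\<Sum>i\<in>I. c i * v i j) = 0"
      using insert.IH[of I v] insert.prems by blast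
    then show ?thesis using True by (intro exI[of _ c]) auto
  next
    case False
    then obtain i0 where i0: "i0 \<in> I" "v i0 j \<noteq> 0" by blast
    define I' where "I' = I - {i0}"
    have I': "finite I'" "card J < card I'" using insert i0 by (auto simp: I'_def)
    obtain c' where c': "\<exists>i\<in>I'. c' i \<noteq> 0"
      "\<And>k. k \<in> J \<Longrightarrow> (\<Sum>i\<in>I'. c' i * (v i k - v i j / v i0 j * v i0 k)) = 0"
      using insert.IH[OF I', of "\<lambda>i k. v i k - v i j / v i0 j * v i0 k"] by blast
    \<comment> \<open>The value at the pivot is the one that makes the equation \<open>j\<close>
      hold.\<close>
    define c where "c = c' (i0 := - (\<Sum>i\<in>I'. c' i * v i j) / v i0 j)"
    have I: "I = insert i0 I'" "i0 \<notin> I'" using i0 by (auto simp: I'_def)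
    have sumc: "(\<Sum>i\<in>I. c i * v i k) =
        (\<Sum>i\<in>I'. c' i * v i k) - (\<Sum>i\<in>I'. c' i * v i j) / v i0 j * v i0 k" for k
    proof -
      have "(\<Sum>i\<in>I'. c i * v i k) = (\<Sum>i\<in>I'. c' i * v i k)"
        using I(2) by (intro sum.cong) (auto simp: c_def)
      then show ?thesis unfolding I(1) using I' I(2) by (simp add: c_def)
    qed
    have "(\<Sum>i\<in>I. c i * v i k) = 0" if "k \<in> J" for k
    proof -
      have "(\<Sum>i\<in>I'. c' i * (v i k - v i j / v i0 j * v i0 k)) =
        (\<Sum>i\<in>I'. c' i * v i k) - (\<Sum>i\<in>I'. c' i * v i j) / v i0 j * v i0 k"
        by (simp add: right_diff_distrib sum_subtractf sum_distrib_right sum_divide_distrib mult.assoc)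
      then show ?thesis using c'(2)[OF that] sumc[of k] by simp
    qed
    moreover have "(\<Sum>i\<in>I. c i * v i j) = 0" using i0 sumc[of j] by simp
    moreover have "\<exists>i\<in>I. c i \<noteq> 0" using c'(1) I by (auto simp: c_def)
    ultimately show ?thesis by (intro exI[of _ c]) auto
  qed
qed

section \<open>Algebraic relations along a chain of irreducible closed sets\<close>

definition vanishes_on :: "((nat \<Rightarrow> complex) \<Rightarrow> complex) \<Rightarrow> (nat \<Rightarrow> complex) set set \<Rightarrow> bool" where
  "vanishes_on f Z \<longleftrightarrow> (\<forall>P\<in>Z. \<forall>x\<in>P. f x = 0)"

text \<open>The ideal of \<open>Z\<close> is prime: the zero sets of the two forms are closed and
  together cover \<open>Z\<close>, because nonvanishing at one representative of a point passes to
  all of them.\<close>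

lemma irreducible_in_zariski_mult:
  assumes "irreducible_in (subtopology (zariski d) X) Z" "f \<in> forms d k" "g \<in> forms d l"
    and "vanishes_on (\<lambda>x. f x * g x) Z"
  shows "vanishes_on f Z \<or> vanishes_on g Z"
proof -
  define V where "V h = X \<inter> {P \<in> proj_space d. \<forall>x\<in>P. h x = 0}" for h :: "(nat \<Rightarrow> complex) \<Rightarrow> complex"
  have cl: "closedin (subtopology (zariski d) X) (V h)" if "h \<in> forms d j" for h j
    unfolding V_def closedin_subtopology using closedin_zariski_hypersurface[OF that] by blast
  have ZX: "Z \<subseteq> X" "Z \<subseteq> proj_space d"
    using assms(1) by (auto simp: irreducible_in_def topspace_subtopology topspace_zariski)
  have "Z \<subseteq> V f \<union> V g"
  proof
    fix P assume P: "P \<in> Z"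
    show "P \<in> V f \<union> V g"
    proof (rule ccontr)
      assume "P \<notin> V f \<union> V g"
      then obtain x y where xy: "x \<in> P" "f x \<noteq> 0" "y \<in> P" "g y \<noteq> 0"
        using P ZX unfolding V_def by blast
      obtain c where "y = cscale c x" using proj_space_scale xy P ZX by blast
      then have "g x \<noteq> 0" using xy forms_scale[OF assms(3)] by auto
      then show False using assms(4) P xy unfolding vanishes_on_def by auto
    qed
  qed
  then have "Z \<subseteq> V f \<or> Z \<subseteq> V g"
    using assms(1) cl[OF assms(2)] cl[OF assms(3)] unfolding irreducible_in_def by blast
  then show ?thesis unfolding V_def vanishes_on_def by blast
qed

text \<open>As \<open>Z'\<close> is irreducible, the relation may be divided by \<open>f ^ k0\<close>; restrict the quotient to \<open>Z\<close>.\<close>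

lemma lowest_coefficient_vanishes:
  assumes irr: "irreducible_in (subtopology (zariski d) X) Z'"
    and f: "f \<in> forms d D" "\<not> vanishes_on f Z'" "vanishes_on f Z" "Z \<subseteq> Z'"
    and G: "\<And>k. k < N \<Longrightarrow> G k \<in> forms d (E - k * D)" "N * D \<le> E"
    and rel: "vanishes_on (\<lambda>x. \<Sum>k<N. G k x * f x ^ k) Z'"
    and k0: "k0 < N" "\<And>k x. k < k0 \<Longrightarrow> G k x = 0"
  shows "vanishes_on (G k0) Z"
proof -
  define H where "H x = (\<Sum>k=k0..<N. G k x * f x ^ (k - k0))" for x
  have "(\<lambda>x. G k x * f x ^ (k - k0)) \<in> forms d (E - k0 * D)" if k: "k \<in> {k0..<N}" for k
  proof -
    obtain e where e: "k = k0 + e" using k le_Suc_ex[of k0 k] by auto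
    have "k * D \<le> N * D" using that by (intro mult_le_mono1) simp
    \<comment> \<open>The bound \<open>N * D \<le> E\<close> keeps the subtractions in the degrees
      from truncating.\<close>
    then have "k0 * D + e * D \<le> E" using G(2) by (simp add: e add_mult_distrib)
    then have "E - k * D + (k - k0) * D = E - k0 * D" by (simp add: e add_mult_distrib)
    then show ?thesis using forms_mult[OF G(1)[of k] forms_power[OF f(1), of "k - k0"]] that by simp
  qed
  then have H: "H \<in> forms d (E - k0 * D)" unfolding H_def[abs_def] by (intro forms_sum)
  have "(\<Sum>k<N. G k x * f x ^ k) = f x ^ k0 * H x" for x
  proof -
    have "(\<Sum>k<N. G k x * f x ^ k) = (\<Sum>k=k0..<N. G k x * f x ^ k)"
      using k0 by (intro sum.mono_neutral_right) auto
    also have "\<dots> = f x ^ k0 * H x"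
      unfolding H_def sum_distrib_left
    proof (intro sum.cong refl)
      fix k assume "k \<in> {k0..<N}"
      then have "f x ^ k = f x ^ k0 * f x ^ (k - k0)" by (simp flip: power_add)
      then show "G k x * f x ^ k = f x ^ k0 * (G k x * f x ^ (k - k0))" by simp
    qed
    finally show ?thesis .
  qed
  then have "vanishes_on (\<lambda>x. f x ^ k0 * H x) Z'" using rel by simp
  then have "vanishes_on (\<lambda>x. f x ^ k0) Z' \<or> vanishes_on H Z'"
    by (rule irreducible_in_zariski_mult[OF irr forms_power[OF f(1)] H])
  moreover have "\<not> vanishes_on (\<lambda>x. f x ^ k0) Z'"
    using f(2) unfolding vanishes_on_def by auto
  ultimately have HZ: "vanishes_on H Z'" by blast
  show ?thesis unfolding vanishes_on_def
  proof (intro ballI)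
    fix P x assume P: "P \<in> Z" "x \<in> P"
    then have "f x = 0" "H x = 0" using f(3,4) HZ unfolding vanishes_on_def by blast+
    \<comment> \<open>On \<open>Z\<close> the form \<open>f\<close> is zero, so only the summand
      \<open>k0\<close> survives, with \<open>0 ^ 0 = 1\<close>.\<close>
    then have "0 = (\<Sum>k=k0..<N. G k x * 0 ^ (k - k0))" by (simp add: H_def)
    also have "\<dots> = (\<Sum>k\<in>{k0}. G k x * 0 ^ (k - k0))"
      using k0(1) by (intro sum.mono_neutral_right) auto
    finally show "G k0 x = 0" by simp
  qed
qed

lemma forms_degree_zero: "g \<in> forms d 0 \<Longrightarrow> g x = g y"
  using forms_scale[of g d 0 0 x] forms_scale[of g d 0 0 y] by (simp add: cscale_def)

text \<open>The degree is positive because a form of degree 0 is constant and cannot vanish on the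
  nonempty \<open>C\<close> without vanishing on \<open>C'\<close>. Positive degrees allow several
  separating forms to be raised to a common degree.\<close>

lemma closedin_separating_form:
  assumes "closedin (zariski d) C" "C \<noteq> {}" "C \<subset> C'" "C' \<subseteq> proj_space d"
  obtains g k where "g \<in> forms d k" "k > 0" "vanishes_on g C" "\<not> vanishes_on g C'"
proof -
  obtain P where P: "P \<in> C'" "P \<notin> C" using assms(3) by blast
  obtain g k where g: "g \<in> forms d k" "\<And>Q x. Q \<in> C \<Longrightarrow> x \<in> Q \<Longrightarrow> g x = 0" "\<And>x. x \<in> P \<Longrightarrow> g x \<noteq> 0"
    using closedin_zariski_separate[OF assms(1) _ P(2)] P assms(4) by (metis subsetD)
  obtain x where x: "x \<in> P" using P(1) assms(4) proj_space_nonempty by blast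
  obtain Q y where y: "Q \<in> C" "y \<in> Q" using assms(2-4) proj_space_nonempty by blast
  have "k > 0"
  proof (rule ccontr)
    assume "\<not> k > 0"
    then show False using forms_degree_zero[of g d x y] g(1) g(2)[OF y] g(3)[OF x] by simp
  qed
  moreover have "vanishes_on g C" using g(2) unfolding vanishes_on_def by blast
  moreover have "\<not> vanishes_on g C'" using g(3) x P(1) unfolding vanishes_on_def by blast
  ultimately show ?thesis using that g(1) by simp
qed

text \<open>The form \<open>f0\<close>, \<open>f1\<close> or \<open>f2\<close> vanishes on one
  member of the chain but not on the next, and \<open>f3\<close> is nonzero at a point of
  \<open>Z 0\<close>. Counting yields a nontrivial relation among their monomials. Taking the lowest
  power of \<open>f2\<close> on \<open>Z 3\<close>, then of \<open>f1\<close> on \<open>Z 2\<close>,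
  then of \<open>f0\<close> on \<open>Z 1\<close> leaves a nonzero multiple of a power of
  \<open>f3\<close> that vanishes on \<open>Z 0\<close>, a contradiction.\<close>

lemma no_irreducible_chain:
  assumes "proj_closure d igms = X"
    and Z: "\<And>i. i \<le> 3 \<Longrightarrow> closedin (subtopology (zariski d) X) (Z i)"
      "\<And>i. i \<le> 3 \<Longrightarrow> irreducible_in (subtopology (zariski d) X) (Z i)"
      "\<And>i. i < 3 \<Longrightarrow> Z i \<subset> Z (Suc i)"
  shows False
proof -
  have clX: "closedin (zariski d) X" using assms(1) closedin_proj_closure by blast
  have Zcl: "closedin (zariski d) (Z i)" if "i \<le> 3" for i
    using Z(1)[OF that] clX closedin_closed_subtopology by blast
  have Zne: "Z i \<noteq> {}" and ZX: "Z i \<subseteq> X" and Zsp: "Z i \<subseteq> proj_space d" if "i \<le> 3" for i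
    using Z(2)[OF that] by (auto simp: irreducible_in_def topspace_subtopology topspace_zariski)
  have sep: "\<exists>g k. g \<in> forms d k \<and> k > 0 \<and> vanishes_on g (Z i) \<and> \<not> vanishes_on g (Z (Suc i))"
    if "i < 3" for i
  proof (rule closedin_separating_form)
    show "closedin (zariski d) (Z i)" "Z i \<noteq> {}" "Z (Suc i) \<subseteq> proj_space d" "Z i \<subset> Z (Suc i)"
      using that Zcl Zne Zsp Z(3) by simp_all
  qed blast
  obtain g0 k0 where g0: "g0 \<in> forms d k0" "k0 > 0" "vanishes_on g0 (Z 0)" "\<not> vanishes_on g0 (Z 1)"
    using sep[of 0] by auto
  obtain g1 k1 where g1: "g1 \<in> forms d k1" "k1 > 0" "vanishes_on g1 (Z 1)" "\<not> vanishes_on g1 (Z 2)"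
    using sep[of 1] by (auto simp: numeral_2_eq_2)
  obtain g2 k2 where g2: "g2 \<in> forms d k2" "k2 > 0" "vanishes_on g2 (Z 2)" "\<not> vanishes_on g2 (Z 3)"
    using sep[of 2] by (auto simp: eval_nat_numeral)
  obtain P where P: "P \<in> Z 0" using Zne[of 0] by auto
  then have "P \<in> proj_space d" using Zsp[of 0] by auto
  then obtain x0 where x0: "x0 \<in> P" using proj_space_nonempty by blast
  then obtain j where j: "j \<le> d" "x0 j \<noteq> 0" using proj_space_memD(3)[OF \<open>P \<in> proj_space d\<close>] by blast

  \<comment> \<open>Each separating form is raised to the product of the other two degrees, so that
    all have degree \<open>D\<close>.\<close>
  define D where "D = k0 * k1 * k2"
  define f0 where "f0 x = g0 x ^ (k1 * k2)" for x
  define f1 where "f1 x = g1 x ^ (k0 * k2)" for x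
  define f2 where "f2 x = g2 x ^ (k0 * k1)" for x
  define f3 where "f3 x = x j ^ D" for x :: "nat \<Rightarrow> complex"
  have f0: "f0 \<in> forms d D" "vanishes_on f0 (Z 0)" "\<not> vanishes_on f0 (Z 1)"
    using forms_power[OF g0(1), of "k1 * k2"] g0(3,4) g1(2) g2(2)
    unfolding vanishes_on_def f0_def[abs_def] D_def by (auto simp: mult_ac)
  have f1: "f1 \<in> forms d D" "vanishes_on f1 (Z 1)" "\<not> vanishes_on f1 (Z 2)"
    using forms_power[OF g1(1), of "k0 * k2"] g1(3,4) g0(2) g2(2)
    unfolding vanishes_on_def f1_def[abs_def] D_def by (auto simp: mult_ac)
  have f2: "f2 \<in> forms d D" "vanishes_on f2 (Z 2)" "\<not> vanishes_on f2 (Z 3)"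
    using forms_power[OF g2(1), of "k0 * k1"] g2(3,4) g0(2) g1(2)
    unfolding vanishes_on_def f2_def[abs_def] D_def by (auto simp: mult_ac)
  have f3: "f3 \<in> forms d D" "f3 x0 \<noteq> 0"
    using forms_power[OF forms_coord[OF j(1)], of D] j(2) by (simp_all add: f3_def[abs_def])

  \<comment> \<open>The monomials have degree \<open>3 * N * D\<close>, so their pullbacks have
    degree at most \<open>L\<close> in each variable. Since \<open>L + 1 \<le> K * N\<close> and
    \<open>N > K\<^sup>2\<close>, the \<open>(L + 1)\<^sup>2\<close> coefficients are fewer than the
    \<open>N ^ 3\<close> monomials.\<close>
  define K where "K = 3 * D * d + 1"
  define N where "N = K ^ 2 + 1"
  define L where "L = 3 * N * D * d"
  \<comment> \<open>The power of \<open>f3\<close> fills the total exponent up to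
    \<open>3 * N\<close>; the other three exponents are below \<open>N\<close>, so the subtraction
    does not truncate.\<close>
  define F where "F z x = f0 x ^ snd (snd z) * f3 x ^ (3 * N - fst z - fst (snd z) - snd (snd z)) *
    f1 x ^ fst (snd z) * f2 x ^ fst z" for z :: "nat \<times> nat \<times> nat" and x
  define I where "I = {..<N} \<times> {..<N} \<times> {..<N}"
  have F: "F z \<in> forms d (3 * N * D)" if "z \<in> I" for z
  proof -
    obtain k j i where z: "z = (k, j, i)" by (cases z)
    have "i * D + (3 * N - k - j - i) * D + j * D + k * D = 3 * N * D"
    proof -
      have "i + (3 * N - k - j - i) + j + k = 3 * N" using that by (auto simp: z I_def)
      then show ?thesis by (metis distrib_right)
    qed
    then show ?thesis
      using forms_mult[OF forms_mult[OF forms_mult[OF forms_power[OF f0(1), of i]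
         forms_power[OF f3(1), of "3 * N - k - j - i"]] forms_power[OF f1(1), of j]] forms_power[OF f2(1), of k]]
      by (simp add: F_def[abs_def] z)
  qed
  have "\<exists>w. \<forall>\<mu> a. F z (igm \<mu> a) = (\<Sum>(p, q)\<in>{..L} \<times> {..L}. w (p, q) * (\<mu> ^ p * a ^ q))" if "z \<in> I" for z
    using forms_igm_bipoly[OF F[OF that]] unfolding bipoly_def L_def by simp
  then have "\<forall>z\<in>I. \<exists>w. \<forall>\<mu> a. F z (igm \<mu> a) = (\<Sum>(p, q)\<in>{..L} \<times> {..L}. w (p, q) * (\<mu> ^ p * a ^ q))"
    by (intro ballI)
  from bchoice[OF this] obtain w where w: "\<And>z \<mu> a. z \<in> I \<Longrightarrow>
      F z (igm \<mu> a) = (\<Sum>(p, q)\<in>{..L} \<times> {..L}. w z (p, q) * (\<mu> ^ p * a ^ q))"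
    by auto
  have "card ({..L} \<times> {..L}) < card I"
  proof -
    have "L + 1 \<le> K * N" by (simp add: L_def K_def N_def algebra_simps)
    then have "(L + 1) * (L + 1) \<le> (K * N) * (K * N)" by (intro mult_le_mono)
    also have "\<dots> = K ^ 2 * (N * N)" by (simp add: power2_eq_square)
    also have "\<dots> < N * (N * N)" by (simp add: N_def)
    finally show ?thesis by (simp add: I_def card_cartesian_product)
  qed
  then obtain c where c: "\<exists>z\<in>I. c z \<noteq> 0" "\<And>y. y \<in> {..L} \<times> {..L} \<Longrightarrow> (\<Sum>z\<in>I. c z * w z y) = 0"
    using underdetermined_system[of "{..L} \<times> {..L}" I w] by (auto simp: I_def)
  have "(\<Sum>z\<in>I. c z * F z (igm \<mu> a)) = 0" for \<mu> a
  proof -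
    have "(\<Sum>z\<in>I. c z * F z (igm \<mu> a)) =
        (\<Sum>z\<in>I. \<Sum>y\<in>{..L} \<times> {..L}. c z * w z y * (\<mu> ^ fst y * a ^ snd y))"
      by (intro sum.cong refl) (simp add: w case_prod_unfold sum_distrib_left mult.assoc)
    also have "\<dots> = (\<Sum>y\<in>{..L} \<times> {..L}. \<Sum>z\<in>I. c z * w z y * (\<mu> ^ fst y * a ^ snd y))"
      by (rule sum.swap)
    also have "\<dots> = 0"
      by (rule sum.neutral) (use c(2) in \<open>simp flip: sum_distrib_right\<close>)
    finally show ?thesis .
  qed
  then have relX: "(\<Sum>z\<in>I. c z * F z h) = 0" if "h \<in> igms" for h
    using that by (auto simp: igms_def)
  have "(\<lambda>x. \<Sum>z\<in>I. c z * F z x) \<in> forms d (3 * N * D)"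
    by (intro forms_sum forms_cmult F)
  from proj_closure_vanish[OF this relX] have rel: "vanishes_on (\<lambda>x. \<Sum>z\<in>I. c z * F z x) (Z 3)"
    using ZX[of 3] assms(1) unfolding vanishes_on_def by blast

  \<comment> \<open>\<open>k'\<close>, \<open>j'\<close> and \<open>i'\<close> form the
    lexicographically least index with nonzero coefficient, found one entry at a time.\<close>
  define G2 where "G2 k x = (\<Sum>j<N. \<Sum>i<N. c (k, j, i) * (f0 x ^ i * f3 x ^ (3 * N - k - j - i) * f1 x ^ j))" for k x
  define k' where "k' = (LEAST k. \<exists>j i. (k, j, i) \<in> I \<and> c (k, j, i) \<noteq> 0)"
  have exk: "\<exists>k j i. (k, j, i) \<in> I \<and> c (k, j, i) \<noteq> 0" using c(1) by auto
  have k': "\<exists>j i. (k', j, i) \<in> I \<and> c (k', j, i) \<noteq> 0" unfolding k'_def using LeastI_ex[OF exk] .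
  then have k'N: "k' < N" by (auto simp: I_def)
  have "vanishes_on (G2 k') (Z 2)"
  proof (rule lowest_coefficient_vanishes[OF Z(2)[of 3] f2(1,3,2), where N = N and E = "3 * N * D"])
    show "vanishes_on (\<lambda>x. \<Sum>k<N. G2 k x * f2 x ^ k) (Z 3)"
    proof -
      have "(\<Sum>k<N. G2 k x * f2 x ^ k) = (\<Sum>z\<in>I. c z * F z x)" for x
      proof -
        have "(\<Sum>z\<in>I. c z * F z x) = (\<Sum>k<N. \<Sum>j<N. \<Sum>i<N. c (k, j, i) * F (k, j, i) x)"
          by (simp add: I_def sum.cartesian_product case_prod_unfold)
        also have "\<dots> = (\<Sum>k<N. G2 k x * f2 x ^ k)"
          by (simp add: G2_def F_def sum_distrib_right mult.assoc)
        finally show ?thesis by simp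
      qed
      then show ?thesis using rel by simp
    qed
    show "G2 k x = 0" if "k < k'" for k x
    proof -
      have "c (k, j, i) = 0" if "j < N" "i < N" for j i
        using not_less_Least[OF \<open>k < k'\<close>[unfolded k'_def]] that \<open>k < k'\<close> k'N by (auto simp: I_def)
      then show ?thesis by (simp add: G2_def)
    qed
    show "G2 k \<in> forms d (3 * N * D - k * D)" if "k < N" for k
    proof -
      have "(\<lambda>x. f0 x ^ i * f3 x ^ (3 * N - k - j - i) * f1 x ^ j) \<in> forms d (3 * N * D - k * D)"
        if "i < N" "j < N" for i j
      proof -
        have "i * D + (3 * N - k - j - i) * D + j * D = 3 * N * D - k * D"
        proof -
          have "i + (3 * N - k - j - i) + j = 3 * N - k" using that \<open>k < N\<close> by auto
          then show ?thesis by (metis distrib_right diff_mult_distrib)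
        qed
        then show ?thesis
          using forms_mult[OF forms_mult[OF forms_power[OF f0(1), of i]
             forms_power[OF f3(1), of "3 * N - k - j - i"]] forms_power[OF f1(1), of j]] by simp
      qed
      then show ?thesis unfolding G2_def[abs_def] by (intro forms_sum forms_cmult) auto
    qed
    show "Z 2 \<subseteq> Z 3" using Z(3)[of 2] by (auto simp: eval_nat_numeral)
  qed (use k'N in simp_all)

  define G1 where "G1 j x = (\<Sum>i<N. c (k', j, i) * (f0 x ^ i * f3 x ^ (3 * N - k' - j - i)))" for j x
  define j' where "j' = (LEAST j. \<exists>i. (k', j, i) \<in> I \<and> c (k', j, i) \<noteq> 0)"
  have j': "\<exists>i. (k', j', i) \<in> I \<and> c (k', j', i) \<noteq> 0" unfolding j'_def using LeastI_ex[OF k'] .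
  then have j'N: "j' < N" by (auto simp: I_def)
  have "vanishes_on (G1 j') (Z 1)"
  proof (rule lowest_coefficient_vanishes[OF Z(2)[of 2] f1(1,3,2), where N = N and E = "(3 * N - k') * D"])
    show "vanishes_on (\<lambda>x. \<Sum>j<N. G1 j x * f1 x ^ j) (Z 2)"
    proof -
      have "(\<Sum>j<N. G1 j x * f1 x ^ j) = G2 k' x" for x
        by (simp add: G1_def G2_def sum_distrib_right mult.assoc)
      then show ?thesis using \<open>vanishes_on (G2 k') (Z 2)\<close> by (simp add: vanishes_on_def)
    qed
    show "G1 j x = 0" if "j < j'" for j x
    proof -
      have "c (k', j, i) = 0" if "i < N" for i
        using not_less_Least[OF \<open>j < j'\<close>[unfolded j'_def]] that \<open>j < j'\<close> j'N k'N by (auto simp: I_def)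
      then show ?thesis by (simp add: G1_def)
    qed
    show "G1 j \<in> forms d ((3 * N - k') * D - j * D)" if "j < N" for j
    proof -
      have "(\<lambda>x. f0 x ^ i * f3 x ^ (3 * N - k' - j - i)) \<in> forms d ((3 * N - k') * D - j * D)"
        if "i < N" for i
      proof -
        have "i * D + (3 * N - k' - j - i) * D = (3 * N - k') * D - j * D"
        proof -
          have "i + (3 * N - k' - j - i) = 3 * N - k' - j" using that \<open>j < N\<close> k'N by auto
          then show ?thesis by (metis distrib_right diff_mult_distrib)
        qed
        then show ?thesis
          using forms_mult[OF forms_power[OF f0(1), of i] forms_power[OF f3(1), of "3 * N - k' - j - i"]] by simp
      qed
      then show ?thesis unfolding G1_def[abs_def] by (intro forms_sum forms_cmult) auto
    qed
    show "Z 1 \<subseteq> Z 2" using Z(3)[of 1] by (auto simp: eval_nat_numeral)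
    show "N * D \<le> (3 * N - k') * D" using k'N by (intro mult_le_mono1) simp
  qed (use j'N in simp_all)

  define G0 where "G0 i x = c (k', j', i) * f3 x ^ (3 * N - k' - j' - i)" for i x
  define i' where "i' = (LEAST i. (k', j', i) \<in> I \<and> c (k', j', i) \<noteq> 0)"
  have i': "(k', j', i') \<in> I" "c (k', j', i') \<noteq> 0" unfolding i'_def using LeastI_ex[OF j'] by blast+
  then have i'N: "i' < N" by (auto simp: I_def)
  have "vanishes_on (G0 i') (Z 0)"
  proof (rule lowest_coefficient_vanishes[OF Z(2)[of 1] f0(1,3,2), where N = N and E = "(3 * N - k' - j') * D"])
    show "vanishes_on (\<lambda>x. \<Sum>i<N. G0 i x * f0 x ^ i) (Z 1)"
    proof -
      have "(\<Sum>i<N. G0 i x * f0 x ^ i) = G1 j' x" for x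
        by (simp add: G1_def G0_def mult_ac)
      then show ?thesis using \<open>vanishes_on (G1 j') (Z 1)\<close> by (simp add: vanishes_on_def)
    qed
    show "G0 i x = 0" if "i < i'" for i x
    proof -
      have "c (k', j', i) = 0"
        using not_less_Least[OF \<open>i < i'\<close>[unfolded i'_def]] \<open>i < i'\<close> j'N k'N i'N by (auto simp: I_def)
      then show ?thesis by (simp add: G0_def)
    qed
    show "G0 i \<in> forms d ((3 * N - k' - j') * D - i * D)" if "i < N" for i
      using forms_cmult[OF forms_power[OF f3(1), of "3 * N - k' - j' - i"]]
      by (simp add: G0_def[abs_def] diff_mult_distrib add_mult_distrib add.assoc)
    show "Z 0 \<subseteq> Z 1" using Z(3)[of 0] by auto
    show "N * D \<le> (3 * N - k' - j') * D" using k'N j'N by (intro mult_le_mono1) simp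
  qed (use i'N in simp_all)
  then have "G0 i' x0 = 0" using P x0 unfolding vanishes_on_def by blast
  then show False using i'(2) f3(2) by (simp add: G0_def)
qed

lemma local_dim_ig_le:
  "local_dim (subtopology (zariski d) (ig_moment_variety d)) P \<le> 2"
proof -
  have "n \<le> 2" if
    "\<forall>i\<le>n. closedin (subtopology (zariski d) (ig_moment_variety d)) (Z i) \<and>
       irreducible_in (subtopology (zariski d) (ig_moment_variety d)) (Z i)"
    "\<forall>i<n. Z i \<subset> Z (Suc i)" for n and Z :: "nat \<Rightarrow> (nat \<Rightarrow> complex) set set"
  proof (rule ccontr)
    assume "\<not> n \<le> 2"
    then show False
      using no_irreducible_chain[of d "ig_moment_variety d" Z] that by (simp add: ig_moment_variety_eq)
  qed
  then have "enat n \<le> 2" if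
    "\<forall>i\<le>n. closedin (subtopology (zariski d) (ig_moment_variety d)) (Z i) \<and>
       irreducible_in (subtopology (zariski d) (ig_moment_variety d)) (Z i)"
    "\<forall>i<n. Z i \<subset> Z (Suc i)" for n and Z :: "nat \<Rightarrow> (nat \<Rightarrow> complex) set set"
    using that by (metis enat_ord_simps(1) numeral_eq_enat)
  then show ?thesis unfolding local_dim_def by (intro Sup_least) blast
qed

section \<open>Tangent spaces\<close>

lemma poly_eval_partial_deriv:
  "poly_eval (partial_deriv j f) x = (\<Sum>m\<in>Poly_Mapping.keys f. of_nat (Poly_Mapping.lookup m j) *
     Poly_Mapping.lookup f m * monom_eval (m - Poly_Mapping.single j 1) x)"
  by (simp add: partial_deriv_def poly_eval_sum)

lemma monom_eval_has_derivative:
  assumes m: "Poly_Mapping.keys m \<subseteq> {..d}"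
    and \<gamma>: "\<And>i. i \<le> d \<Longrightarrow> ((\<lambda>s. \<gamma> s i) has_field_derivative v i) (at s0)"
  shows "((\<lambda>s. monom_eval m (\<gamma> s)) has_field_derivative
    (\<Sum>j\<le>d. of_nat (Poly_Mapping.lookup m j) * monom_eval (m - Poly_Mapping.single j 1) (\<gamma> s0) * v j)) (at s0)"
proof -
  have 1: "monom_eval m (\<gamma> s) = (\<Prod>i\<le>d. \<gamma> s i ^ Poly_Mapping.lookup m i)" for s
    by (rule monom_eval_superset) (use m in auto)
  have sub: "Poly_Mapping.keys (m - Poly_Mapping.single j 1) \<subseteq> {..d}" for j
  proof -
    have "Poly_Mapping.keys (m - Poly_Mapping.single j 1) \<subseteq> Poly_Mapping.keys m"
      by (auto simp: in_keys_iff lookup_minus)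
    then show ?thesis using m by blast
  qed
  have 2: "monom_eval (m - Poly_Mapping.single j 1) x =
      x j ^ (Poly_Mapping.lookup m j - 1) * (\<Prod>i\<in>{..d} - {j}. x i ^ Poly_Mapping.lookup m i)"
    if "j \<le> d" for j x
  proof -
    have "monom_eval (m - Poly_Mapping.single j 1) x =
        (\<Prod>i\<le>d. x i ^ Poly_Mapping.lookup (m - Poly_Mapping.single j 1) i)"
      by (rule monom_eval_superset) (use sub in auto)
    also have "\<dots> = x j ^ (Poly_Mapping.lookup m j - 1) *
        (\<Prod>i\<in>{..d} - {j}. x i ^ Poly_Mapping.lookup (m - Poly_Mapping.single j 1) i)"
      using that by (subst prod.remove[of _ j]) (auto simp: lookup_minus)
    also have "(\<Prod>i\<in>{..d} - {j}. x i ^ Poly_Mapping.lookup (m - Poly_Mapping.single j 1) i) =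
        (\<Prod>i\<in>{..d} - {j}. x i ^ Poly_Mapping.lookup m i)"
      by (intro prod.cong refl) (auto simp: lookup_minus lookup_single when_def)
    finally show ?thesis .
  qed
  have "((\<lambda>s. \<Prod>i\<le>d. \<gamma> s i ^ Poly_Mapping.lookup m i) has_field_derivative
     (\<Sum>j\<le>d. (of_nat (Poly_Mapping.lookup m j) * \<gamma> s0 j ^ (Poly_Mapping.lookup m j - 1) * v j) *
        (\<Prod>i\<in>{..d} - {j}. \<gamma> s0 i ^ Poly_Mapping.lookup m i))) (at s0)"
    by (rule has_field_derivative_prod)
       (auto intro!: derivative_eq_intros \<gamma>)
  also have "(\<Sum>j\<le>d. (of_nat (Poly_Mapping.lookup m j) * \<gamma> s0 j ^ (Poly_Mapping.lookup m j - 1) * v j) *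
        (\<Prod>i\<in>{..d} - {j}. \<gamma> s0 i ^ Poly_Mapping.lookup m i)) =
     (\<Sum>j\<le>d. of_nat (Poly_Mapping.lookup m j) * monom_eval (m - Poly_Mapping.single j 1) (\<gamma> s0) * v j)"
    by (intro sum.cong refl) (simp add: 2 mult_ac del: One_nat_def)
  finally show ?thesis by (simp add: 1)
qed

lemma poly_eval_has_derivative:
  assumes f: "f \<in> polys_upto d"
    and \<gamma>: "\<And>i. i \<le> d \<Longrightarrow> ((\<lambda>s. \<gamma> s i) has_field_derivative v i) (at s0)"
  shows "((\<lambda>s. poly_eval f (\<gamma> s)) has_field_derivative
    (\<Sum>j\<le>d. poly_eval (partial_deriv j f) (\<gamma> s0) * v j)) (at s0)"
proof -
  let ?c = "Poly_Mapping.lookup f"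
  have "((\<lambda>s. \<Sum>m\<in>Poly_Mapping.keys f. ?c m * monom_eval m (\<gamma> s)) has_field_derivative
    (\<Sum>m\<in>Poly_Mapping.keys f. ?c m * (\<Sum>j\<le>d. of_nat (Poly_Mapping.lookup m j) *
       monom_eval (m - Poly_Mapping.single j 1) (\<gamma> s0) * v j))) (at s0)"
    using f unfolding polys_upto_def
    by (intro DERIV_sum DERIV_cmult monom_eval_has_derivative \<gamma>) auto
  also have "(\<Sum>m\<in>Poly_Mapping.keys f. ?c m * (\<Sum>j\<le>d. of_nat (Poly_Mapping.lookup m j) *
       monom_eval (m - Poly_Mapping.single j 1) (\<gamma> s0) * v j)) =
     (\<Sum>m\<in>Poly_Mapping.keys f. \<Sum>j\<le>d. of_nat (Poly_Mapping.lookup m j) * ?c m *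
       monom_eval (m - Poly_Mapping.single j 1) (\<gamma> s0) * v j)"
    by (simp add: sum_distrib_left mult_ac)
  also have "\<dots> = (\<Sum>j\<le>d. poly_eval (partial_deriv j f) (\<gamma> s0) * v j)"
    by (subst sum.swap) (simp add: poly_eval_partial_deriv sum_distrib_right)
  finally show ?thesis by (simp add: poly_eval_def)
qed

text \<open>With tangency expressed along the line \<open>x + s * v\<close>, the condition imposed
  by an explicit form can be read off as its coefficient of \<open>s\<close>.\<close>

lemma tangent_subspace_form:
  assumes "v \<in> tangent_subspace d X P" "x \<in> P" "F \<in> forms d k" "vanishes_on F X"
  shows "((\<lambda>s. F (\<lambda>i. x i + s * v i)) has_field_derivative 0) (at 0)"
proof -
  obtain f where f: "F = poly_eval f" "f \<in> polys_upto d" using formsE[OF assms(3)] by blast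
  have "f \<in> vanishing_ideal d X"
    using f assms(4) by (simp add: vanishing_ideal_def vanishes_on_def)
  then have "(\<Sum>j\<le>d. poly_eval (partial_deriv j f) x * v j) = 0"
    using assms(1,2) unfolding tangent_subspace_def by blast
  moreover have "((\<lambda>s. poly_eval f (\<lambda>i. x i + s * v i)) has_field_derivative
    (\<Sum>j\<le>d. poly_eval (partial_deriv j f) (\<lambda>i. x i + 0 * v i) * v j)) (at 0)"
    by (rule poly_eval_has_derivative[OF f(2)]) (auto intro!: derivative_eq_intros)
  ultimately show ?thesis by (simp add: f(1))
qed

lemma sum_fun_at: "(\<Sum>a\<in>S. f a) i = (\<Sum>a\<in>S. f a i)" for f :: "'a \<Rightarrow> nat \<Rightarrow> complex"
  by (induction S rule: infinite_finite_induct) simp_all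

lemma subspace_tangent_subspace: "cfun.subspace (tangent_subspace d X P)"
  unfolding cfun.subspace_def tangent_subspace_def
  by (auto simp: cvecs_def cscale_def algebra_simps sum.distrib simp flip: sum_distrib_left)

section \<open>Dimensions of subspaces through coordinates\<close>

text \<open>Restriction to the coordinates in \<open>K\<close> is injective on \<open>V\<close>; a
  basis larger than \<open>K\<close> would have a nontrivial combination in its kernel.\<close>

lemma dim_le_of_determining_coords:
  assumes V: "cfun.subspace V" and K: "finite K" "\<And>v. v \<in> V \<Longrightarrow> (\<And>k. k \<in> K \<Longrightarrow> v k = 0) \<Longrightarrow> v = 0"
  shows "cfun.dim V \<le> card K"
proof -
  obtain B where B: "B \<subseteq> V" "cfun.independent B" "V \<subseteq> cfun.span B" "card B = cfun.dim V"
    by (rule cfun.basis_exists[of V])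
  have "card B \<le> card K"
  proof (rule ccontr)
    assume *: "\<not> ?thesis"
    then have fin: "finite B" by (intro card_ge_0_finite) linarith
    obtain c where c: "\<exists>b\<in>B. c b \<noteq> 0" "\<And>k. k \<in> K \<Longrightarrow> (\<Sum>b\<in>B. c b * b k) = 0"
      using underdetermined_system[of K B "\<lambda>b k. b k"] * fin K(1) by auto
    have "(\<Sum>b\<in>B. cscale (c b) b) \<in> V"
      using B(1) V by (intro cfun.subspace_sum cfun.subspace_scale) auto
    then have "(\<Sum>b\<in>B. cscale (c b) b) = 0"
      by (rule K(2)) (simp add: c(2) sum_fun_at cscale_def)
    then show False using c(1) B(2) cfun.dependent_finite[OF fin] by blast
  qed
  then show ?thesis using B(4) by simp
qed

definition unit_vec :: "nat \<Rightarrow> nat \<Rightarrow> complex" where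
  "unit_vec j = (\<lambda>i. if i = j then 1 else 0)"

lemma inj_unit_vec: "inj unit_vec"
  by (rule injI) (metis unit_vec_def zero_neq_one)

lemma independent_unit_vecs:
  assumes "finite J"
  shows "cfun.independent (unit_vec ` J)"
proof
  assume "cfun.dependent (unit_vec ` J)"
  then obtain u where u: "\<exists>v\<in>unit_vec ` J. u v \<noteq> 0" "(\<Sum>v\<in>unit_vec ` J. cscale (u v) v) = 0"
    using cfun.dependent_finite[of "unit_vec ` J"] assms by auto
  have "u (unit_vec j) = 0" if "j \<in> J" for j
  proof -
    have "0 = (\<Sum>v\<in>unit_vec ` J. cscale (u v) v) j" using u(2) by simp
    also have "\<dots> = (\<Sum>i\<in>J. cscale (u (unit_vec i)) (unit_vec i) j)"
      unfolding sum_fun_at using inj_unit_vec by (subst sum.reindex) (auto intro: inj_on_subset)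
    also have "\<dots> = (\<Sum>i\<in>J. if i = j then u (unit_vec j) else 0)"
      by (intro sum.cong) (auto simp: cscale_def unit_vec_def)
    also have "\<dots> = u (unit_vec j)" using that assms by (simp add: sum.delta)
    finally show ?thesis by simp
  qed
  then show False using u(1) by blast
qed

lemma cvecs_span: "cvecs d \<subseteq> cfun.span (unit_vec ` {..d})"
proof
  fix v assume v: "v \<in> cvecs d"
  have "v = (\<Sum>j\<le>d. cscale (v j) (unit_vec j))"
  proof
    fix i
    have "(\<Sum>j\<le>d. cscale (v j) (unit_vec j)) i = (\<Sum>j\<le>d. if j = i then v i else 0)"
      unfolding sum_fun_at by (intro sum.cong) (auto simp: cscale_def unit_vec_def)
    then show "v i = (\<Sum>j\<le>d. cscale (v j) (unit_vec j)) i"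
      using v by (auto simp: sum.delta cvecs_def)
  qed
  also have "\<dots> \<in> cfun.span (unit_vec ` {..d})"
    by (intro cfun.span_sum cfun.span_scale cfun.span_base) auto
  finally show "v \<in> cfun.span (unit_vec ` {..d})" .
qed

text \<open>Containment in \<open>cvecs d\<close> makes a basis of \<open>V\<close> finite, so that
  the exchange bound applies.\<close>

lemma dim_ge_card_unit_vecs:
  assumes "V \<subseteq> cvecs d" "finite J" "unit_vec ` J \<subseteq> V"
  shows "card J \<le> cfun.dim V"
proof -
  obtain B where B: "B \<subseteq> V" "cfun.independent B" "V \<subseteq> cfun.span B" "card B = cfun.dim V"
    by (rule cfun.basis_exists[of V])
  have "finite B"
    using cfun.independent_span_bound[of "unit_vec ` {..d}" B] B assms(1) cvecs_span by blast
  then have "card (unit_vec ` J) \<le> card B"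
    using cfun.independent_span_bound[of B "unit_vec ` J"] B assms independent_unit_vecs by blast
  then show ?thesis using B(4) card_image[of unit_vec J] inj_unit_vec by (metis inj_on_subset subset_UNIV)
qed

lemma unit_vec_tangent:
  assumes "j \<le> d"
    and "\<And>f x. f \<in> vanishing_ideal d X \<Longrightarrow> x \<in> P \<Longrightarrow> poly_eval (partial_deriv j f) x = 0"
  shows "unit_vec j \<in> tangent_subspace d X P"
proof -
  have "(\<Sum>i\<le>d. poly_eval (partial_deriv i f) x * unit_vec j i) = 0"
    if "f \<in> vanishing_ideal d X" "x \<in> P" for f x
    using assms(2)[OF that] by (intro sum.neutral) (auto simp: unit_vec_def)
  moreover have "unit_vec j \<in> cvecs d" using assms(1) by (auto simp: unit_vec_def cvecs_def)
  ultimately show ?thesis by (simp add: tangent_subspace_def)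
qed

section \<open>Equations\<close>

lemma forms_monom3:
  assumes "i \<le> d" "j \<le> d" "k \<le> d"
  shows "(\<lambda>x. c * (x i * x j * x k)) \<in> forms d 3"
  using forms_cmult[OF forms_mult[OF forms_mult[OF forms_coord[OF assms(1)] forms_coord[OF assms(2)]]
    forms_coord[OF assms(3)]], of c] by (simp add: numeral_eq_Suc)

lemma forms_monom4:
  assumes "i \<le> d" "j \<le> d" "k \<le> d" "l \<le> d"
  shows "(\<lambda>x. c * (x i * x j * x k * x l)) \<in> forms d 4"
  using forms_cmult[OF forms_mult[OF forms_mult[OF forms_mult[OF forms_coord[OF assms(1)] forms_coord[OF assms(2)]]
    forms_coord[OF assms(3)]] forms_coord[OF assms(4)]], of c] by (simp add: numeral_eq_Suc)

text \<open>The recurrence with \<open>\<mu>\<close> and \<open>a\<close> replaced by \<open>x\<^sub>1/x\<^sub>0\<close> and \<open>(x\<^sub>2x\<^sub>0 - x\<^sub>1\<^sup>2)/(x\<^sub>0x\<^sub>1)\<close>.\<close>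

definition recurrence_form :: "nat \<Rightarrow> (nat \<Rightarrow> complex) \<Rightarrow> complex" where
  "recurrence_form n x = (x 0)\<^sup>2 * x 1 * x (n + 2) -
     (2 * of_nat n + 1) * x 0 * (x 2 * x 0 - (x 1)\<^sup>2) * x (n + 1) - (x 1) ^ 3 * x n"

text \<open>Two instances of the recurrence, with \<open>a\<close> eliminated.\<close>

definition elimination_form :: "nat \<Rightarrow> nat \<Rightarrow> (nat \<Rightarrow> complex) \<Rightarrow> complex" where
  "elimination_form p n x =
     (2 * of_nat n + 1) * ((x 0)\<^sup>2 * x (p + 2) - (x 1)\<^sup>2 * x p) * x (n + 1) -
     (2 * of_nat p + 1) * ((x 0)\<^sup>2 * x (n + 2) - (x 1)\<^sup>2 * x n) * x (p + 1)"

text \<open>Three consecutive instances of the recurrence, as a singular \<open>3 \<times> 3\<close> linear system.\<close>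

definition minor_form :: "nat \<Rightarrow> (nat \<Rightarrow> complex) \<Rightarrow> complex" where
  "minor_form n x =
     x (n + 2) * ((2 * of_nat n + 3) * x (n + 2) * x (n + 2) - (2 * of_nat n + 5) * x (n + 3) * x (n + 1)) -
     (2 * of_nat n + 1) * x (n + 1) * (x (n + 3) * x (n + 2) - x (n + 4) * x (n + 1)) +
     x n * ((2 * of_nat n + 5) * x (n + 3) * x (n + 3) - (2 * of_nat n + 3) * x (n + 4) * x (n + 2))"

lemma recurrence_form: "n + 2 \<le> d \<Longrightarrow> recurrence_form n \<in> forms d 4"
proof -
  assume n: "n + 2 \<le> d"
  have eq: "recurrence_form n = (\<lambda>x. 1 * (x 0 * x 0 * x 1 * x (n + 2)) -
      (2 * of_nat n + 1) * (x 0 * x 2 * x 0 * x (n + 1)) +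
      (2 * of_nat n + 1) * (x 0 * x 1 * x 1 * x (n + 1)) - 1 * (x 1 * x 1 * x 1 * x n))"
    by (simp add: fun_eq_iff recurrence_form_def algebra_simps power2_eq_square power3_eq_cube)
  show ?thesis unfolding eq
    by (intro forms_diff forms_add forms_monom4) (use n in auto)
qed

lemma elimination_form: "n + 2 \<le> d \<Longrightarrow> p + 2 \<le> d \<Longrightarrow> elimination_form p n \<in> forms d 4"
proof -
  assume n: "n + 2 \<le> d" "p + 2 \<le> d"
  have eq: "elimination_form p n = (\<lambda>x. (2 * of_nat n + 1) * (x 0 * x 0 * x (p + 2) * x (n + 1)) -
      (2 * of_nat n + 1) * (x 1 * x 1 * x p * x (n + 1)) -
      (2 * of_nat p + 1) * (x 0 * x 0 * x (n + 2) * x (p + 1)) +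
      (2 * of_nat p + 1) * (x 1 * x 1 * x n * x (p + 1)))"
    by (simp add: fun_eq_iff elimination_form_def algebra_simps power2_eq_square)
  show ?thesis unfolding eq
    by (intro forms_diff forms_add forms_monom4) (use n in auto)
qed

lemma minor_form: "n + 4 \<le> d \<Longrightarrow> minor_form n \<in> forms d 3"
proof -
  assume n: "n + 4 \<le> d"
  have eq: "minor_form n = (\<lambda>x. (2 * of_nat n + 3) * (x (n + 2) * x (n + 2) * x (n + 2)) -
      (2 * of_nat n + 5) * (x (n + 2) * x (n + 3) * x (n + 1)) -
      (2 * of_nat n + 1) * (x (n + 1) * x (n + 3) * x (n + 2)) +
      (2 * of_nat n + 1) * (x (n + 1) * x (n + 4) * x (n + 1)) +
      (2 * of_nat n + 5) * (x n * x (n + 3) * x (n + 3)) -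
      (2 * of_nat n + 3) * (x n * x (n + 4) * x (n + 2)))"
    by (simp add: fun_eq_iff minor_form_def algebra_simps)
  show ?thesis unfolding eq
    by (intro forms_diff forms_add forms_monom3) (use n in auto)
qed

lemma igm_two: "igm \<mu> a 2 = a * \<mu> + \<mu>\<^sup>2"
  by (simp add: numeral_2_eq_2)

lemma igm_step: "igm \<mu> a (n + 2) = (2 * of_nat n + 1) * a * igm \<mu> a (n + 1) + \<mu>\<^sup>2 * igm \<mu> a n"
  by simp

lemma igm_step3: "igm \<mu> a (n + 3) = (2 * of_nat n + 3) * a * igm \<mu> a (n + 2) + \<mu>\<^sup>2 * igm \<mu> a (n + 1)"
  using igm_step[of \<mu> a "n + 1"] by (simp add: eval_nat_numeral algebra_simps)

lemma odd_neq_0: "2 * of_nat n + 1 \<noteq> (0 :: complex)"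
  using of_nat_neq_0[of "2 * n", where ?'a = complex] by (simp add: add.commute)

lemma recurrence_form_igm: "recurrence_form n (igm \<mu> a) = 0"
  unfolding recurrence_form_def igm_two igm_step by (simp add: algebra_simps power2_eq_square power3_eq_cube)

lemma elimination_form_igm: "elimination_form p n (igm \<mu> a) = 0"
  unfolding elimination_form_def igm_step by (simp add: algebra_simps power2_eq_square)

text \<open>The form is the determinant of the matrix with rows \<open>x (j + 2)\<close>,
  \<open>(2 * j + 1) * x (j + 1)\<close>, \<open>x j\<close> for \<open>j = n, n + 1, n + 2\<close>;
  on the moments its kernel contains \<open>(1, - a, - \<mu>\<^sup>2)\<close>.\<close>

lemma minor_form_igm: "minor_form n (igm \<mu> a) = 0"
proof -
  have s: "igm \<mu> a (n + 4) = (2 * of_nat n + 5) * a * igm \<mu> a (n + 3) + \<mu>\<^sup>2 * igm \<mu> a (n + 2)"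
    using igm_step[of \<mu> a "n + 2"] by (simp add: eval_nat_numeral algebra_simps)
  have *: "y2 * ((2 * k + 3) * y2 * y2 - (2 * k + 5) * y3 * y1) -
      (2 * k + 1) * y1 * (y3 * y2 - y4 * y1) + y0 * ((2 * k + 5) * y3 * y3 - (2 * k + 3) * y4 * y2) = 0"
    if "y2 = (2 * k + 1) * a * y1 + b * y0" "y3 = (2 * k + 3) * a * y2 + b * y1"
      "y4 = (2 * k + 5) * a * y3 + b * y2" for k b y0 y1 y2 y3 y4 :: complex
    using that by algebra
  show ?thesis unfolding minor_form_def
    by (rule *[OF igm_step igm_step3 s])
qed

lemma vanishes_on_ig: "F \<in> forms d k \<Longrightarrow> (\<And>\<mu> a. F (igm \<mu> a) = 0) \<Longrightarrow> vanishes_on F (ig_moment_variety d)"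
  unfolding vanishes_on_def ig_moment_variety_eq
  by (intro ballI, rule proj_closure_vanish[of F d k igms]) (auto simp: igms_def)

section \<open>Points with nonzero first coordinates\<close>

lemma ig_point_affine:
  assumes P: "P \<in> ig_moment_variety d" "x \<in> P" and x: "x 0 \<noteq> 0" "x 1 \<noteq> 0" and "i \<le> d"
  shows "x i = x 0 * igm (x 1 / x 0) ((x 2 * x 0 - (x 1)\<^sup>2) / (x 0 * x 1)) i"
  using \<open>i \<le> d\<close>
proof (induction i rule: induct_nat_012)
  case (ge2 n)
  let ?\<mu> = "x 1 / x 0" and ?a = "(x 2 * x 0 - (x 1)\<^sup>2) / (x 0 * x 1)"
  have "recurrence_form n x = 0"
    using vanishes_on_ig[OF recurrence_form recurrence_form_igm, of n d] P ge2(3) by (auto simp: vanishes_on_def)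
  then have "x (n + 2) = (2 * of_nat n + 1) * ?a * x (n + 1) + ?\<mu>\<^sup>2 * x n"
    using x unfolding recurrence_form_def
    by (simp add: field_simps power2_eq_square power3_eq_cube)
  then show ?case using ge2 by (simp add: algebra_simps)
qed (use x in auto)

text \<open>If a tangent vector is zero at 0, 1, 2 and at the indices \<open>n\<close> and
  \<open>n + 1\<close>, the differential of \<open>recurrence_form n\<close> reduces to a nonzero
  multiple of its entry \<open>n + 2\<close>. Thus coordinates 0, 1, 2 determine it.\<close>

lemma tangent_dim_affine:
  assumes d: "d \<ge> 3" and P: "P \<in> ig_moment_variety d" "x \<in> P" and x: "x 0 \<noteq> 0" "x 1 \<noteq> 0"
  shows "cfun.dim (tangent_subspace d (ig_moment_variety d) P) \<le> 3"
proof -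
  let ?V = "tangent_subspace d (ig_moment_variety d) P"
  have "v = 0" if v: "v \<in> ?V" "\<And>k. k \<in> {0, 1, 2} \<Longrightarrow> v k = 0" for v
  proof
    fix i
    show "v i = 0 i"
    proof (cases "i \<le> d")
      case True
      then have "v i = 0"
      proof (induction i rule: less_induct)
        case (less i)
        show ?case
        proof (cases "i \<le> 2")
          case True
          then have "i \<in> {0, 1, 2}" by auto
          then show ?thesis by (rule v(2))
        next
          case False
          define n where "n = i - 2"
          have n: "i = n + 2" "n \<ge> 1" "n + 2 \<le> d" using False less.prems by (auto simp: n_def)
          have vz: "v 0 = 0" "v 1 = 0" "v 2 = 0" using v(2) by auto
          have vz': "v n = 0" "v (n + 1) = 0" using less n by auto
          let ?y = "\<lambda>s i. x i + s * v i"
          have "recurrence_form n (?y s) = recurrence_form n x + ((x 0)\<^sup>2 * x 1 * v (n + 2)) * s" for s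
            unfolding recurrence_form_def vz vz' by (simp add: algebra_simps)
          moreover have "((\<lambda>s. recurrence_form n x + ((x 0)\<^sup>2 * x 1 * v (n + 2)) * s) has_field_derivative
              (x 0)\<^sup>2 * x 1 * v (n + 2)) (at 0)"
            by (auto intro!: derivative_eq_intros)
          ultimately have "((\<lambda>s. recurrence_form n (?y s)) has_field_derivative (x 0)\<^sup>2 * x 1 * v (n + 2)) (at 0)"
            by simp
          moreover have "((\<lambda>s. recurrence_form n (?y s)) has_field_derivative 0) (at 0)"
            using tangent_subspace_form[OF v(1) P(2) recurrence_form[OF n(3)]
                vanishes_on_ig[OF recurrence_form[OF n(3)] recurrence_form_igm]] .
          ultimately have "(x 0)\<^sup>2 * x 1 * v (n + 2) = 0" by (rule DERIV_unique)
          then show ?thesis using x n by simp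
        qed
      qed
      then show ?thesis by simp
    next
      case False
      then show ?thesis using v(1) by (simp add: tangent_subspace_def cvecs_def)
    qed
  qed
  then have "cfun.dim ?V \<le> card {0, 1, 2 :: nat}"
    by (intro dim_le_of_determining_coords subspace_tangent_subspace) auto
  then show ?thesis by simp
qed

text \<open>Since \<open>x 1 = 0\<close>, the coefficient used for \<open>recurrence_form\<close> in
  the affine case is lost. Pairing the recurrence for the last coordinate with the one of index
  \<open>n\<close> isolates \<open>v (n + 1)\<close>, multiplied by the nonzero \<open>x 0\<close>
  and \<open>x d\<close>.\<close>

lemma tangent_dim_line:
  assumes d: "d \<ge> 3" and P: "P \<in> ig_moment_variety d" "x \<in> P"
    and x: "x 0 \<noteq> 0" "x d \<noteq> 0" "\<And>i. 1 \<le> i \<Longrightarrow> i < d \<Longrightarrow> x i = 0"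
  shows "cfun.dim (tangent_subspace d (ig_moment_variety d) P) \<le> 3"
proof -
  let ?V = "tangent_subspace d (ig_moment_variety d) P"
  have "v = 0" if v: "v \<in> ?V" "\<And>k. k \<in> {0, d - 1, d} \<Longrightarrow> v k = 0" for v
  proof
    fix i
    consider "i \<in> {0, d - 1, d}" | "i > d" | n where "i = n + 1" "n + 2 < d" 
      by (cases i) (use d in \<open>auto, linarith\<close>)
    then show "v i = 0 i"
    proof cases
      case 1
      then show ?thesis using v(2) by simp
    next
      case 2
      then show ?thesis using v(1) by (simp add: tangent_subspace_def cvecs_def)
    next
      case n: (3 n)
      define p where "p = d - 2"
      have p: "d = p + 2" "p \<ge> 1" "n + 2 \<le> d" "p + 2 \<le> d" using d n by (auto simp: p_def)
      have xz: "x 1 = 0" "x p = 0" "x (p + 1) = 0" "x (n + 1) = 0" and vz: "v 0 = 0" "v (p + 1) = 0" "v (p + 2) = 0"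
        using x(3) v(2) p n by auto
      let ?y = "\<lambda>s i. x i + s * v i"
      let ?c = "(2 * of_nat n + 1) * (x 0)\<^sup>2 * x d * v (n + 1)"
      have "elimination_form p n (?y s) = ?c * s - ((2 * of_nat n + 1) * (v 1)\<^sup>2 * v p * v (n + 1)) * s ^ 4" for s
        unfolding elimination_form_def xz vz p(1) by (simp add: algebra_simps power2_eq_square eval_nat_numeral)
      moreover have "((\<lambda>s. ?c * s - ((2 * of_nat n + 1) * (v 1)\<^sup>2 * v p * v (n + 1)) * s ^ 4) has_field_derivative
          ?c) (at 0)"
        by (auto intro!: derivative_eq_intros)
      ultimately have "((\<lambda>s. elimination_form p n (?y s)) has_field_derivative ?c) (at 0)"
        by simp
      moreover have "((\<lambda>s. elimination_form p n (?y s)) has_field_derivative 0) (at 0)"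
        using tangent_subspace_form[OF v(1) P(2) elimination_form[OF p(3,4)]
            vanishes_on_ig[OF elimination_form[OF p(3,4)] elimination_form_igm]] .
      ultimately have "?c = 0" by (rule DERIV_unique)
      then show ?thesis using x(1,2) n odd_neq_0[of n] by simp
    qed
  qed
  then have "cfun.dim ?V \<le> card {0, d - 1, d}"
    by (intro dim_le_of_determining_coords subspace_tangent_subspace) auto
  also have "\<dots> \<le> 3" by (simp add: card_insert_if)
  finally show ?thesis .
qed

section \<open>Lower bound for the dimension\<close>

text \<open>Points are closed: the linear forms \<open>x j * z i - x i * z j\<close>, for a fixed
  \<open>j\<close> with \<open>x j \<noteq> 0\<close>, force \<open>z\<close> to be proportional to
  \<open>x\<close>.\<close>

lemma proj_closure_point:
  assumes "P \<in> proj_space d" "x \<in> P"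
  shows "proj_closure d {x} = {P}"
proof (intro equalityI subsetI)
  fix Q assume Q: "Q \<in> proj_closure d {x}"
  then have Qs: "Q \<in> proj_space d" using proj_closure_space by blast
  obtain y where y: "y \<in> Q" using proj_space_nonempty[OF Qs] by blast
  obtain j where j: "j \<le> d" "x j \<noteq> 0" using proj_space_memD(3)[OF assms] by blast
  have e: "y i = y j / x j * x i" for i
  proof (cases "i \<le> d")
    case True
    have "(\<lambda>z. x j * z i - x i * z j) \<in> forms d 1"
      by (intro forms_diff forms_cmult forms_coord True j(1))
    from proj_closure_vanish[OF this _ Q y] have "x j * y i - x i * y j = 0" by simp
    then show ?thesis using j(2) by (simp add: field_simps)
  next
    case False
    then show ?thesis using proj_space_memD(1)[OF assms] proj_space_memD(1)[OF Qs y] by (simp add: cvecs_def)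
  qed
  have "y j / x j \<noteq> 0"
  proof
    assume "y j / x j = 0"
    then have "y i = 0" for i using e[of i] by (simp only: mult_zero_left)
    then have "y = 0" by (simp add: fun_eq_iff)
    then show False using proj_space_memD(2)[OF Qs y] by blast
  qed
  moreover have "y = cscale (y j / x j) (trunc d x)"
    unfolding trunc_eq[OF proj_space_memD(1)[OF assms]] cscale_def by (intro ext e)
  ultimately have "y \<in> proj_point d x"
    using proj_point_mem_iff[OF proj_space_memD(3)[OF assms], of y] by blast
  then have "y \<in> P" using proj_space_memD(4)[OF assms] by simp
  then show "Q \<in> {P}"
    using proj_space_memD(4)[OF Qs y] proj_space_memD(4)[OF assms(1), of y] by simp
next
  fix Q assume "Q \<in> {P}"
  then show "Q \<in> proj_closure d {x}"
    using proj_closure_mem[of x "{x}" d] proj_space_memD(3,4)[OF assms] by auto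
qed

lemma proj_closure_memI:
  assumes "P \<in> proj_space d" "x \<in> P" "h \<in> A" "c \<noteq> 0" "\<And>i. i \<le> d \<Longrightarrow> x i = c * h i"
  shows "P \<in> proj_closure d A" "P = proj_point d h"
proof -
  have nz: "\<exists>i\<le>d. h i \<noteq> 0" using proj_space_memD(3)[OF assms(1,2)] assms(4,5) by auto
  have "x = cscale c (trunc d h)"
    using assms(5) proj_space_memD(1)[OF assms(1,2)] by (auto simp: fun_eq_iff cscale_def trunc_def cvecs_def)
  then have "x \<in> proj_point d h" using proj_point_mem_iff[OF nz] assms(4) by blast
  then have "proj_point d h = proj_point d x" using proj_space_memD(4) proj_point_in_space[OF nz] by blast
  then show "P = proj_point d h" using proj_space_memD(4)[OF assms(1,2)] by simp
  then show "P \<in> proj_closure d A" using proj_closure_mem[OF assms(3) nz] by simp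
qed

lemma proj_closure_vanish_vec:
  assumes "g \<in> forms d k" "\<And>h. h \<in> A \<Longrightarrow> g h = 0" "proj_point d h \<in> proj_closure d A" "\<exists>i\<le>d. h i \<noteq> 0"
  shows "g h = 0"
  using proj_closure_vanish[OF assms(1-3) trunc_mem_proj_point[OF assms(4)]] forms_trunc[OF assms(1)] by simp

lemma proj_point_eqD:
  assumes "proj_point d h = proj_point d h'" "\<exists>i\<le>d. h i \<noteq> 0" "\<exists>i\<le>d. h' i \<noteq> 0"
  shows "\<exists>c. c \<noteq> 0 \<and> (\<forall>i\<le>d. h i = c * h' i)"
proof -
  obtain c where c: "c \<noteq> 0" "trunc d h = cscale c (trunc d h')"
    using trunc_mem_proj_point[OF assms(2)] proj_point_mem_iff[OF assms(3), of "trunc d h"] assms(1) by auto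
  have "h i = c * h' i" if "i \<le> d" for i
    using fun_cong[OF c(2), of i] that by (simp add: trunc_def cscale_def)
  then show ?thesis using c(1) by blast
qed

text \<open>This reduces the lower bound to finding an irreducible closed \<open>Z\<close> strictly
  between the point and \<open>X\<close>.\<close>

lemma local_dim_ge_2:
  assumes X: "closedin (zariski d) X" "irreducible_in (subtopology (zariski d) X) X"
    and Z: "closedin (zariski d) Z" "irreducible_in (subtopology (zariski d) X) Z" "Z \<subset> X"
    and P: "P \<in> Z" "Z \<noteq> {P}"
  shows "2 \<le> local_dim (subtopology (zariski d) X) P"
proof -
  have Psp: "P \<in> proj_space d"
    using P(1) Z(2) by (auto simp: irreducible_in_def topspace_subtopology topspace_zariski)
  obtain x where x: "x \<in> P" using proj_space_nonempty[OF Psp] by blast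
  have pt: "proj_closure d {x} = {P}" by (rule proj_closure_point[OF Psp x])
  have "irreducible_in (subtopology (zariski d) X) (proj_closure d {x})"
    by (rule irreducible_proj_closure[OF X(1)]) (use pt P Z(3) proj_space_memD(3)[OF Psp x] in auto)
  then have irrP: "irreducible_in (subtopology (zariski d) X) {P}" by (simp add: pt)
  have clP: "closedin (zariski d) {P}" using closedin_proj_closure[of d "{x}"] pt by simp
  define C where "C i = (if i = 0 then {P} else if i = 1 then Z else X)" for i :: nat
  have "closedin (subtopology (zariski d) X) (C i) \<and> irreducible_in (subtopology (zariski d) X) (C i)" for i
    using X Z clP irrP P by (auto simp: C_def closedin_closed_subtopology)
  moreover have "C i \<subset> C (Suc i)" if "i < 2" for i
    using that P Z(3) by (auto simp: C_def less_2_cases_iff)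
  moreover have "P \<in> C 0" by (simp add: C_def)
  ultimately have "enat 2 \<le> local_dim (subtopology (zariski d) X) P"
    unfolding local_dim_def by (intro Sup_upper CollectI exI[of _ 2] conjI refl exI[of _ C]) auto
  then show ?thesis by (simp add: numeral_eq_enat)
qed

lemma closedin_ig: "closedin (zariski d) (ig_moment_variety d)"
  by (simp add: ig_moment_variety_eq closedin_proj_closure)

lemma ig_in_space: "P \<in> ig_moment_variety d \<Longrightarrow> P \<in> proj_space d"
  using proj_closure_space by (auto simp: ig_moment_variety_eq)

lemma igm_in_ig: "proj_point d (igm \<mu> a) \<in> ig_moment_variety d"
proof -
  have "igm \<mu> a \<in> igms" unfolding igms_def by blast
  then show ?thesis unfolding ig_moment_variety_eq using proj_closure_mem igms_nonzero by blast
qed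

lemma proj_closure_subset_ig:
  assumes "\<And>g k h. g \<in> forms d k \<Longrightarrow> (\<And>\<mu> a. g (igm \<mu> a) = 0) \<Longrightarrow> h \<in> A \<Longrightarrow> g h = 0"
  shows "proj_closure d A \<subseteq> ig_moment_variety d"
proof
  fix P assume P: "P \<in> proj_closure d A"
  have "g x = 0" if g: "g \<in> forms d k" "\<forall>h\<in>igms. g h = 0" and x: "x \<in> P" for g k x
  proof (rule proj_closure_vanish[OF g(1) _ P x])
    show "g h = 0" if "h \<in> A" for h
      using assms[OF g(1) _ that] g(2) by (auto simp: igms_def)
  qed
  then show "P \<in> ig_moment_variety d"
    using P unfolding ig_moment_variety_eq proj_closure_def by blast
qed

text \<open>Two parameter pairs are joined by a straight segment, whose image is a polynomial curve
  of moment vectors.\<close>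

lemma irreducible_ig:
  "irreducible_in (subtopology (zariski d) (ig_moment_variety d)) (ig_moment_variety d)"
proof -
  have "irreducible_in (subtopology (zariski d) (ig_moment_variety d)) (proj_closure d igms)"
  proof (rule irreducible_proj_closure_curves[OF closedin_ig])
    fix u v assume "u \<in> igms" "v \<in> igms"
    then obtain \<mu>1 a1 \<mu>2 a2 where uv: "u = igm \<mu>1 a1" "v = igm \<mu>2 a2" by (auto simp: igms_def)
    define \<gamma> where "\<gamma> s = igm (poly [:\<mu>1, \<mu>2 - \<mu>1:] s) (poly [:a1, a2 - a1:] s)" for s
    have "\<gamma> 0 = u" "\<gamma> 1 = v" "\<forall>s. \<gamma> s \<in> igms"
      by (auto simp: \<gamma>_def uv igms_def)
    moreover have "\<forall>i\<le>d. \<exists>q. \<forall>s. \<gamma> s i = poly q s" unfolding \<gamma>_def using igm_poly by blast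
    ultimately show "\<exists>\<gamma>. \<gamma> 0 = u \<and> \<gamma> 1 = v \<and> (\<forall>s. \<gamma> s \<in> igms) \<and> (\<forall>i\<le>d. \<exists>q. \<forall>s. \<gamma> s i = poly q s)"
      by blast
  qed (use igms_nonempty igms_nonzero ig_moment_variety_eq in auto)
  then show ?thesis by (simp add: ig_moment_variety_eq)
qed

text \<open>The intermediate curve keeps \<mu> fixed and lets \<open>a\<close> vary. It is proper
  because \<open>z 1 - \<mu> * z 0\<close> vanishes on it, and not a point because
  \<open>m\<^sub>2 = a\<mu> + \<mu>\<^sup>2\<close> varies with \<open>a\<close>.\<close>

lemma local_dim_affine:
  assumes d: "d \<ge> 3" and P: "P \<in> ig_moment_variety d" "x \<in> P" and x: "x 0 \<noteq> 0" "x 1 \<noteq> 0"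
  shows "2 \<le> local_dim (subtopology (zariski d) (ig_moment_variety d)) P"
proof -
  define \<mu> where "\<mu> = x 1 / x 0"
  define a where "a = (x 2 * x 0 - (x 1)\<^sup>2) / (x 0 * x 1)"
  define A where "A = {igm \<mu> b | b. True}"
  have Aigm: "igm \<mu> b \<in> A" for b by (auto simp: A_def)
  have Anz: "\<exists>i\<le>d. h i \<noteq> 0" if "h \<in> A" for h using that by (auto simp: A_def intro!: exI[of _ 0])
  have sub: "proj_closure d A \<subseteq> ig_moment_variety d"
    by (rule proj_closure_subset_ig) (auto simp: A_def)
  have PA: "P \<in> proj_closure d A" "P = proj_point d (igm \<mu> a)"
    using proj_closure_memI[OF ig_in_space[OF P(1)] P(2) Aigm x(1), of a] ig_point_affine[OF P x]
    unfolding \<mu>_def a_def by blast+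
  show ?thesis
  proof (rule local_dim_ge_2[OF closedin_ig irreducible_ig closedin_proj_closure _ _ PA(1)])
    show "irreducible_in (subtopology (zariski d) (ig_moment_variety d)) (proj_closure d A)"
    proof (rule irreducible_proj_closure_curves[OF closedin_ig sub])
      fix u v assume "u \<in> A" "v \<in> A"
      then obtain a1 a2 where uv: "u = igm \<mu> a1" "v = igm \<mu> a2" by (auto simp: A_def)
      define \<gamma> where "\<gamma> s = igm (poly [:\<mu>:] s) (poly [:a1, a2 - a1:] s)" for s
      have "\<gamma> 0 = u" "\<gamma> 1 = v" "\<forall>s. \<gamma> s \<in> A"
        by (auto simp: \<gamma>_def uv A_def)
      moreover have "\<forall>i\<le>d. \<exists>q. \<forall>s. \<gamma> s i = poly q s" unfolding \<gamma>_def using igm_poly by blast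
      ultimately show "\<exists>\<gamma>. \<gamma> 0 = u \<and> \<gamma> 1 = v \<and> (\<forall>s. \<gamma> s \<in> A) \<and> (\<forall>i\<le>d. \<exists>q. \<forall>s. \<gamma> s i = poly q s)"
        by blast
    qed (use Aigm Anz in auto)
    have "proj_point d (igm (\<mu> + 1) 0) \<notin> proj_closure d A"
    proof
      assume *: "proj_point d (igm (\<mu> + 1) 0) \<in> proj_closure d A"
      have "(\<lambda>z. z 1 - \<mu> * z 0) \<in> forms d 1"
        using d by (intro forms_diff forms_cmult forms_coord) auto
      then have "igm (\<mu> + 1) 0 1 - \<mu> * igm (\<mu> + 1) 0 0 = 0"
        by (rule proj_closure_vanish_vec[OF _ _ *]) (auto simp: A_def intro!: exI[of _ 0])
      then show False by simp
    qed
    then show "proj_closure d A \<subset> ig_moment_variety d" using sub igm_in_ig by blast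
    show "proj_closure d A \<noteq> {P}"
    proof
      assume *: "proj_closure d A = {P}"
      have "proj_point d (igm \<mu> (a + 1)) \<in> proj_closure d A"
        using proj_closure_mem[OF Aigm Anz[OF Aigm]] .
      then have "proj_point d (igm \<mu> (a + 1)) = proj_point d (igm \<mu> a)" using * PA(2) by simp
      from proj_point_eqD[OF this Anz[OF Aigm] Anz[OF Aigm]] obtain c where
        c: "\<And>i. i \<le> d \<Longrightarrow> igm \<mu> (a + 1) i = c * igm \<mu> a i" by blast
      have "c = 1" using c[of 0] by simp
      then have "\<mu> = 0" using c[of 2] d by (simp add: igm_two algebra_simps)
      then show False using x by (simp add: \<mu>_def)
    qed
  qed
qed

section \<open>The line through the first and the last coordinate point\<close>

text \<open>The reverse Bessel polynomials. Once the factor \<open>\<mu> * a ^ n\<close> is split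
  off from the moment \<open>n + 1\<close>, the rest depends only on
  \<open>\<mu> / a\<close>.\<close>

fun reverse_bessel :: "nat \<Rightarrow> complex \<Rightarrow> complex" where
  "reverse_bessel 0 w = 1"
| "reverse_bessel (Suc 0) w = 1 + w"
| "reverse_bessel (Suc (Suc n)) w = (2 * of_nat n + 3) * reverse_bessel (Suc n) w + w\<^sup>2 * reverse_bessel n w"

lemma igm_reverse_bessel:
  "a \<noteq> 0 \<Longrightarrow> igm \<mu> a (Suc n) = \<mu> * a ^ n * reverse_bessel n (\<mu> / a)"
proof (induction n rule: induct_nat_012)
  case (ge2 n)
  then show ?case
    by (simp add: algebra_simps power2_eq_square)
qed (simp_all add: field_simps power2_eq_square)

lemma reverse_bessel_poly: "\<exists>q. \<forall>s. reverse_bessel n (poly p s) = poly q s"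
proof (induction n rule: induct_nat_012)
  case 0
  show ?case by (intro exI[of _ 1]) simp
next
  case 1
  show ?case by (intro exI[of _ "1 + p"]) simp
next
  case (ge2 n)
  then obtain q1 q2 where "\<And>s. reverse_bessel n (poly p s) = poly q1 s"
    "\<And>s. reverse_bessel (Suc n) (poly p s) = poly q2 s" by blast
  then show ?case
    by (intro exI[of _ "smult (2 * of_nat n + 3) q2 + p\<^sup>2 * q1"]) simp
qed

text \<open>The value at 0 is the odd double factorial \<open>1 * 3 * ... * (2 * n - 1)\<close>;
  only its being a positive integer is recorded.\<close>

lemma reverse_bessel_zero: "reverse_bessel n 0 \<noteq> 0"
proof -
  have "\<exists>k. reverse_bessel n 0 = of_nat (Suc k)"
  proof (induction n rule: induct_nat_012)
    case (ge2 n)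
    then obtain k where "reverse_bessel (Suc n) 0 = of_nat (Suc k)" by blast
    then have "reverse_bessel (Suc (Suc n)) 0 = of_nat (Suc ((2 * n + 3) * k + 2 * n + 2))"
      by (simp add: algebra_simps)
    then show ?case by blast
  qed (auto intro!: exI[of _ 0])
  then show ?thesis using of_nat_neq_0 by metis
qed

definition end_vec :: "nat \<Rightarrow> complex \<Rightarrow> nat \<Rightarrow> complex" where
  "end_vec d c = (\<lambda>i. if i = 0 then 1 else if i = d then c else 0)"

text \<open>The vector is the limit, as \<open>u\<close> tends to 0, of the moments with \<open>a = 1/u\<close> and \<open>\<mu>\<close> proportional
  to \<open>u ^ (d - 1)\<close>.\<close>

lemma end_vec_vanish:
  assumes g: "g \<in> forms d k" "\<And>\<mu> a. g (igm \<mu> a) = 0" and d: "d \<ge> 1"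
  shows "g (end_vec d c) = 0"
proof -
  \<comment> \<open>The scaling makes the last coordinate tend to \<open>c\<close>. With
    \<open>a = 1 / u\<close> and \<open>\<mu> = c' * u ^ (d - 1)\<close> the negative powers of
    \<open>u\<close> cancel, which gives the polynomial expression \<gamma>, defined also at
    \<open>u = 0\<close>.\<close>
  define c' where "c' = c / reverse_bessel (d - 1) 0"
  define \<gamma> where "\<gamma> u i = (if i = 0 then 1 else c' * u ^ (d - i) * reverse_bessel (i - 1) (c' * u ^ d))" for u i
  have "\<exists>q. \<forall>s. \<gamma> s i = poly q s" for i
  proof (cases "i = 0")
    case True
    then show ?thesis by (intro exI[of _ 1]) (simp add: \<gamma>_def)
  next
    case False
    obtain q where "\<And>s. reverse_bessel (i - 1) (poly (monom c' d) s) = poly q s"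
      using reverse_bessel_poly by blast
    then show ?thesis using False
      by (intro exI[of _ "monom c' (d - i) * q"]) (simp add: \<gamma>_def poly_monom)
  qed
  then obtain q where q: "\<And>s. g (\<gamma> s) = poly q s" using forms_along_curve[OF g(1), of \<gamma>] by blast
  have "poly q u = 0" if u: "u \<noteq> 0" for u
  proof -
    have "trunc d (\<gamma> u) = trunc d (igm (c' * u ^ (d - 1)) (1 / u))"
    proof
      fix i
      show "trunc d (\<gamma> u) i = trunc d (igm (c' * u ^ (d - 1)) (1 / u)) i"
      proof (cases "i = 0 \<or> i > d")
        case True
        then show ?thesis by (auto simp: trunc_def \<gamma>_def)
      next
        case False
        then obtain n where n: "i = Suc n" "n < d" by (cases i) auto
        obtain e where e: "d = Suc n + e" using n(2) less_iff_Suc_add by auto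
        show ?thesis
          using u by (simp add: trunc_def \<gamma>_def n e igm_reverse_bessel power_add field_simps)
      qed
    qed
    then have "g (\<gamma> u) = g (igm (c' * u ^ (d - 1)) (1 / u))" using forms_trunc[OF g(1)] by metis
    then show ?thesis using g(2) q by simp
  qed
  then have "q = 0" by (rule poly_zero_except_point)
  then have "g (\<gamma> 0) = 0" using q by simp
  moreover have "trunc d (\<gamma> 0) = trunc d (end_vec d c)"
    using d reverse_bessel_zero[of "d - 1"]
    by (auto simp: fun_eq_iff trunc_def \<gamma>_def end_vec_def c'_def power_0_left)
  ultimately show ?thesis using forms_trunc[OF g(1)] by metis
qed

text \<open>The intermediate curve is the joining line itself; it is proper because
  \<open>z 1\<close> vanishes on it.\<close>

lemma local_dim_line:
  assumes d: "d \<ge> 3" and P: "P \<in> ig_moment_variety d" "x \<in> P"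
    and x: "x 0 \<noteq> 0" "\<And>i. 1 \<le> i \<Longrightarrow> i < d \<Longrightarrow> x i = 0"
  shows "2 \<le> local_dim (subtopology (zariski d) (ig_moment_variety d)) P"
proof -
  define A where "A = range (end_vec d)"
  have Aev: "end_vec d c \<in> A" for c by (auto simp: A_def)
  have Anz: "\<exists>i\<le>d. h i \<noteq> 0" if "h \<in> A" for h using that by (auto simp: A_def end_vec_def intro!: exI[of _ 0])
  have sub: "proj_closure d A \<subseteq> ig_moment_variety d"
    by (rule proj_closure_subset_ig) (use end_vec_vanish d in \<open>auto simp: A_def\<close>)
  have "x i = x 0 * end_vec d (x d / x 0) i" if "i \<le> d" for i
    using x that d by (auto simp: end_vec_def)
  then have PA: "P \<in> proj_closure d A" "P = proj_point d (end_vec d (x d / x 0))"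
    using proj_closure_memI[OF ig_in_space[OF P(1)] P(2) Aev x(1), of "x d / x 0"] by blast+
  show ?thesis
  proof (rule local_dim_ge_2[OF closedin_ig irreducible_ig closedin_proj_closure _ _ PA(1)])
    show "irreducible_in (subtopology (zariski d) (ig_moment_variety d)) (proj_closure d A)"
    proof (rule irreducible_proj_closure_curves[OF closedin_ig sub])
      fix u v assume "u \<in> A" "v \<in> A"
      then obtain c1 c2 where uv: "u = end_vec d c1" "v = end_vec d c2" by (auto simp: A_def)
      define \<gamma> where "\<gamma> s = end_vec d (poly [:c1, c2 - c1:] s)" for s
      have "\<gamma> 0 = u" "\<gamma> 1 = v" "\<forall>s. \<gamma> s \<in> A"
        by (auto simp: \<gamma>_def uv A_def)
      moreover have "\<exists>q. \<forall>s. \<gamma> s i = poly q s" for i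
        unfolding \<gamma>_def end_vec_def
        by (intro exI[of _ "if i = 0 then 1 else if i = d then [:c1, c2 - c1:] else 0"]) simp
      ultimately show "\<exists>\<gamma>. \<gamma> 0 = u \<and> \<gamma> 1 = v \<and> (\<forall>s. \<gamma> s \<in> A) \<and> (\<forall>i\<le>d. \<exists>q. \<forall>s. \<gamma> s i = poly q s)"
        by blast
    qed (use Aev Anz in auto)
    have "proj_point d (igm 1 0) \<notin> proj_closure d A"
    proof
      assume *: "proj_point d (igm 1 0) \<in> proj_closure d A"
      have "(\<lambda>z. z 1) \<in> forms d 1"
        using d by (intro forms_coord) auto
      then have "igm 1 0 1 = 0"
        by (rule proj_closure_vanish_vec[OF _ _ *]) (use d in \<open>auto simp: A_def end_vec_def intro!: exI[of _ 0]\<close>)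
      then show False by simp
    qed
    then show "proj_closure d A \<subset> ig_moment_variety d" using sub igm_in_ig by blast
    show "proj_closure d A \<noteq> {P}"
    proof
      assume *: "proj_closure d A = {P}"
      let ?c = "x d / x 0"
      have "proj_point d (end_vec d (?c + 1)) \<in> proj_closure d A"
        using proj_closure_mem[OF Aev Anz[OF Aev]] .
      then have "proj_point d (end_vec d (?c + 1)) = proj_point d (end_vec d ?c)" using * PA(2) by simp
      from proj_point_eqD[OF this Anz[OF Aev] Anz[OF Aev]] obtain c where
        c: "\<And>i. i \<le> d \<Longrightarrow> end_vec d (?c + 1) i = c * end_vec d ?c i" by blast
      have "c = 1" using c[of 0] by (simp add: end_vec_def)
      then show False using c[of d] d by (simp add: end_vec_def)
    qed
  qed
qed

section \<open>The tangent space at the first coordinate point\<close>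

text \<open>Members of the vanishing ideal need not be homogeneous, so the scalar is carried along;
  it must be nonzero because the zero vector represents no point.\<close>

lemma igm_in_cone:
  assumes "f \<in> vanishing_ideal d (ig_moment_variety d)" "c \<noteq> 0"
  shows "poly_eval f (\<lambda>i. c * igm \<mu> a i) = 0"
proof -
  have f: "f \<in> polys_upto d" using assms(1) by (simp add: vanishing_ideal_def)
  have "\<exists>i\<le>d. igm \<mu> a i \<noteq> 0" by (intro exI[of _ 0]) simp
  then have "cscale c (trunc d (igm \<mu> a)) \<in> proj_point d (igm \<mu> a)"
    using proj_point_mem_iff assms(2) by blast
  then have "poly_eval f (cscale c (trunc d (igm \<mu> a))) = 0"
    using assms(1) igm_in_ig unfolding vanishing_ideal_def by blast
  moreover have "poly_eval f (cscale c (trunc d (igm \<mu> a))) = poly_eval f (\<lambda>i. c * igm \<mu> a i)"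
    by (rule poly_eval_cong[OF f]) (simp add: cscale_def trunc_def)
  ultimately show ?thesis by simp
qed

text \<open>At \<mu> = 0 the summand with \<open>\<mu>\<^sup>2\<close> has derivative 0, so the
  derivatives satisfy the recurrence of \<open>reverse_bessel\<close> at 0.\<close>

lemma igm_deriv_mu_zero:
  "((\<lambda>\<mu>. igm \<mu> a (Suc n)) has_field_derivative a ^ n * reverse_bessel n 0) (at 0)"
proof (induction n rule: induct_nat_012)
  case 0
  show ?case by (auto intro!: derivative_eq_intros)
next
  case 1
  show ?case by (auto intro!: derivative_eq_intros)
next
  case (ge2 n)
  have "((\<lambda>\<mu>. (2 * of_nat (Suc n) + 1) * a * igm \<mu> a (Suc (Suc n)) + \<mu>\<^sup>2 * igm \<mu> a (Suc n))
    has_field_derivative (2 * of_nat (Suc n) + 1) * a * (a ^ Suc n * reverse_bessel (Suc n) 0)) (at 0)"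
    by (rule derivative_eq_intros ge2 refl)+ (simp add: igm_mu_zero)
  then show ?case by (simp add: algebra_simps)
qed

lemma partial_deriv_first_point:
  assumes f: "f \<in> vanishing_ideal d (ig_moment_variety d)" and c: "c \<noteq> 0" and j: "j \<le> d"
  shows "poly_eval (partial_deriv j f) (\<lambda>i. if i = 0 then c else 0) = 0"
proof -
  let ?E = "\<lambda>i. if i = (0::nat) then c else 0"
  let ?D = "\<lambda>j. poly_eval (partial_deriv j f) ?E"
  have fd: "f \<in> polys_upto d" using f by (simp add: vanishing_ideal_def)
  have E: "(\<lambda>i. c * igm 0 a i) = ?E" for a
    by (auto simp: fun_eq_iff igm_mu_zero)
  have "?D 0 = 0"
  proof -
    have "((\<lambda>s. poly_eval f (\<lambda>i. (c + s) * igm 0 0 i)) has_field_derivative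
        (\<Sum>j\<le>d. poly_eval (partial_deriv j f) (\<lambda>i. (c + 0) * igm 0 0 i) * igm 0 0 j)) (at 0)"
      by (rule poly_eval_has_derivative[OF fd]) (auto intro!: derivative_eq_intros)
    moreover have "((\<lambda>s. poly_eval f (\<lambda>i. (c + s) * igm 0 0 i)) has_field_derivative 0) (at 0)"
    proof (rule DERIV_cong_ev[THEN iffD1, OF refl _ refl DERIV_const[of 0]])
      \<comment> \<open>For \<open>s = - c\<close> the vector is zero and not a representative; near
        0 this does not happen.\<close>
      have "eventually (\<lambda>s. s \<noteq> - c) (nhds 0)"
        using c by (intro t1_space_nhds) auto
      then show "eventually (\<lambda>s. 0 = poly_eval f (\<lambda>i. (c + s) * igm 0 0 i)) (nhds 0)"
        by eventually_elim (simp add: igm_in_cone[OF f] add_eq_0_iff)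
    qed
    ultimately have "(\<Sum>j\<le>d. poly_eval (partial_deriv j f) (\<lambda>i. c * igm 0 0 i) * igm 0 0 j) = 0"
      by (auto dest: DERIV_unique)
    moreover have "(\<Sum>j\<le>d. ?D j * igm 0 0 j) = (\<Sum>j\<le>d. if j = 0 then ?D 0 else 0)"
      by (intro sum.cong) (auto simp: igm_mu_zero)
    ultimately show ?thesis by (simp add: E sum.delta)
  qed
  moreover have "?D (Suc n) = 0" if "n < d" for n
  proof -
    have *: "(\<Sum>n<d. ?D (Suc n) * (c * (a ^ n * reverse_bessel n 0))) = 0" for a
    proof -
      define D' where "D' j = (case j of 0 \<Rightarrow> 0 | Suc n \<Rightarrow> c * (a ^ n * reverse_bessel n 0))" for j
      have "((\<lambda>s. poly_eval f (\<lambda>i. c * igm s a i)) has_field_derivative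
          (\<Sum>j\<le>d. poly_eval (partial_deriv j f) (\<lambda>i. c * igm 0 a i) * D' j)) (at 0)"
      proof (rule poly_eval_has_derivative[OF fd])
        fix i
        show "((\<lambda>s. c * igm s a i) has_field_derivative D' i) (at 0)"
        proof (cases i)
          case (Suc n)
          then show ?thesis unfolding D'_def using DERIV_cmult[OF igm_deriv_mu_zero] by simp
        qed (simp add: D'_def)
      qed
      then have "(\<Sum>j\<le>d. poly_eval (partial_deriv j f) (\<lambda>i. c * igm 0 a i) * D' j) = 0"
        using igm_in_cone[OF f c] by (auto dest: DERIV_unique[OF _ DERIV_const])
      then have "(\<Sum>j\<le>d. ?D j * D' j) = 0" unfolding E .
      moreover have "(\<Sum>j\<le>d. ?D j * D' j) = ?D 0 * D' 0 + (\<Sum>n<d. ?D (Suc n) * D' (Suc n))"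
        by (rule sum.atMost_shift)
      ultimately show ?thesis by (simp add: D'_def)
    qed
    \<comment> \<open>As \<open>a\<close> varies, the relation becomes a polynomial identity whose
      coefficients are nonzero multiples of the partial derivatives.\<close>
    define q where "q = (\<Sum>n<d. monom (?D (Suc n) * c * reverse_bessel n 0) n)"
    have "poly q a = 0" for a
      using *[of a] by (simp add: q_def poly_sum poly_monom mult_ac)
    then have "q = 0" using poly_zero_except_point by blast
    then have "coeff q n = 0" by simp
    also have "coeff q n = ?D (Suc n) * c * reverse_bessel n 0"
      using that by (simp add: q_def coeff_sum sum.delta)
    finally show ?thesis using c reverse_bessel_zero by simp
  qed
  ultimately show ?thesis using j by (cases j) auto
qed

section \<open>Zeros of the moments\<close>

text \<open>\<open>bessel_poly (Suc n)\<close> is the Bessel polynomial \<open>y\<^sub>n\<close>, of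
  degree \<open>n\<close>.\<close>

fun bessel_poly :: "nat \<Rightarrow> complex poly" where
  "bessel_poly 0 = 1"
| "bessel_poly (Suc 0) = 1"
| "bessel_poly (Suc (Suc n)) = smult (2 * of_nat n + 1) (pCons 0 (bessel_poly (Suc n))) + bessel_poly n"

lemma poly_bessel_poly: "poly (bessel_poly n) t = igm 1 t n"
  by (induction n rule: bessel_poly.induct) (simp_all add: mult.assoc)

lemma igm_scale: "igm (r * \<mu>) (r * a) n = r ^ n * igm \<mu> a n"
  by (induction n rule: bessel_poly.induct) (simp_all add: algebra_simps power2_eq_square)

text \<open>For \<mu> = 1 the lower term of the recurrence has coefficient 1, so two consecutive
  zeros would propagate down to the moment 0, which is 1.\<close>

lemma igm_one_no_common_root: "igm 1 t n = 0 \<Longrightarrow> igm 1 t (Suc n) \<noteq> 0"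
proof (induction n)
  case (Suc n)
  then show ?case by auto
qed simp

lemma igm_one_zero: "igm 1 0 n = 1"
  by (induction n rule: bessel_poly.induct) simp_all

lemma degree_bessel_poly: "degree (bessel_poly (Suc n)) = n"
proof (induction n rule: induct_nat_012)
  case (ge2 n)
  have "bessel_poly (Suc (Suc n)) \<noteq> 0" using ge2(2) by auto
  then have "degree (smult (2 * of_nat (Suc n) + 1) (pCons 0 (bessel_poly (Suc (Suc n))))) = Suc (Suc n)"
    using ge2(2) odd_neq_0[of "Suc n"] degree_pCons_eq[of "bessel_poly (Suc (Suc n))" 0]
    by (simp only: degree_smult_eq if_False not_False_eq_True simp_thms)
  then show ?case
    using ge2(1) by (subst bessel_poly.simps(3)) (simp add: degree_add_eq_left del: bessel_poly.simps)
qed (simp_all add: one_pCons)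

text \<open>Differentiating the recurrence couples the two identities, hence the joint induction. At
  a root of \<open>bessel_poly (Suc n)\<close> the second turns the derivative into
  \<open>igm 1 t n\<close>, which is nonzero there; so the roots are simple.\<close>

lemma pderiv_bessel_poly:
  "t\<^sup>2 * poly (pderiv (bessel_poly n)) t = igm 1 t (Suc n) - (of_nat n * t + 1) * igm 1 t n \<and>
   t\<^sup>2 * poly (pderiv (bessel_poly (Suc n))) t = (of_nat n * t - 1) * igm 1 t (Suc n) + igm 1 t n"
proof (induction n)
  case 0
  show ?case by simp
next
  case (Suc n)
  have "t\<^sup>2 * poly (pderiv (bessel_poly (Suc (Suc n)))) t =
      (2 * of_nat n + 1) * (t\<^sup>2 * igm 1 t (Suc n) + t * (t\<^sup>2 * poly (pderiv (bessel_poly (Suc n))) t)) +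
      t\<^sup>2 * poly (pderiv (bessel_poly n)) t"
    by (simp add: pderiv_add pderiv_smult pderiv_pCons poly_bessel_poly algebra_simps)
  moreover have a: "t\<^sup>2 * poly (pderiv (bessel_poly n)) t = igm 1 t (Suc n) - (of_nat n * t + 1) * igm 1 t n"
    and b: "t\<^sup>2 * poly (pderiv (bessel_poly (Suc n))) t = (of_nat n * t - 1) * igm 1 t (Suc n) + igm 1 t n"
    using Suc by blast+
  ultimately have "t\<^sup>2 * poly (pderiv (bessel_poly (Suc (Suc n)))) t =
      (of_nat (Suc n) * t - 1) * igm 1 t (Suc (Suc n)) + igm 1 t (Suc n)"
    unfolding a b by (simp add: algebra_simps power2_eq_square del: bessel_poly.simps)
  then show ?case unfolding b by (simp add: algebra_simps del: bessel_poly.simps)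
qed

lemma card_roots_rsquarefree:
  fixes p :: "complex poly"
  assumes "rsquarefree p"
  shows "card {z. poly p z = 0} = degree p"
proof -
  have nz: "p \<noteq> 0" using assms by (auto simp: rsquarefree_def)
  have "degree p = degree (smult (lead_coeff p) (\<Prod>z | poly p z = 0. [:-z, 1:]))"
    using complex_poly_decompose_rsquarefree[OF assms] by simp
  also have "\<dots> = (\<Sum>z | poly p z = 0. 1)"
    using nz by (simp add: degree_prod_eq_sum_degree)
  finally show ?thesis by simp
qed

lemma card_igm_one_roots: "card {t. igm 1 t (Suc n) = 0} = n"
proof -
  have "rsquarefree (bessel_poly (Suc n))"
    unfolding rsquarefree_roots
  proof (intro allI notI)
    fix t assume t: "poly (bessel_poly (Suc n)) t = 0 \<and> poly (pderiv (bessel_poly (Suc n))) t = 0"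
    then have z: "igm 1 t (Suc n) = 0" by (simp add: poly_bessel_poly)
    then have "igm 1 t n = 0" using pderiv_bessel_poly[of t n] t by simp
    then show False using igm_one_no_common_root z by blast
  qed
  from card_roots_rsquarefree[OF this] show ?thesis by (simp add: poly_bessel_poly degree_bessel_poly)
qed

text \<open>There are \<open>d - 1\<close> distinct roots. If all lay in \<open>{t1, - t1}\<close>,
  then \<open>d = 3\<close> and the roots of \<open>3t\<^sup>2 + 3t + 1\<close> would be opposite,
  although their sum is -1.\<close>

lemma igm_one_roots_distinct_squares:
  assumes "d \<ge> 3"
  obtains t1 t2 where "igm 1 t1 d = 0" "igm 1 t2 d = 0" "t1\<^sup>2 \<noteq> t2\<^sup>2"
proof -
  let ?R = "{t. igm 1 t d = 0}"
  have card: "card ?R = d - 1" using card_igm_one_roots[of "d - 1"] assms by simp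
  then have "?R \<noteq> {}" using assms by (intro notI) simp
  then obtain t1 where t1: "igm 1 t1 d = 0" by blast
  have "\<exists>t2. igm 1 t2 d = 0 \<and> t1\<^sup>2 \<noteq> t2\<^sup>2"
  proof (rule ccontr)
    assume "\<not> ?thesis"
    then have sub: "?R \<subseteq> {t1, - t1}" by (auto simp: power2_eq_iff)
    have "card ?R \<le> card {t1, - t1}" by (rule card_mono[OF _ sub]) simp
    also have "\<dots> \<le> 2" by (simp add: card_insert_if)
    finally have d: "d = 3" using card assms by simp
    have "?R = {t1, - t1}"
    proof (rule card_seteq[OF _ sub])
      show "card {t1, - t1} \<le> card ?R" using card d by (simp add: card_insert_if)
    qed simp
    then have r: "igm 1 (- t1) 3 = 0" using d by blast
    have "igm 1 t 3 = 3 * t\<^sup>2 + 3 * t + 1" for t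
      by (simp add: numeral_3_eq_3 algebra_simps power2_eq_square)
    then have "3 * t1\<^sup>2 - 3 * t1 + 1 = 0" "3 * t1\<^sup>2 + 3 * t1 + 1 = 0" using r t1 d by simp_all
    then have "t1 = 0" by algebra
    then show False using t1 igm_one_zero[of d] by simp
  qed
  then show ?thesis using that t1 by blast
qed

section \<open>The tangent space along the line at infinity\<close>

lemma tendsto_poly_eval:
  assumes "\<And>i. ((\<lambda>t. \<gamma> t i) \<longlongrightarrow> x i) F"
  shows "((\<lambda>t. poly_eval f (\<gamma> t)) \<longlongrightarrow> poly_eval f x) F"
  unfolding poly_eval_def monom_eval_def by (intro tendsto_intros assms)

lemma tendsto_monom_eval:
  assumes "\<And>i. ((\<lambda>t. \<gamma> t i) \<longlongrightarrow> x i) F"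
  shows "((\<lambda>t. monom_eval m (\<gamma> t)) \<longlongrightarrow> monom_eval m x) F"
  unfolding monom_eval_def by (intro tendsto_intros assms)

lemma eventually_poly_nonzero:
  fixes q :: "complex poly"
  assumes "q \<noteq> 0"
  shows "eventually (\<lambda>t. poly q t \<noteq> 0) (at t0)"
proof -
  have "closed ({t. poly q t = 0} - {t0})"
    using poly_roots_finite[OF assms] by (intro finite_imp_closed) simp
  then have "open (- ({t. poly q t = 0} - {t0}))" by (rule open_Compl)
  then show ?thesis unfolding eventually_at_topological by blast
qed

lemma tendsto_igm_one: "((\<lambda>t. igm 1 t n) \<longlongrightarrow> igm 1 t0 n) (at t0)"
  using isContD[OF poly_isCont[of t0 "bessel_poly n"]] by (simp add: poly_bessel_poly)

section \<open>Weights of monomials near the line at infinity\<close>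

text \<open>Writing \<open>d = e + 3\<close> names the four relevant indices \<open>e\<close> to
  \<open>e + 3\<close> without subtraction.\<close>

definition inf_vec :: "nat \<Rightarrow> complex \<Rightarrow> complex \<Rightarrow> nat \<Rightarrow> complex" where
  "inf_vec e x y = (\<lambda>i. if i = e + 2 then x else if i = e + 3 then y else 0)"

text \<open>The order in \<open>s\<close> of a monomial along a curve whose \<open>i\<close>th coordinate has order \<open>e + 2 - i\<close>
  (order 0 for the last coordinate \<open>i = e + 3\<close>).\<close>

definition weight :: "nat \<Rightarrow> (nat \<Rightarrow>\<^sub>0 nat) \<Rightarrow> nat" where
  "weight e m = (\<Sum>i\<le>e + 3. (e + 2 - i) * Poly_Mapping.lookup m i)"

lemma monom_eval_weight:
  assumes "Poly_Mapping.keys m \<subseteq> {..e + 3}"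
  shows "monom_eval m (\<lambda>i. s ^ (e + 2 - i) * z i) = s ^ weight e m * monom_eval m z"
  unfolding monom_eval_superset[OF finite_atMost assms] weight_def
  by (simp add: power_mult_distrib prod.distrib power_sum power_mult)

text \<open>A coordinate below \<open>e\<close> has weight at least 3. Hence the monomials of weight
  at most 2, which decide the expansion up to second order, contain apart from the last two
  variables at most one variable \<open>e\<close> or two variables \<open>e + 1\<close>.\<close>

definition low_weight :: "nat \<Rightarrow> (nat \<Rightarrow>\<^sub>0 nat) \<Rightarrow> nat" where
  "low_weight e m = (\<Sum>i<e. (e + 2 - i) * Poly_Mapping.lookup m i)"

lemma weight_split:
  "weight e m = low_weight e m + 2 * Poly_Mapping.lookup m e + Poly_Mapping.lookup m (e + 1)"
proof -
  have "{..e + 3} = {..<e} \<union> {e, e + 1, e + 2, e + 3}" by auto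
  then show ?thesis unfolding weight_def low_weight_def by (simp add: sum.union_disjoint)
qed

lemma low_weight_cases: "low_weight e m = 0 \<or> low_weight e m \<ge> 3"
proof (cases "\<exists>i<e. Poly_Mapping.lookup m i \<noteq> 0")
  case True
  then obtain i where i: "i < e" "Poly_Mapping.lookup m i \<noteq> 0" by blast
  have "3 * 1 \<le> (e + 2 - i) * Poly_Mapping.lookup m i" by (rule mult_le_mono) (use i in auto)
  also have "\<dots> \<le> low_weight e m" unfolding low_weight_def
    by (rule member_le_sum) (use i in auto)
  finally show ?thesis by simp
qed (auto simp: low_weight_def)

lemma low_weight_zero: "low_weight e m = 0 \<longleftrightarrow> (\<forall>i<e. Poly_Mapping.lookup m i = 0)"
  by (auto simp: low_weight_def)

definition top_monom :: "nat \<Rightarrow> (nat \<Rightarrow>\<^sub>0 nat) \<Rightarrow> complex \<Rightarrow> complex \<Rightarrow> complex" where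
  "top_monom e m x y = x ^ Poly_Mapping.lookup m (e + 2) * y ^ Poly_Mapping.lookup m (e + 3)"

lemma monom_eval_split:
  assumes "Poly_Mapping.keys m \<subseteq> {..e + 3}"
  shows "monom_eval m z = (\<Prod>i<e. z i ^ Poly_Mapping.lookup m i) * z e ^ Poly_Mapping.lookup m e *
    z (e + 1) ^ Poly_Mapping.lookup m (e + 1) * top_monom e m (z (e + 2)) (z (e + 3))"
proof -
  have "{..e + 3} = {..<e} \<union> {e, e + 1, e + 2, e + 3}" by auto
  then show ?thesis unfolding monom_eval_superset[OF finite_atMost assms] top_monom_def
    by (simp add: prod.union_disjoint mult.assoc)
qed

lemma monom_eval_low:
  assumes "Poly_Mapping.keys m \<subseteq> {..e + 3}" "low_weight e m = 0"
  shows "monom_eval m z = z e ^ Poly_Mapping.lookup m e *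
    z (e + 1) ^ Poly_Mapping.lookup m (e + 1) * top_monom e m (z (e + 2)) (z (e + 3))"
  using assms(2) unfolding monom_eval_split[OF assms(1)] low_weight_zero by simp

lemma monom_eval_inf_vec:
  assumes "Poly_Mapping.keys m \<subseteq> {..e + 3}"
  shows "monom_eval m (inf_vec e x y) = (if weight e m = 0 then top_monom e m x y else 0)"
proof (cases "low_weight e m = 0")
  case True
  then show ?thesis
    unfolding monom_eval_low[OF assms True] weight_split by (auto simp: inf_vec_def power_0_left)
next
  case False
  then obtain i where i: "i < e" "Poly_Mapping.lookup m i \<noteq> 0" by (auto simp: low_weight_zero)
  then have "(\<Prod>i<e. inf_vec e x y i ^ Poly_Mapping.lookup m i) = 0"
    by (intro prod_zero) (auto simp: inf_vec_def power_0_left)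
  then show ?thesis using False unfolding monom_eval_split[OF assms] weight_split by simp
qed

text \<open>Only the last two coordinates of \<open>inf_vec\<close> can be nonzero, so a derivative
  survives only if the monomial has the differentiated variable exactly once and otherwise just
  those two.\<close>

lemma partial_monom_inf_vec:
  assumes "Poly_Mapping.keys m \<subseteq> {..e + 3}"
  shows "of_nat (Poly_Mapping.lookup m (e + 1)) * monom_eval (m - Poly_Mapping.single (e + 1) 1) (inf_vec e x y) =
      (if weight e m = 1 then top_monom e m x y else 0)" (is ?A)
    and "of_nat (Poly_Mapping.lookup m e) * monom_eval (m - Poly_Mapping.single e 1) (inf_vec e x y) =
      (if weight e m = 2 \<and> Poly_Mapping.lookup m e = 1 then top_monom e m x y else 0)" (is ?B)
proof -
  have keys: "Poly_Mapping.keys (m - Poly_Mapping.single j 1) \<subseteq> {..e + 3}" for j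
  proof -
    have "Poly_Mapping.keys (m - Poly_Mapping.single j 1) \<subseteq> Poly_Mapping.keys m"
      by (auto simp: in_keys_iff lookup_minus)
    then show ?thesis using assms by blast
  qed
  have low: "low_weight e (m - Poly_Mapping.single j 1) = low_weight e m"
    and top: "top_monom e (m - Poly_Mapping.single j 1) x y = top_monom e m x y" if "j = e \<or> j = e + 1" for j
    using that unfolding low_weight_def top_monom_def
    by (auto simp: lookup_minus lookup_single when_def intro!: sum.cong)
  have lk: "Poly_Mapping.lookup (m - Poly_Mapping.single j 1) i =
      (if i = j then Poly_Mapping.lookup m i - 1 else Poly_Mapping.lookup m i)" for i j
    by (auto simp: lookup_minus lookup_single when_def)
  show ?A
    unfolding monom_eval_inf_vec[OF keys] weight_split lk low[OF disjI2[OF refl]] top[OF disjI2[OF refl]]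
    using low_weight_cases[of e m]
    by (cases "Poly_Mapping.lookup m (e + 1)") auto
  show ?B
    unfolding monom_eval_inf_vec[OF keys] weight_split lk low[OF disjI1[OF refl]] top[OF disjI1[OF refl]]
    using low_weight_cases[of e m]
    by (cases "Poly_Mapping.lookup m e") auto
qed

text \<open>It extracts the coefficients of order 0, 1 and 2 in \<open>s\<close> in turn, without
  expanding \<open>s\<close> itself in \<open>t\<close>.\<close>

lemma leading_term_vanishes:
  fixes a :: "complex \<Rightarrow> complex"
  assumes "eventually (\<lambda>t. a t + s t * b t = 0) (at t0)"
    and "(a \<longlongrightarrow> a0) (at t0)" "(b \<longlongrightarrow> b0) (at t0)" "(s \<longlongrightarrow> 0) (at t0)"
  shows "a0 = 0"
proof -
  have "((\<lambda>t. a t + s t * b t) \<longlongrightarrow> a0 + 0 * b0) (at t0)"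
    by (intro tendsto_intros assms(2-4))
  moreover have "((\<lambda>t. a t + s t * b t) \<longlongrightarrow> 0) (at t0)"
    using assms(1) by (rule tendsto_eventually)
  ultimately show ?thesis using tendsto_unique[OF trivial_limit_at] by fastforce
qed

text \<open>Half the second partial derivative in the coordinate \<open>e + 1\<close> at
  \<open>inf_vec e x y\<close>: a monomial of weight 2 contains either the variable \<open>e\<close>
  once or the variable \<open>e + 1\<close> twice.\<close>

definition square_coeff :: "nat \<Rightarrow> cpoly \<Rightarrow> complex \<Rightarrow> complex \<Rightarrow> complex" where
  "square_coeff e f x y = (\<Sum>m\<in>Poly_Mapping.keys f.
     if weight e m = 2 \<and> Poly_Mapping.lookup m e \<noteq> 1 then Poly_Mapping.lookup f m * top_monom e m x y else 0)"

text \<open>As \<open>t\<close> tends to a zero \<open>t0\<close> of the last moment, \<open>s\<close> tends to 0 and the curve below, which lies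
  on the cone, tends to \<open>inf_vec e x y\<close>; its last two coordinates are constant.\<close>

lemma inf_vec_expansion:
  assumes f: "f \<in> polys_upto (e + 3)"
    and cone: "\<And>c \<mu> a. c \<noteq> 0 \<Longrightarrow> poly_eval f (\<lambda>i. c * igm \<mu> a i) = 0"
    and xy: "x \<noteq> 0" "y \<noteq> 0" and t0: "igm 1 t0 (e + 3) = 0"
  defines "A \<equiv> (2 * of_nat e + 1) * (2 * of_nat e + 3 :: complex)"
  shows "poly_eval f (inf_vec e x y) = 0"
    and "poly_eval (partial_deriv (e + 1) f) (inf_vec e x y) = 0"
    and "poly_eval (partial_deriv e f) (inf_vec e x y) * (1 + A * t0\<^sup>2) +
       square_coeff e f x y * x * ((2 * of_nat e + 3) * t0)\<^sup>2 = 0"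
proof -
  define p where "p i t = igm 1 t i" for i t
  define z where "z t i = (if i \<le> e + 2 then x * p i t / p (e + 2) t else y)" for t i
  \<comment> \<open>After scaling coordinate \<open>e + 2\<close> to \<open>x\<close>, the last one
    is \<open>x * p (e + 3) t / (p (e + 2) t * s t)\<close>; this choice of \<open>s\<close> makes
    it equal to \<open>y\<close>.\<close>
  define s where "s t = x * p (e + 3) t / (y * p (e + 2) t)" for t
  let ?c = "Poly_Mapping.lookup f"
  let ?K = "Poly_Mapping.keys f"
  define R where "R t = (\<Sum>m\<in>?K. if weight e m \<ge> 3 then ?c m * s t ^ (weight e m - 3) * monom_eval m (z t) else 0)" for t
  define s0 where "s0 = poly_eval f (inf_vec e x y)"
  define k1 where "k1 = poly_eval (partial_deriv (e + 1) f) (inf_vec e x y)"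
  define k2 where "k2 = poly_eval (partial_deriv e f) (inf_vec e x y)"
  define B where "B t = z t e * k2 + (z t (e + 1))\<^sup>2 * square_coeff e f x y" for t
  have keys: "Poly_Mapping.keys m \<subseteq> {..e + 3}" if "m \<in> ?K" for m
    using f that unfolding polys_upto_def by blast
  have p0: "p (e + 2) t0 \<noteq> 0"
    using igm_one_no_common_root[of t0 "e + 2"] t0 by (auto simp: p_def eval_nat_numeral)
  have p_lim: "(p i \<longlongrightarrow> p i t0) (at t0)" for i
    unfolding p_def[abs_def] by (rule tendsto_igm_one)
  have z_lim: "((\<lambda>t. z t i) \<longlongrightarrow> z t0 i) (at t0)" for i
    unfolding z_def using p0 by (cases "i \<le> e + 2") (auto intro!: tendsto_intros p_lim)
  have "(s \<longlongrightarrow> x * p (e + 3) t0 / (y * p (e + 2) t0)) (at t0)"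
    unfolding s_def[abs_def] using p0 xy by (intro tendsto_intros p_lim) auto
  then have s_lim: "(s \<longlongrightarrow> 0) (at t0)" using t0 by (simp add: p_def)
  have "((\<lambda>t. if weight e m \<ge> 3 then ?c m * s t ^ (weight e m - 3) * monom_eval m (z t) else 0) \<longlongrightarrow>
     (if weight e m \<ge> 3 then ?c m * 0 ^ (weight e m - 3) * monom_eval m (z t0) else 0)) (at t0)" for m
    by (cases "weight e m \<ge> 3") (auto intro!: tendsto_intros tendsto_monom_eval z_lim s_lim)
  then have R_lim: "(R \<longlongrightarrow> (\<Sum>m\<in>?K. if weight e m \<ge> 3 then ?c m * 0 ^ (weight e m - 3) * monom_eval m (z t0) else 0)) (at t0)"
    unfolding R_def[abs_def] by (intro tendsto_sum)
  have B_lim: "(B \<longlongrightarrow> B t0) (at t0)"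
    unfolding B_def[abs_def] by (intro tendsto_intros z_lim)

  have s0_sum: "s0 = (\<Sum>m\<in>?K. if weight e m = 0 then ?c m * top_monom e m x y else 0)"
    unfolding s0_def poly_eval_def by (intro sum.cong refl) (simp add: monom_eval_inf_vec[OF keys])
  have k1_sum: "k1 = (\<Sum>m\<in>?K. if weight e m = 1 then ?c m * top_monom e m x y else 0)"
    unfolding k1_def poly_eval_partial_deriv
  proof (intro sum.cong refl)
    fix m assume "m \<in> ?K"
    from partial_monom_inf_vec(1)[OF keys[OF this], of x y]
    show "of_nat (Poly_Mapping.lookup m (e + 1)) * ?c m * monom_eval (m - Poly_Mapping.single (e + 1) 1) (inf_vec e x y) =
      (if weight e m = 1 then ?c m * top_monom e m x y else 0)"
      by (simp only: mult.assoc mult.left_commute[of _ "?c m"] if_distrib[of "(*) (?c m)"] mult_zero_right)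
  qed
  have k2_sum: "k2 = (\<Sum>m\<in>?K. if weight e m = 2 \<and> Poly_Mapping.lookup m e = 1 then ?c m * top_monom e m x y else 0)"
    unfolding k2_def poly_eval_partial_deriv
  proof (intro sum.cong refl)
    fix m assume "m \<in> ?K"
    from partial_monom_inf_vec(2)[OF keys[OF this], of x y]
    show "of_nat (Poly_Mapping.lookup m e) * ?c m * monom_eval (m - Poly_Mapping.single e 1) (inf_vec e x y) =
      (if weight e m = 2 \<and> Poly_Mapping.lookup m e = 1 then ?c m * top_monom e m x y else 0)"
      by (simp only: mult.assoc mult.left_commute[of _ "?c m"] if_distrib[of "(*) (?c m)"] mult_zero_right)
  qed

  \<comment> \<open>Grouping the monomials by weight gives the orders 0, 1, 2 and a remainder
    \<open>R\<close> that stays bounded near \<open>t0\<close>.\<close>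
  have expand: "poly_eval f (\<lambda>i. s t ^ (e + 2 - i) * z t i) =
      s0 + s t * (k1 * z t (e + 1) + s t * (B t + s t * R t))" if "p (e + 2) t \<noteq> 0" for t
  proof -
    have ztop: "z t (e + 2) = x" "z t (e + 3) = y" using that by (simp_all add: z_def)
    have summand: "?c m * monom_eval m (\<lambda>i. s t ^ (e + 2 - i) * z t i) =
       (if weight e m = 0 then ?c m * top_monom e m x y else 0) +
       s t * ((if weight e m = 1 then ?c m * top_monom e m x y else 0) * z t (e + 1)) +
       s t ^ 2 * (z t e * (if weight e m = 2 \<and> Poly_Mapping.lookup m e = 1 then ?c m * top_monom e m x y else 0)) +
       s t ^ 2 * ((z t (e + 1))\<^sup>2 * (if weight e m = 2 \<and> Poly_Mapping.lookup m e \<noteq> 1 then ?c m * top_monom e m x y else 0)) +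
       s t ^ 3 * (if weight e m \<ge> 3 then ?c m * s t ^ (weight e m - 3) * monom_eval m (z t) else 0)"
      if m: "m \<in> ?K" for m
    proof -
      note w = monom_eval_weight[OF keys[OF m], of "s t" "z t"]
      consider "weight e m \<ge> 3" | "weight e m = 0" | "weight e m = 1" | "weight e m = 2" by linarith
      then show ?thesis
      proof cases
        case 1
        then have "s t ^ weight e m = s t ^ 3 * s t ^ (weight e m - 3)" by (simp flip: power_add)
        then show ?thesis using 1 w by simp
      next
        case 2
        then have "low_weight e m = 0" "Poly_Mapping.lookup m e = 0" "Poly_Mapping.lookup m (e + 1) = 0"
          unfolding weight_split by auto
        then have "monom_eval m (z t) = top_monom e m x y"
          using monom_eval_low[OF keys[OF m], of "z t"] ztop by simp
        then show ?thesis using 2 w by simp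
      next
        case 3
        then have "low_weight e m = 0" "Poly_Mapping.lookup m e = 0" "Poly_Mapping.lookup m (e + 1) = 1"
          using low_weight_cases[of e m] unfolding weight_split by arith+
        then have "monom_eval m (z t) = z t (e + 1) * top_monom e m x y"
          using monom_eval_low[OF keys[OF m], of "z t"] ztop by simp
        then show ?thesis using 3 w by simp
      next
        case 4
        then have low: "low_weight e m = 0"
          and cs: "(Poly_Mapping.lookup m e = 1 \<and> Poly_Mapping.lookup m (e + 1) = 0) \<or>
          (Poly_Mapping.lookup m e = 0 \<and> Poly_Mapping.lookup m (e + 1) = 2)"
          using low_weight_cases[of e m] unfolding weight_split by arith+
        from cs show ?thesis
        proof
          assume "Poly_Mapping.lookup m e = 1 \<and> Poly_Mapping.lookup m (e + 1) = 0"
          then show ?thesis using 4 w monom_eval_low[OF keys[OF m] low, of "z t"] ztop by simp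
        next
          assume "Poly_Mapping.lookup m e = 0 \<and> Poly_Mapping.lookup m (e + 1) = 2"
          then show ?thesis using 4 w monom_eval_low[OF keys[OF m] low, of "z t"] ztop by simp
        qed
      qed
    qed
    have "poly_eval f (\<lambda>i. s t ^ (e + 2 - i) * z t i) =
      s0 + s t * (k1 * z t (e + 1)) + s t ^ 2 * (z t e * k2) +
      s t ^ 2 * ((z t (e + 1))\<^sup>2 * square_coeff e f x y) + s t ^ 3 * R t"
      unfolding poly_eval_def s0_sum k1_sum k2_sum square_coeff_def R_def
        sum_distrib_left sum_distrib_right sum.distrib[symmetric]
      by (intro sum.cong refl summand)
    then show ?thesis by (simp add: B_def algebra_simps power2_eq_square power3_eq_cube)
  qed
  have "bessel_poly (e + 2) \<noteq> 0" "bessel_poly (e + 3) \<noteq> 0"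
    using poly_bessel_poly[of "e + 2" 0] poly_bessel_poly[of "e + 3" 0] by (auto simp: igm_one_zero simp del: bessel_poly.simps)
  \<comment> \<open>Both polynomials take the value 1 at 0, so they are nonzero and have no roots
    near \<open>t0\<close> except possibly \<open>t0\<close>.\<close>
  then have ev: "eventually (\<lambda>t. p (e + 2) t \<noteq> 0 \<and> p (e + 3) t \<noteq> 0) (at t0)"
    unfolding p_def poly_bessel_poly[symmetric] by (intro eventually_conj eventually_poly_nonzero)
  have ev1: "eventually (\<lambda>t. s t \<noteq> 0 \<and> s0 + s t * (k1 * z t (e + 1) + s t * (B t + s t * R t)) = 0) (at t0)"
    using ev
  proof eventually_elim
    case (elim t)
    then have s: "s t \<noteq> 0" using xy by (simp add: s_def)
    \<comment> \<open>By \<open>igm_scale\<close> the parameters \<open>1 / s\<close> and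
      \<open>t / s\<close> produce the powers of \<open>s\<close>; the scalar \<open>?C\<close>
      turns them into the required orders.\<close>
    let ?C = "x * s t ^ (e + 2) / p (e + 2) t"
    have "poly_eval f (\<lambda>i. s t ^ (e + 2 - i) * z t i) = poly_eval f (\<lambda>i. ?C * igm (1 / s t) (t / s t) i)"
    proof (rule poly_eval_cong[OF f])
      fix i assume i: "i \<le> e + 3"
      have ig: "igm (1 / s t) (t / s t) i = (1 / s t) ^ i * p i t"
        using igm_scale[of "1 / s t" 1 t i] by (simp add: p_def)
      show "s t ^ (e + 2 - i) * z t i = ?C * igm (1 / s t) (t / s t) i"
      proof (cases "i \<le> e + 2")
        case True
        then have "s t ^ (e + 2) = s t ^ (e + 2 - i) * s t ^ i" by (simp flip: power_add)
        then show ?thesis unfolding ig z_def using True s by (simp add: field_simps)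
      next
        case False
        then have i: "i = Suc (e + 2)" using i by simp
        have "s t ^ (e + 2) * (1 / s t) ^ i = 1 / s t"
          using s unfolding i by (simp add: power_divide)
        moreover have "?C * igm (1 / s t) (t / s t) i = x * p i t / p (e + 2) t * (s t ^ (e + 2) * (1 / s t) ^ i)"
          unfolding ig by simp
        ultimately have "?C * igm (1 / s t) (t / s t) i = x * p i t / p (e + 2) t * (1 / s t)" by (simp only:)
        also have "\<dots> = y"
        proof -
          have "i = e + 3" using i by simp
          then show ?thesis using elim xy by (simp add: s_def)
        qed
        finally show ?thesis using i by (simp add: z_def)
      qed
    qed
    also have "\<dots> = 0" by (rule cone) (use elim s xy in simp)
    finally show ?case using expand[of t] elim s by simp
  qed
  have z1_lim: "((\<lambda>t. k1 * z t (e + 1)) \<longlongrightarrow> k1 * z t0 (e + 1)) (at t0)"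
    by (intro tendsto_intros z_lim)
  \<comment> \<open>After each coefficient is shown to vanish, the relation is divided by
    \<open>s\<close>, which is nonzero near \<open>t0\<close>.\<close>
  have s0: "s0 = 0"
  proof (rule leading_term_vanishes[OF _ tendsto_const _ s_lim])
    show "eventually (\<lambda>t. s0 + s t * (k1 * z t (e + 1) + s t * (B t + s t * R t)) = 0) (at t0)"
      using ev1 by eventually_elim simp
  qed (rule tendsto_add[OF z1_lim tendsto_mult[OF s_lim tendsto_add[OF B_lim tendsto_mult[OF s_lim R_lim]]]])
  then show "poly_eval f (inf_vec e x y) = 0" by (simp add: s0_def)
  have "k1 * z t0 (e + 1) = 0"
  proof (rule leading_term_vanishes[OF _ z1_lim _ s_lim])
    show "eventually (\<lambda>t. k1 * z t (e + 1) + s t * (B t + s t * R t) = 0) (at t0)"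
      using ev1 by eventually_elim (auto simp: s0)
  qed (rule tendsto_add[OF B_lim tendsto_mult[OF s_lim R_lim]])
  \<comment> \<open>The recurrence is solved backwards from the zero at \<open>e + 3\<close>. As
    also \<open>t0 \<noteq> 0\<close>, the factor \<open>z t0 (e + 1)\<close> is nonzero and
    \<open>k1\<close> must vanish.\<close>
  moreover have p1: "p (e + 1) t0 = - ((2 * of_nat e + 3) * t0) * p (e + 2) t0"
    using t0 igm_step3[of 1 t0 e] unfolding p_def
    by (simp add: eq_neg_iff_add_eq_0 add.commute del: igm.simps)
  moreover have t0nz: "t0 \<noteq> 0" using t0 igm_one_zero[of "e + 3"] by auto
  moreover have z1: "z t0 (e + 1) = - (x * ((2 * of_nat e + 3) * t0))"
  proof -
    have "z t0 (e + 1) = x * p (e + 1) t0 / p (e + 2) t0" by (simp add: z_def)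
    then show ?thesis using p0 unfolding p1 by simp
  qed
  moreover have "(2 * of_nat e + 3 :: complex) \<noteq> 0" using odd_neq_0[of "Suc e"] by (simp add: algebra_simps)
  ultimately have k1: "k1 = 0" using xy by simp
  then show "poly_eval (partial_deriv (e + 1) f) (inf_vec e x y) = 0" by (simp add: k1_def)
  have "B t0 = 0"
  proof (rule leading_term_vanishes[OF _ B_lim R_lim s_lim])
    show "eventually (\<lambda>t. B t + s t * R t = 0) (at t0)"
      using ev1 by eventually_elim (auto simp: s0 k1)
  qed
  \<comment> \<open>One more backward step of the recurrence produces the constant
    \<open>A\<close>.\<close>
  moreover have "z t0 e = x * (1 + A * t0\<^sup>2)"
  proof -
    have "p (e + 2) t0 = (2 * of_nat e + 1) * t0 * p (e + 1) t0 + p e t0"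
      unfolding p_def igm_step by simp
    then have "p e t0 = p (e + 2) t0 * (1 + A * t0\<^sup>2)"
      unfolding p1 A_def by algebra
    then show ?thesis using p0 by (simp add: z_def)
  qed
  ultimately have "x * (k2 * (1 + A * t0\<^sup>2) + square_coeff e f x y * x * ((2 * of_nat e + 3) * t0)\<^sup>2) = 0"
    unfolding B_def z1 by (simp add: algebra_simps power2_eq_square)
  then show "poly_eval (partial_deriv e f) (inf_vec e x y) * (1 + A * t0\<^sup>2) +
       square_coeff e f x y * x * ((2 * of_nat e + 3) * t0)\<^sup>2 = 0"
    using xy by (simp add: k2_def)
qed

text \<open>The expansion needs both coordinates nonzero; shifting both by the same small
  \<open>s\<close> reaches the remaining vectors by continuity.\<close>

lemma poly_eval_inf_vec_continuation:
  assumes "\<And>x y. x \<noteq> 0 \<Longrightarrow> y \<noteq> 0 \<Longrightarrow> poly_eval g (inf_vec e x y) = 0"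
  shows "poly_eval g (inf_vec e x y) = 0"
proof -
  have lim: "((\<lambda>s. inf_vec e (x + s) (y + s) i) \<longlongrightarrow> inf_vec e (x + 0) (y + 0) i) (at 0)" for i
    unfolding inf_vec_def by (cases "i = e + 2"; cases "i = e + 3") (auto intro!: tendsto_eq_intros)
  have "((\<lambda>s. poly_eval g (inf_vec e (x + s) (y + s))) \<longlongrightarrow> poly_eval g (inf_vec e (x + 0) (y + 0))) (at 0)"
    by (rule tendsto_poly_eval[OF lim])
  moreover have "eventually (\<lambda>s. poly [:x, 1:] s \<noteq> 0 \<and> poly [:y, 1:] s \<noteq> 0) (at 0)"
    by (intro eventually_conj eventually_poly_nonzero) simp_all
  then have "eventually (\<lambda>s. poly_eval g (inf_vec e (x + s) (y + s)) = 0) (at 0)"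
    by eventually_elim (simp add: assms)
  then have "((\<lambda>s. poly_eval g (inf_vec e (x + s) (y + s))) \<longlongrightarrow> 0) (at 0)"
    by (rule tendsto_eventually)
  ultimately show ?thesis using tendsto_unique[OF trivial_limit_at] by fastforce
qed

lemma inf_vec_vanish:
  assumes f: "f \<in> polys_upto (e + 3)"
    and cone: "\<And>c \<mu> a. c \<noteq> 0 \<Longrightarrow> poly_eval f (\<lambda>i. c * igm \<mu> a i) = 0"
  shows "poly_eval f (inf_vec e x y) = 0"
proof (rule poly_eval_inf_vec_continuation)
  fix x y :: complex assume "x \<noteq> 0" "y \<noteq> 0"
  moreover obtain t0 where "igm 1 t0 (e + 3) = 0"
    by (rule igm_one_roots_distinct_squares[of "e + 3"]) auto
  ultimately show "poly_eval f (inf_vec e x y) = 0" using inf_vec_expansion(1)[OF f cone] by blast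
qed

text \<open>For \<open>e + 2\<close> and \<open>e + 3\<close> the derivative is taken along the
  line, on which \<open>f\<close> vanishes. Direction \<open>e + 1\<close> is the common tangent of
  the branches. For \<open>e\<close> the second order relation is affine in
  \<open>t\<^sup>2\<close>, and two different values of \<open>t\<^sup>2\<close> force its constant
  term to vanish.\<close>

lemma partial_deriv_inf_vec:
  assumes f: "f \<in> vanishing_ideal (e + 3) (ig_moment_variety (e + 3))" and j: "j \<in> {e, e + 1, e + 2, e + 3}"
  shows "poly_eval (partial_deriv j f) (inf_vec e x y) = 0"
proof -
  have fd: "f \<in> polys_upto (e + 3)" using f by (simp add: vanishing_ideal_def)
  note cone = igm_in_cone[OF f]
  obtain t1 t2 where t: "igm 1 t1 (e + 3) = 0" "igm 1 t2 (e + 3) = 0" "t1\<^sup>2 \<noteq> t2\<^sup>2"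
    by (rule igm_one_roots_distinct_squares[of "e + 3"]) auto
  have vel: "(\<Sum>i\<le>e + 3. poly_eval (partial_deriv i f) (inf_vec e x y) * v i) = 0"
    if "v = unit_vec (e + 2) \<or> v = unit_vec (e + 3)" for v
  proof -
    have "((\<lambda>s. poly_eval f (\<lambda>i. inf_vec e x y i + s * v i)) has_field_derivative
        (\<Sum>i\<le>e + 3. poly_eval (partial_deriv i f) (\<lambda>i. inf_vec e x y i + 0 * v i) * v i)) (at 0)"
      by (rule poly_eval_has_derivative[OF fd]) (auto intro!: derivative_eq_intros)
    moreover have "\<exists>x' y'. (\<lambda>i. inf_vec e x y i + s * v i) = inf_vec e x' y'" for s
      using that
      by (elim disjE; intro exI[of _ "x + s * v (e + 2)"] exI[of _ "y + s * v (e + 3)"])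
         (auto simp: inf_vec_def unit_vec_def fun_eq_iff)
    then have "poly_eval f (\<lambda>i. inf_vec e x y i + s * v i) = 0" for s
      using inf_vec_vanish[OF fd cone] by metis
    ultimately show ?thesis by (auto dest: DERIV_unique[OF _ DERIV_const])
  qed
  have unit: "(\<Sum>i\<le>e + 3. h i * unit_vec k i) = h k" if "k \<le> e + 3" for h k
  proof -
    have "(\<Sum>i\<le>e + 3. h i * unit_vec k i) = (\<Sum>i\<le>e + 3. if i = k then h k else 0)"
      by (intro sum.cong) (auto simp: unit_vec_def)
    then show ?thesis using that by (simp add: sum.delta)
  qed
  consider "j = e + 2" | "j = e + 3" | "j = e + 1" | "j = e" using j by blast
  then show ?thesis
  proof cases
    case 1
    then show ?thesis using vel[of "unit_vec (e + 2)"] unit[of "e + 2"] by simp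
  next
    case 2
    then show ?thesis using vel[of "unit_vec (e + 3)"] unit[of "e + 3"] by simp
  next
    case 3
    then show ?thesis
      using poly_eval_inf_vec_continuation[OF inf_vec_expansion(2)[OF fd cone _ _ t(1)]] by simp
  next
    case 4
    have "poly_eval (partial_deriv e f) (inf_vec e x y) = 0"
    proof (rule poly_eval_inf_vec_continuation)
      fix x y :: complex assume xy: "x \<noteq> 0" "y \<noteq> 0"
      let ?k = "poly_eval (partial_deriv e f) (inf_vec e x y)"
      let ?A = "(2 * of_nat e + 1) * (2 * of_nat e + 3 :: complex)"
      \<comment> \<open>The coefficient of \<open>t\<^sup>2\<close> in the second order relation; it
        does not depend on the root.\<close>
      let ?b = "?k * ?A + square_coeff e f x y * x * (2 * of_nat e + 3)\<^sup>2"
      have eq: "?k + ?b * t\<^sup>2 = 0" if "igm 1 t (e + 3) = 0" for t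
        using inf_vec_expansion(3)[OF fd cone xy that] unfolding power_mult_distrib by (simp add: algebra_simps)
      have "?k + ?b * t1\<^sup>2 = ?k + ?b * t2\<^sup>2" unfolding eq[OF t(1)] eq[OF t(2)] by (rule refl)
      then have "?b * t1\<^sup>2 = ?b * t2\<^sup>2" by (rule add_left_imp_eq)
      then have b: "?b = 0" using t(3) unfolding mult_cancel_left by blast
      show "?k = 0" using eq[OF t(1)] unfolding b by simp
    qed
    then show ?thesis using 4 by simp
  qed
qed

section \<open>The singular locus\<close>

text \<open>If \<open>x 0 = 0\<close>, the recurrence gives \<open>x 1 ^ 4 = 0\<close> but no longer
  controls later entries; \<open>minor_form n\<close> then gives \<open>x (n + 2) ^ 3 = 0\<close>
  from two preceding zeros, up to \<open>d - 2\<close> because it involves \<open>n + 4\<close>. If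
  only \<open>x 1 = 0\<close>, eliminating \<open>a\<close> from consecutive recurrences gives
  \<open>(x (n + 2))\<^sup>2 = 0\<close>, up to \<open>d - 1\<close>.\<close>

lemma ig_point_cases:
  assumes d: "d \<ge> 3" and P: "P \<in> ig_moment_variety d" "x \<in> P"
  shows "x 0 = 0 \<Longrightarrow> i \<le> d - 2 \<Longrightarrow> x i = 0"
    and "x 0 \<noteq> 0 \<Longrightarrow> x 1 = 0 \<Longrightarrow> 1 \<le> i \<Longrightarrow> i < d \<Longrightarrow> x i = 0"
proof -
  have rec: "recurrence_form n x = 0" if "n + 2 \<le> d" for n
    using vanishes_on_ig[OF recurrence_form[OF that] recurrence_form_igm] P by (auto simp: vanishes_on_def)
  have elim: "elimination_form p n x = 0" if "n + 2 \<le> d" "p + 2 \<le> d" for p n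
    using vanishes_on_ig[OF elimination_form[OF that] elimination_form_igm] P by (auto simp: vanishes_on_def)
  have minor: "minor_form n x = 0" if "n + 4 \<le> d" for n
    using vanishes_on_ig[OF minor_form[OF that] minor_form_igm] P by (auto simp: vanishes_on_def)
  show "x i = 0" if x0: "x 0 = 0" and "i \<le> d - 2"
    using that(2)
  proof (induction i rule: induct_nat_012)
    case 0
    show ?case by (rule x0)
  next
    case 1
    have "x 1 ^ 3 * x 1 = 0" using rec[of 1] d x0 by (simp add: recurrence_form_def)
    then show ?case by simp
  next
    case (ge2 n)
    have "n + 4 \<le> d" using ge2(3) d by simp
    moreover have "x n = 0" "x (n + 1) = 0" using ge2 by simp_all
    ultimately have "x (n + 2) * ((2 * of_nat n + 3) * x (n + 2) * x (n + 2)) = 0"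
      using minor[of n] by (simp add: minor_form_def)
    moreover have "(2 * of_nat n + 3 :: complex) \<noteq> 0" using odd_neq_0[of "Suc n"] by (simp add: algebra_simps)
    ultimately show ?case by simp
  qed
  show "x i = 0" if x0: "x 0 \<noteq> 0" "x 1 = 0" and "1 \<le> i" "i < d"
    using that(3,4)
  proof (induction i rule: induct_nat_012)
    case (ge2 n)
    show ?case
    proof (cases n)
      case 0
      have "recurrence_form 1 x = 0" "elimination_form 1 0 x = 0"
        using rec[of 1] elim[of 0 1] d by simp_all
      then have "3 * (x 0)\<^sup>2 * (x 2)\<^sup>2 = 0"
        using x0 by (simp add: elimination_form_def power2_eq_square numeral_2_eq_2)
      then show ?thesis using x0 0 by (simp add: numeral_2_eq_2)
    next
      case (Suc k)
      have "elimination_form (n + 1) n x = 0" using ge2(4) by (intro elim) simp_all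
      moreover have "x (n + 1) = 0" using ge2 Suc by simp
      ultimately have "(2 * of_nat (n + 1) + 1) * ((x 0)\<^sup>2 * x (n + 2) * x (n + 2)) = 0"
        using x0 by (simp add: elimination_form_def mult.assoc)
      then show ?thesis using odd_neq_0[of "n + 1"] x0 by simp
    qed
  qed (use x0 in simp_all)
qed

lemma singular_of_tangent:
  assumes d: "d \<ge> 3" and P: "P \<in> ig_moment_variety d"
    and T: "\<And>f x j. f \<in> vanishing_ideal d (ig_moment_variety d) \<Longrightarrow> x \<in> P \<Longrightarrow> j \<in> {d - 3..d} \<Longrightarrow>
       poly_eval (partial_deriv j f) x = 0"
  shows "P \<in> singular_locus d (ig_moment_variety d)"
proof -
  let ?V = "tangent_subspace d (ig_moment_variety d) P"
  have "unit_vec ` {d - 3..d} \<subseteq> ?V" using T by (auto intro!: unit_vec_tangent)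
  moreover have "?V \<subseteq> cvecs d" by (auto simp: tangent_subspace_def)
  ultimately have "card {d - 3..d} \<le> cfun.dim ?V" by (intro dim_ge_card_unit_vecs) auto
  then have "4 \<le> cfun.dim ?V" using d by simp
  moreover have "local_dim (subtopology (zariski d) (ig_moment_variety d)) P + 1 \<le> 2 + 1"
    by (intro add_right_mono local_dim_ig_le)
  moreover have "(2 + 1 :: enat) < enat 4" by (simp add: numeral_eq_enat one_enat_def)
  ultimately have "local_dim (subtopology (zariski d) (ig_moment_variety d)) P + 1 < enat (cfun.dim ?V)"
    by (meson enat_ord_simps(1) le_less_trans less_le_trans)
  then show ?thesis using P by (simp add: singular_locus_def)
qed

lemma not_singular_of_dims:
  assumes "2 \<le> local_dim (subtopology (zariski d) (ig_moment_variety d)) P"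
    and "cfun.dim (tangent_subspace d (ig_moment_variety d) P) \<le> 3"
  shows "P \<notin> singular_locus d (ig_moment_variety d)"
proof -
  have "enat (cfun.dim (tangent_subspace d (ig_moment_variety d) P)) \<le> enat 3" using assms(2) by simp
  also have "enat 3 = 2 + 1" by (simp add: numeral_eq_enat one_enat_def)
  also have "\<dots> \<le> local_dim (subtopology (zariski d) (ig_moment_variety d)) P + 1"
    using assms(1) by (intro add_right_mono)
  finally show ?thesis by (simp add: singular_locus_def not_less)
qed

lemma inf_point_eq_inf_vec:
  assumes "P \<in> proj_space (e + 3)" "x \<in> P" "\<And>i. i \<le> e + 1 \<Longrightarrow> x i = 0"
  shows "x = inf_vec e (x (e + 2)) (x (e + 3))"
proof
  fix i
  consider "i \<le> e + 1" | "i = e + 2" | "i = e + 3" | "i > e + 3" by linarith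
  then show "x i = inf_vec e (x (e + 2)) (x (e + 3)) i"
    using assms(3) proj_space_memD(1)[OF assms(1,2)] by cases (auto simp: inf_vec_def cvecs_def)
qed

text \<open>That the line lies in X is part of the claim; it comes from the order 0 term of the
  expansion, through \<open>inf_vec_vanish\<close>.\<close>

lemma inf_point_singular:
  assumes d: "d \<ge> 3" and P: "P \<in> proj_space d" "\<And>x i. x \<in> P \<Longrightarrow> i \<le> d - 2 \<Longrightarrow> x i = 0"
  shows "P \<in> singular_locus d (ig_moment_variety d)"
proof -
  obtain e where e: "d = e + 3" using d by (metis add.commute le_Suc_ex)
  have Px: "x = inf_vec e (x (e + 2)) (x (e + 3))" if "x \<in> P" for x
    using inf_point_eq_inf_vec[of P e x] P that by (simp add: e)
  have "g x = 0" if g: "g \<in> forms (e + 3) k" "\<forall>h\<in>igms. g h = 0" and x: "x \<in> P" for g k x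
  proof -
    obtain f where f: "g = poly_eval f" "f \<in> polys_upto (e + 3)" using formsE[OF g(1)] by blast
    have "poly_eval f (inf_vec e (x (e + 2)) (x (e + 3))) = 0"
    proof (rule inf_vec_vanish[OF f(2)])
      fix c \<mu> a
      have "g (igm \<mu> a) = 0" using g(2) unfolding igms_def by blast
      then have "g (cscale c (igm \<mu> a)) = 0" using forms_scale[OF g(1)] by simp
      then show "poly_eval f (\<lambda>i. c * igm \<mu> a i) = 0" by (simp add: f(1) cscale_def)
    qed
    then show ?thesis using Px[OF x] f(1) by metis
  qed
  then have PX: "P \<in> ig_moment_variety d"
    using P(1) unfolding ig_moment_variety_eq proj_closure_def e by blast
  show ?thesis
  proof (rule singular_of_tangent[OF d PX])
    fix f x j assume f: "f \<in> vanishing_ideal d (ig_moment_variety d)" "x \<in> P" "j \<in> {d - 3..d}"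
    have "j \<in> {e, e + 1, e + 2, e + 3}" using f(3) e by auto
    then show "poly_eval (partial_deriv j f) x = 0"
      using partial_deriv_inf_vec[of f e j] f(1) Px[OF f(2)] unfolding e by metis
  qed
qed

lemma first_point_singular:
  assumes d: "d \<ge> 3" and P: "P \<in> proj_space d" "\<And>x i. x \<in> P \<Longrightarrow> i \<in> {1..d} \<Longrightarrow> x i = 0"
  shows "P \<in> singular_locus d (ig_moment_variety d)"
proof -
  have Px: "x = (\<lambda>i. if i = 0 then x 0 else 0)" "x 0 \<noteq> 0" if x: "x \<in> P" for x
  proof -
    show "x = (\<lambda>i. if i = 0 then x 0 else 0)"
    proof
      fix i
      show "x i = (if i = 0 then x 0 else 0)"
        using P(2)[OF x, of i] proj_space_memD(1)[OF P(1) x] by (cases "i \<le> d") (auto simp: cvecs_def)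
    qed
    obtain i where "i \<le> d" "x i \<noteq> 0" using proj_space_memD(3)[OF P(1) x] by blast
    then show "x 0 \<noteq> 0" using P(2)[OF x, of i] by (cases "i = 0") auto
  qed
  obtain x where x: "x \<in> P" using proj_space_nonempty[OF P(1)] by blast
  have "P \<in> proj_closure d igms"
  proof (rule proj_closure_memI(1)[OF P(1) x _ Px(2)[OF x]])
    show "igm 0 0 \<in> igms" unfolding igms_def by blast
    show "x i = x 0 * igm 0 0 i" if "i \<le> d" for i
      using fun_cong[OF Px(1)[OF x], of i] by (simp add: igm_mu_zero split: if_splits)
  qed
  then have PX: "P \<in> ig_moment_variety d" by (simp add: ig_moment_variety_eq)
  show ?thesis
  proof (rule singular_of_tangent[OF d PX])
    fix f x j assume f: "f \<in> vanishing_ideal d (ig_moment_variety d)" "x \<in> P" "j \<in> {d - 3..d}"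
    have "poly_eval (partial_deriv j f) (\<lambda>i. if i = 0 then x 0 else 0) = 0"
      using partial_deriv_first_point[OF f(1) Px(2)[OF f(2)], of j] f(3) by simp
    then show "poly_eval (partial_deriv j f) x = 0"
      by (simp only: Px(1)[OF f(2), symmetric])
  qed
qed

theorem proposition3p6:
  fixes d :: nat
  assumes "d \<ge> 3"
  shows "singular_locus d (ig_moment_variety d) =
    {P \<in> proj_space d. \<forall>x\<in>P. \<forall>i\<le>d - 2. x i = 0} \<union>
    {P \<in> proj_space d. \<forall>x\<in>P. \<forall>i\<in>{1..d}. x i = 0}"
proof (intro equalityI subsetI)
  fix P assume S: "P \<in> singular_locus d (ig_moment_variety d)"
  then have PX: "P \<in> ig_moment_variety d" by (simp add: singular_locus_def)
  have Psp: "P \<in> proj_space d" by (rule ig_in_space[OF PX])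
  show "P \<in> {P \<in> proj_space d. \<forall>x\<in>P. \<forall>i\<le>d - 2. x i = 0} \<union>
    {P \<in> proj_space d. \<forall>x\<in>P. \<forall>i\<in>{1..d}. x i = 0}"
  proof (rule ccontr)
    assume "\<not> ?thesis"
    then obtain x i y j where x: "x \<in> P" "i \<le> d - 2" "x i \<noteq> 0" and y: "y \<in> P" "j \<in> {1..d}" "y j \<noteq> 0"
      using Psp by blast
    \<comment> \<open>The two failures may occur at different representatives; both are transferred
      to \<open>x\<close>.\<close>
    obtain c where c: "y = cscale c x" using proj_space_scale[OF Psp x(1) y(1)] by blast
    have x0: "x 0 \<noteq> 0" using ig_point_cases(1)[OF assms PX x(1) _ x(2)] x(3) by blast
    have xj: "x j \<noteq> 0" using y(3) by (auto simp: c cscale_def)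
    show False
    proof (cases "x 1 = 0")
      case True
      note z = ig_point_cases(2)[OF assms PX x(1) x0 True]
      \<comment> \<open>Some coordinate of index at least 1 is nonzero, and those strictly between 0
        and \<open>d\<close> vanish.\<close>
      have "x d \<noteq> 0" using z[of j] xj y(2) by (cases "j = d") auto
      then show False
        using S not_singular_of_dims[OF local_dim_line[OF assms PX x(1) x0 z]
          tangent_dim_line[OF assms PX x(1) x0 _ z]] by blast
    next
      case False
      then show False
        using S not_singular_of_dims[OF local_dim_affine[OF assms PX x(1) x0 False]
          tangent_dim_affine[OF assms PX x(1) x0 False]] by blast
    qed
  qed
next
  fix P assume "P \<in> {P \<in> proj_space d. \<forall>x\<in>P. \<forall>i\<le>d - 2. x i = 0} \<union>
    {P \<in> proj_space d. \<forall>x\<in>P. \<forall>i\<in>{1..d}. x i = 0}"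
  then show "P \<in> singular_locus d (ig_moment_variety d)"
    using inf_point_singular[OF assms, of P] first_point_singular[OF assms, of P] by blast
qed

end
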